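(* Let $\kappa$ be a field, $G$ a group and $\sigma\in pm(G)$ a factor set. Let $\mathcal{I}_\sigma$ be the ideal of the commutative algebra $B$ generated by the elements (i) $e_s e_{sg} e_{sgh}$, for all $s,g,h\in G$ with $\sigma(g,h)=0$; (ii) $e_s e_{sg} e_{sgh} e_{sght}$, for all $s,g,h,t\in G$ with $\sigma(g,h)\sigma(gh,t)\neq\sigma(g,ht)\sigma(h,t)$. Then $B/\mathcal{I}_\sigma\cong B^\sigma$ as $\kappa$-algebras.
   Context: Algebras are associative and unital, and homomorphisms preserve the unit. A partial projective $\sigma$-representation of $G$ in a unital $\kappa$-algebra $R$ (with $1_R\neq 0$) is a map $\Gamma:G\to R$ for which there is a function $\sigma:G\times G\to\kappa$ (called the factor set) such that for all $g,h\in G$: (i) if $\sigma(g,h)=0$ then $\Gamma(g^{-1})\Gamma(gh)=0$ and $\Gamma(gh)\Gamma(h^{-1})=0$; (ii) if $\Gamma(g)\Gamma(h)=0$ then $\sigma(g,h)=0$; (iii) $\Gamma(1_G)=1_R$; (iv) $\Gamma(g^{-1})\Gamma(g)\Gamma(h)=\sigma(g,h)\Gamma(g^{-1})\Gamma(gh)$; (v) $\Gamma(g)\Gamma(h)\Gamma(h^{-1})=\sigma(g,h)\Gamma(gh)\Gamma(h^{-1})$. The set of all factor sets of $G$ (over all such $R$ and $\Gamma$) is $pm(G)$. For $\sigma\in pm(G)$, the twisted partial group algebra $\kappa_{par}^{\sigma}G$ is the universal $\kappa$-algebra generated by symbols $[g]^\sigma$ ($g\in G$) subject to, for all $g,h\in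 G$: $\sigma(g,h)=0\Rightarrow [g^{-1}]^\sigma[gh]^\sigma=[gh]^\sigma[h^{-1}]^\sigma=0$; $[g^{-1}]^\sigma[g]^\sigma[h]^\sigma=\sigma(g,h)[g^{-1}]^\sigma[gh]^\sigma$; $[g]^\sigma[h]^\sigma[h^{-1}]^\sigma=\sigma(g,h)[gh]^\sigma[h^{-1}]^\sigma$; $[g]^\sigma[1_G]^\sigma=[1_G]^\sigma[g]^\sigma=[g]^\sigma$. Put $e_g^\sigma:=\sigma(g,g^{-1})^{-1}[g]^\sigma[g^{-1}]^\sigma$ if $\sigma(g,g^{-1})\neq0$ and $e_g^\sigma:=0$ otherwise. $B^\sigma$ is the (commutative) subalgebra of $\kappa_{par}^\sigma G$ generated by the idempotents $e_g^\sigma$, $g\in G$. For $\sigma$ identically equal to $1$ one writes $\kappa_{par}G$, $[g]$, $e_g=[g][g^{-1}]$ and $B$ instead of $\kappa_{par}^\sigma G$, $[g]^\sigma$, $e_g^\sigma$ and $B^\sigma$. *)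

theory Defs
  imports "HOL-Algebra.Module" "HOL-Algebra.QuotRing" "HOL-Algebra.Subrings"
begin

section \<open>Associative unital algebras\<close>

text \<open>The library locale \<open>algebra\<close> only covers commutative algebras.\<close>

locale assoc_algebra = module K A + ring A
  for K :: "('k, 'm) ring_scheme" (structure) and A :: "('k, 'a, 'n) module_scheme" (structure) +
  assumes smult_mult_left:
      "\<lbrakk>a \<in> carrier K; x \<in> carrier A; y \<in> carrier A\<rbrakk>
        \<Longrightarrow> (a \<odot>\<^bsub>A\<^esub> x) \<otimes>\<^bsub>A\<^esub> y = a \<odot>\<^bsub>A\<^esub> (x \<otimes>\<^bsub>A\<^esub> y)"
    and smult_mult_right:
      "\<lbrakk>a \<in> carrier K; x \<in> carrier A; y \<in> carrier A\<rbrakk>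
        \<Longrightarrow> x \<otimes>\<^bsub>A\<^esub> (a \<odot>\<^bsub>A\<^esub> y) = a \<odot>\<^bsub>A\<^esub> (x \<otimes>\<^bsub>A\<^esub> y)"

definition alg_iso ::
    "('k, 'm) ring_scheme \<Rightarrow> ('k, 'a, 'n) module_scheme \<Rightarrow> ('k, 'b, 'o) module_scheme \<Rightarrow> ('a \<Rightarrow> 'b) set"
  where "alg_iso K A B =
    {f \<in> ring_iso A B. \<forall>a\<in>carrier K. \<forall>x\<in>carrier A. f (a \<odot>\<^bsub>A\<^esub> x) = a \<odot>\<^bsub>B\<^esub> f x}"

definition generated_subalgebra ::
    "('k, 'm) ring_scheme \<Rightarrow> ('k, 'a, 'n) module_scheme \<Rightarrow> 'a set \<Rightarrow> 'a set"
  where "generated_subalgebra K A S = \<Inter>{H. subring H A \<and> submodule H K A \<and> S \<subseteq> H}"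

text \<open>The scalar multiplication on cosets follows the pattern of \<open>rcoset_mult\<close>:
  for an ideal all summands of the union coincide.\<close>

definition quotient_algebra ::
    "('k, 'a, 'n) module_scheme \<Rightarrow> 'a set \<Rightarrow> ('k, 'a set) module"
  where "quotient_algebra A I =
    \<lparr>carrier = carrier (A Quot I), mult = mult (A Quot I), one = one (A Quot I),
     zero = zero (A Quot I), add = add (A Quot I),
     smult = (\<lambda>a X. \<Union>x\<in>X. I +>\<^bsub>A\<^esub> (a \<odot>\<^bsub>A\<^esub> x))\<rparr>"

text \<open>The free associative unital algebra on \<open>X\<close>: finitely supported coefficient functions on
  the words over \<open>X\<close>, with product extending concatenation of words.\<close>

definition free_algebra ::
    "('k, 'm) ring_scheme \<Rightarrow> 'g set \<Rightarrow> ('k, 'g list \<Rightarrow> 'k) module"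
  where "free_algebra K X =
    \<lparr>carrier = {p. (\<forall>w. p w \<in> carrier K) \<and> finite {w. p w \<noteq> \<zero>\<^bsub>K\<^esub>} \<and> {w. p w \<noteq> \<zero>\<^bsub>K\<^esub>} \<subseteq> lists X},
     mult = (\<lambda>p q w. \<Oplus>\<^bsub>K\<^esub>i\<in>{..length w}. p (take i w) \<otimes>\<^bsub>K\<^esub> q (drop i w)),
     one = (\<lambda>w. if w = [] then \<one>\<^bsub>K\<^esub> else \<zero>\<^bsub>K\<^esub>),
     zero = (\<lambda>w. \<zero>\<^bsub>K\<^esub>),
     add = (\<lambda>p q w. p w \<oplus>\<^bsub>K\<^esub> q w),
     smult = (\<lambda>a p w. a \<otimes>\<^bsub>K\<^esub> p w)\<rparr>"

definition free_gen :: "('k, 'm) ring_scheme \<Rightarrow> 'g \<Rightarrow> 'g list \<Rightarrow> 'k"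
  where "free_gen K g = (\<lambda>w. if w = [g] then \<one>\<^bsub>K\<^esub> else \<zero>\<^bsub>K\<^esub>)"


section \<open>Partial projective representations and their factor sets\<close>

definition partial_proj_rep ::
    "('k, 'm) ring_scheme \<Rightarrow> ('g, 'n) monoid_scheme \<Rightarrow> ('k, 'r) module
      \<Rightarrow> ('g \<Rightarrow> 'r) \<Rightarrow> ('g \<Rightarrow> 'g \<Rightarrow> 'k) \<Rightarrow> bool"
  where "partial_proj_rep K G R \<Gamma> \<sigma> \<longleftrightarrow>
    assoc_algebra K R \<and> \<one>\<^bsub>R\<^esub> \<noteq> \<zero>\<^bsub>R\<^esub> \<and>
    \<Gamma> \<in> carrier G \<rightarrow> carrier R \<and>
    \<sigma> \<in> carrier G \<rightarrow> carrier G \<rightarrow> carrier K \<and>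
    \<Gamma> \<one>\<^bsub>G\<^esub> = \<one>\<^bsub>R\<^esub> \<and>
    (\<forall>g\<in>carrier G. \<forall>h\<in>carrier G.
      (\<sigma> g h = \<zero>\<^bsub>K\<^esub> \<longrightarrow>
        \<Gamma> (inv\<^bsub>G\<^esub> g) \<otimes>\<^bsub>R\<^esub> \<Gamma> (g \<otimes>\<^bsub>G\<^esub> h) = \<zero>\<^bsub>R\<^esub> \<and>
        \<Gamma> (g \<otimes>\<^bsub>G\<^esub> h) \<otimes>\<^bsub>R\<^esub> \<Gamma> (inv\<^bsub>G\<^esub> h) = \<zero>\<^bsub>R\<^esub>) \<and>
      (\<Gamma> g \<otimes>\<^bsub>R\<^esub> \<Gamma> h = \<zero>\<^bsub>R\<^esub> \<longrightarrow> \<sigma> g h = \<zero>\<^bsub>K\<^esub>) \<and>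
      \<Gamma> (inv\<^bsub>G\<^esub> g) \<otimes>\<^bsub>R\<^esub> \<Gamma> g \<otimes>\<^bsub>R\<^esub> \<Gamma> h
        = \<sigma> g h \<odot>\<^bsub>R\<^esub> (\<Gamma> (inv\<^bsub>G\<^esub> g) \<otimes>\<^bsub>R\<^esub> \<Gamma> (g \<otimes>\<^bsub>G\<^esub> h)) \<and>
      \<Gamma> g \<otimes>\<^bsub>R\<^esub> \<Gamma> h \<otimes>\<^bsub>R\<^esub> \<Gamma> (inv\<^bsub>G\<^esub> h)
        = \<sigma> g h \<odot>\<^bsub>R\<^esub> (\<Gamma> (g \<otimes>\<^bsub>G\<^esub> h) \<otimes>\<^bsub>R\<^esub> \<Gamma> (inv\<^bsub>G\<^esub> h)))"

text \<open>An existential quantifier cannot range over all types, so the type \<open>'r\<close> of the elements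
  of \<open>R\<close> is a parameter. A theorem with a hypothesis \<open>\<sigma> \<in> pm TYPE('r) K G\<close> in which
  \<open>'r\<close> is a type variable covers algebras \<open>R\<close> over every type. The values of \<open>\<sigma>\<close> outside
  \<open>carrier G\<close> are irrelevant.\<close>

definition pm ::
    "'r itself \<Rightarrow> ('k, 'm) ring_scheme \<Rightarrow> ('g, 'n) monoid_scheme \<Rightarrow> ('g \<Rightarrow> 'g \<Rightarrow> 'k) set"
  where "pm TYPE('r) K G =
    {\<sigma>. \<exists>(R :: ('k, 'r) module) \<Gamma>. partial_proj_rep K G R \<Gamma> \<sigma>}"


section \<open>Twisted partial group algebras\<close>

text \<open>The last set of relators makes the symbol of the neutral element the unit of the algebra, as
  intended by \<open>[g][1] = [1][g] = [g]\<close> for an algebra generated by the symbols: in a free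
  \<^emph>\<open>unital\<close> algebra those relations alone would leave \<open>1 - [1]\<close> as a spurious central idempotent.\<close>

definition twisted_relators ::
    "('k, 'm) ring_scheme \<Rightarrow> ('g, 'n) monoid_scheme \<Rightarrow> ('g \<Rightarrow> 'g \<Rightarrow> 'k) \<Rightarrow> ('g list \<Rightarrow> 'k) set"
  where "twisted_relators K G \<sigma> =
    (let F = free_algebra K (carrier G); x = free_gen K in
      {x (inv\<^bsub>G\<^esub> g) \<otimes>\<^bsub>F\<^esub> x (g \<otimes>\<^bsub>G\<^esub> h) | g h.
         g \<in> carrier G \<and> h \<in> carrier G \<and> \<sigma> g h = \<zero>\<^bsub>K\<^esub>}
      \<union> {x (g \<otimes>\<^bsub>G\<^esub> h) \<otimes>\<^bsub>F\<^esub> x (inv\<^bsub>G\<^esub> h) | g h.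
         g \<in> carrier G \<and> h \<in> carrier G \<and> \<sigma> g h = \<zero>\<^bsub>K\<^esub>}
      \<union> {x (inv\<^bsub>G\<^esub> g) \<otimes>\<^bsub>F\<^esub> x g \<otimes>\<^bsub>F\<^esub> x h
           \<ominus>\<^bsub>F\<^esub> \<sigma> g h \<odot>\<^bsub>F\<^esub> (x (inv\<^bsub>G\<^esub> g) \<otimes>\<^bsub>F\<^esub> x (g \<otimes>\<^bsub>G\<^esub> h)) | g h.
         g \<in> carrier G \<and> h \<in> carrier G}
      \<union> {x g \<otimes>\<^bsub>F\<^esub> x h \<otimes>\<^bsub>F\<^esub> x (inv\<^bsub>G\<^esub> h)
           \<ominus>\<^bsub>F\<^esub> \<sigma> g h \<odot>\<^bsub>F\<^esub> (x (g \<otimes>\<^bsub>G\<^esub> h) \<otimes>\<^bsub>F\<^esub> x (inv\<^bsub>G\<^esub> h)) | g h.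
         g \<in> carrier G \<and> h \<in> carrier G}
      \<union> {x g \<otimes>\<^bsub>F\<^esub> x \<one>\<^bsub>G\<^esub> \<ominus>\<^bsub>F\<^esub> x g | g. g \<in> carrier G}
      \<union> {x \<one>\<^bsub>G\<^esub> \<otimes>\<^bsub>F\<^esub> x g \<ominus>\<^bsub>F\<^esub> x g | g. g \<in> carrier G}
      \<union> {x \<one>\<^bsub>G\<^esub> \<ominus>\<^bsub>F\<^esub> \<one>\<^bsub>F\<^esub>})"

definition twisted_ideal ::
    "('k, 'm) ring_scheme \<Rightarrow> ('g, 'n) monoid_scheme \<Rightarrow> ('g \<Rightarrow> 'g \<Rightarrow> 'k) \<Rightarrow> ('g list \<Rightarrow> 'k) set"
  where "twisted_ideal K G \<sigma> = Idl\<^bsub>free_algebra K (carrier G)\<^esub> (twisted_relators K G \<sigma>)"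

definition twisted_par_algebra ::
    "('k, 'm) ring_scheme \<Rightarrow> ('g, 'n) monoid_scheme \<Rightarrow> ('g \<Rightarrow> 'g \<Rightarrow> 'k)
      \<Rightarrow> ('k, ('g list \<Rightarrow> 'k) set) module"
  where "twisted_par_algebra K G \<sigma> =
    quotient_algebra (free_algebra K (carrier G)) (twisted_ideal K G \<sigma>)"

definition twisted_gen ::
    "('k, 'm) ring_scheme \<Rightarrow> ('g, 'n) monoid_scheme \<Rightarrow> ('g \<Rightarrow> 'g \<Rightarrow> 'k)
      \<Rightarrow> 'g \<Rightarrow> ('g list \<Rightarrow> 'k) set"
  where "twisted_gen K G \<sigma> g =
    twisted_ideal K G \<sigma> +>\<^bsub>free_algebra K (carrier G)\<^esub> free_gen K g"

definition twisted_idem ::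
    "('k, 'm) ring_scheme \<Rightarrow> ('g, 'n) monoid_scheme \<Rightarrow> ('g \<Rightarrow> 'g \<Rightarrow> 'k)
      \<Rightarrow> 'g \<Rightarrow> ('g list \<Rightarrow> 'k) set"
  where "twisted_idem K G \<sigma> g =
    (let A = twisted_par_algebra K G \<sigma> in
      if \<sigma> g (inv\<^bsub>G\<^esub> g) \<noteq> \<zero>\<^bsub>K\<^esub>
      then (inv\<^bsub>K\<^esub> (\<sigma> g (inv\<^bsub>G\<^esub> g)))
             \<odot>\<^bsub>A\<^esub> (twisted_gen K G \<sigma> g \<otimes>\<^bsub>A\<^esub> twisted_gen K G \<sigma> (inv\<^bsub>G\<^esub> g))
      else \<zero>\<^bsub>A\<^esub>)"

definition twisted_B ::
    "('k, 'm) ring_scheme \<Rightarrow> ('g, 'n) monoid_scheme \<Rightarrow> ('g \<Rightarrow> 'g \<Rightarrow> 'k)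
      \<Rightarrow> ('k, ('g list \<Rightarrow> 'k) set) module"
  where "twisted_B K G \<sigma> =
    (twisted_par_algebra K G \<sigma>)
      \<lparr>carrier := generated_subalgebra K (twisted_par_algebra K G \<sigma>)
                    (twisted_idem K G \<sigma> ` carrier G)\<rparr>"


section \<open>The untwisted case\<close>

abbreviation trivial_factor :: "('k, 'm) ring_scheme \<Rightarrow> 'g \<Rightarrow> 'g \<Rightarrow> 'k"
  where "trivial_factor K \<equiv> (\<lambda>g h. \<one>\<^bsub>K\<^esub>)"

definition par_algebra ::
    "('k, 'm) ring_scheme \<Rightarrow> ('g, 'n) monoid_scheme \<Rightarrow> ('k, ('g list \<Rightarrow> 'k) set) module"
  where "par_algebra K G = twisted_par_algebra K G (trivial_factor K)"

definition par_gen ::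
    "('k, 'm) ring_scheme \<Rightarrow> ('g, 'n) monoid_scheme \<Rightarrow> 'g \<Rightarrow> ('g list \<Rightarrow> 'k) set"
  where "par_gen K G = twisted_gen K G (trivial_factor K)"

definition par_idem ::
    "('k, 'm) ring_scheme \<Rightarrow> ('g, 'n) monoid_scheme \<Rightarrow> 'g \<Rightarrow> ('g list \<Rightarrow> 'k) set"
  where "par_idem K G g = par_gen K G g \<otimes>\<^bsub>par_algebra K G\<^esub> par_gen K G (inv\<^bsub>G\<^esub> g)"

definition par_B ::
    "('k, 'm) ring_scheme \<Rightarrow> ('g, 'n) monoid_scheme \<Rightarrow> ('k, ('g list \<Rightarrow> 'k) set) module"
  where "par_B K G =
    (par_algebra K G)
      \<lparr>carrier := generated_subalgebra K (par_algebra K G) (par_idem K G ` carrier G)\<rparr>"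

definition factor_ideal ::
    "('k, 'm) ring_scheme \<Rightarrow> ('g, 'n) monoid_scheme \<Rightarrow> ('g \<Rightarrow> 'g \<Rightarrow> 'k)
      \<Rightarrow> ('g list \<Rightarrow> 'k) set set"
  where "factor_ideal K G \<sigma> =
    (let B = par_B K G; e = par_idem K G in
      Idl\<^bsub>B\<^esub>
        ({e s \<otimes>\<^bsub>B\<^esub> e (s \<otimes>\<^bsub>G\<^esub> g) \<otimes>\<^bsub>B\<^esub> e (s \<otimes>\<^bsub>G\<^esub> g \<otimes>\<^bsub>G\<^esub> h) | s g h.
            s \<in> carrier G \<and> g \<in> carrier G \<and> h \<in> carrier G \<and> \<sigma> g h = \<zero>\<^bsub>K\<^esub>}
         \<union> {e s \<otimes>\<^bsub>B\<^esub> e (s \<otimes>\<^bsub>G\<^esub> g) \<otimes>\<^bsub>B\<^esub> e (s \<otimes>\<^bsub>G\<^esub> g \<otimes>\<^bsub>G\<^esub> h)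
               \<otimes>\<^bsub>B\<^esub> e (s \<otimes>\<^bsub>G\<^esub> g \<otimes>\<^bsub>G\<^esub> h \<otimes>\<^bsub>G\<^esub> t) | s g h t.
            s \<in> carrier G \<and> g \<in> carrier G \<and> h \<in> carrier G \<and> t \<in> carrier G \<and>
            \<sigma> g h \<otimes>\<^bsub>K\<^esub> \<sigma> (g \<otimes>\<^bsub>G\<^esub> h) t \<noteq> \<sigma> g (h \<otimes>\<^bsub>G\<^esub> t) \<otimes>\<^bsub>K\<^esub> \<sigma> h t}))"

end

theory Submission
  imports Defs
begin

text \<open>
  Both algebras are images of the free algebra \<open>F\<close> on \<open>G\<close>, a letter \<open>g\<close> being sent to the idempotent
  indexed by \<open>g\<close>, and the two kernels coincide. Let \<open>X\<close> be the set of all \<open>S \<subseteq> G\<close> containing \<open>1\<close>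
  such that no \<open>{s, sg, sgh} \<subseteq> S\<close> has \<open>\<sigma>(g,h) = 0\<close> and no \<open>{s, sg, sgh, sght} \<subseteq> S\<close> violates
  the cocycle identity at \<open>(g,h,t)\<close>. An element \<open>p\<close> of \<open>F\<close> lies in either kernel if and only if
  \<open>\<Sum> p(w) = 0\<close> for every finite \<open>S \<in> X\<close>, summing over the words \<open>w\<close> with letters in \<open>S\<close>.

  If the sums vanish, then by Moebius inversion (\<open>X\<close> is closed under subsets containing \<open>1\<close>) the
  coefficient of the product of the idempotents over \<open>S\<close> vanishes for all \<open>S \<in> X\<close>, and for
  \<open>S \<notin> X\<close> the product itself is zero. Conversely, for \<open>S \<in> X\<close> the regular representation twisted by
  \<open>\<sigma>\<close> restricts to the functions on \<open>S\<close>, and there each idempotent indexed by \<open>g\<close> acts on the value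
  at \<open>1\<close> by the scalar \<open>1\<close> if \<open>g \<in> S\<close> and \<open>0\<close> otherwise. The case \<open>\<sigma> = 1\<close> gives the
  relations of \<open>B\<close>, and the generators of the ideal are products over sets outside \<open>X\<close>.
\<close>

section \<open>Algebra homomorphisms, quotients and subalgebras\<close>

text \<open>The obstacle is that neither algebra comes with a presentation by its idempotents. Both
  are subalgebras of algebras given by generators and relations, and sending the symbol [g] to its
  twisted counterpart does not respect those relations in general, so no homomorphism can be
  inherited from the ambient algebras. Computing the two kernels in the free algebra amounts to
  finding the missing presentation. That a product of idempotents vanishes is a calculation with the
  relations. That something does not vanish in an algebra defined by relations needs a model, and
  this is the purpose of the regular representation. On all of G the twisted shifts would require
  \<sigma> to be a 2-cocycle without zeros; restricting to functions on S leaves only configurations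
  inside S, where the definition of the spectrum makes \<sigma> behave like one. The condition that
  1 lies in S mirrors the fact that the idempotent indexed by 1 is the unit; it also supplies the
  point at which the operators are evaluated. Finite S suffice because an element of the free
  algebra involves only finitely many words.\<close>

definition alg_hom ::
    "('k, 'm) ring_scheme \<Rightarrow> ('k, 'a, 'n) module_scheme \<Rightarrow> ('k, 'b, 'o) module_scheme \<Rightarrow> ('a \<Rightarrow> 'b) set"
  where "alg_hom K A B =
    {f \<in> ring_hom A B. \<forall>a\<in>carrier K. \<forall>x\<in>carrier A. f (a \<odot>\<^bsub>A\<^esub> x) = a \<odot>\<^bsub>B\<^esub> f x}"

lemma alg_homI:
  assumes "\<And>x. x \<in> carrier A \<Longrightarrow> f x \<in> carrier B"
    and "\<And>x y. \<lbrakk>x \<in> carrier A; y \<in> carrier A\<rbrakk> \<Longrightarrow> f (x \<otimes>\<^bsub>A\<^esub> y) = f x \<otimes>\<^bsub>B\<^esub> f y"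
    and "\<And>x y. \<lbrakk>x \<in> carrier A; y \<in> carrier A\<rbrakk> \<Longrightarrow> f (x \<oplus>\<^bsub>A\<^esub> y) = f x \<oplus>\<^bsub>B\<^esub> f y"
    and "f \<one>\<^bsub>A\<^esub> = \<one>\<^bsub>B\<^esub>"
    and "\<And>a x. \<lbrakk>a \<in> carrier K; x \<in> carrier A\<rbrakk> \<Longrightarrow> f (a \<odot>\<^bsub>A\<^esub> x) = a \<odot>\<^bsub>B\<^esub> f x"
  shows "f \<in> alg_hom K A B"
  using assms by (simp add: alg_hom_def ring_hom_def Pi_def)

lemma alg_homD:
  assumes "f \<in> alg_hom K A B"
  shows "\<And>x. x \<in> carrier A \<Longrightarrow> f x \<in> carrier B"
    and "\<And>x y. \<lbrakk>x \<in> carrier A; y \<in> carrier A\<rbrakk> \<Longrightarrow> f (x \<otimes>\<^bsub>A\<^esub> y) = f x \<otimes>\<^bsub>B\<^esub> f y"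
    and "\<And>x y. \<lbrakk>x \<in> carrier A; y \<in> carrier A\<rbrakk> \<Longrightarrow> f (x \<oplus>\<^bsub>A\<^esub> y) = f x \<oplus>\<^bsub>B\<^esub> f y"
    and "f \<one>\<^bsub>A\<^esub> = \<one>\<^bsub>B\<^esub>"
    and "\<And>a x. \<lbrakk>a \<in> carrier K; x \<in> carrier A\<rbrakk> \<Longrightarrow> f (a \<odot>\<^bsub>A\<^esub> x) = a \<odot>\<^bsub>B\<^esub> f x"
  using assms by (auto simp add: alg_hom_def ring_hom_def)

lemma alg_hom_ring_hom_ring:
  assumes "assoc_algebra K A" "assoc_algebra K B" "f \<in> alg_hom K A B"
  shows "ring_hom_ring A B f"
  using assms by (simp add: alg_hom_def assoc_algebra_def ring_hom_ringI2)

lemma alg_hom_compose: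
  assumes "f \<in> alg_hom K A B" "g \<in> alg_hom K B C"
  shows "(\<lambda>x. g (f x)) \<in> alg_hom K A C"
  by (rule alg_homI) (simp_all add: alg_homD[OF assms(1)] alg_homD[OF assms(2)])

lemma assoc_algebraI:
  fixes K (structure) and A (structure)
  assumes "cring K"
    and "\<And>x y. \<lbrakk>x \<in> carrier A; y \<in> carrier A\<rbrakk> \<Longrightarrow> x \<oplus>\<^bsub>A\<^esub> y \<in> carrier A"
    and "\<zero>\<^bsub>A\<^esub> \<in> carrier A"
    and "\<And>x y z. \<lbrakk>x \<in> carrier A; y \<in> carrier A; z \<in> carrier A\<rbrakk> \<Longrightarrow>
      (x \<oplus>\<^bsub>A\<^esub> y) \<oplus>\<^bsub>A\<^esub> z = x \<oplus>\<^bsub>A\<^esub> (y \<oplus>\<^bsub>A\<^esub> z)"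
    and "\<And>x y. \<lbrakk>x \<in> carrier A; y \<in> carrier A\<rbrakk> \<Longrightarrow> x \<oplus>\<^bsub>A\<^esub> y = y \<oplus>\<^bsub>A\<^esub> x"
    and "\<And>x. x \<in> carrier A \<Longrightarrow> \<zero>\<^bsub>A\<^esub> \<oplus>\<^bsub>A\<^esub> x = x"
    and "\<And>x. x \<in> carrier A \<Longrightarrow> \<exists>y\<in>carrier A. y \<oplus>\<^bsub>A\<^esub> x = \<zero>\<^bsub>A\<^esub>"
    and "\<And>x y. \<lbrakk>x \<in> carrier A; y \<in> carrier A\<rbrakk> \<Longrightarrow> x \<otimes>\<^bsub>A\<^esub> y \<in> carrier A"
    and "\<one>\<^bsub>A\<^esub> \<in> carrier A"
    and "\<And>x y z. \<lbrakk>x \<in> carrier A; y \<in> carrier A; z \<in> carrier A\<rbrakk> \<Longrightarrow>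
      (x \<otimes>\<^bsub>A\<^esub> y) \<otimes>\<^bsub>A\<^esub> z = x \<otimes>\<^bsub>A\<^esub> (y \<otimes>\<^bsub>A\<^esub> z)"
    and "\<And>x. x \<in> carrier A \<Longrightarrow> \<one>\<^bsub>A\<^esub> \<otimes>\<^bsub>A\<^esub> x = x"
    and "\<And>x. x \<in> carrier A \<Longrightarrow> x \<otimes>\<^bsub>A\<^esub> \<one>\<^bsub>A\<^esub> = x"
    and "\<And>x y z. \<lbrakk>x \<in> carrier A; y \<in> carrier A; z \<in> carrier A\<rbrakk> \<Longrightarrow>
      (x \<oplus>\<^bsub>A\<^esub> y) \<otimes>\<^bsub>A\<^esub> z = x \<otimes>\<^bsub>A\<^esub> z \<oplus>\<^bsub>A\<^esub> y \<otimes>\<^bsub>A\<^esub> z"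
    and "\<And>x y z. \<lbrakk>x \<in> carrier A; y \<in> carrier A; z \<in> carrier A\<rbrakk> \<Longrightarrow>
      z \<otimes>\<^bsub>A\<^esub> (x \<oplus>\<^bsub>A\<^esub> y) = z \<otimes>\<^bsub>A\<^esub> x \<oplus>\<^bsub>A\<^esub> z \<otimes>\<^bsub>A\<^esub> y"
    and "\<And>a x. \<lbrakk>a \<in> carrier K; x \<in> carrier A\<rbrakk> \<Longrightarrow> a \<odot>\<^bsub>A\<^esub> x \<in> carrier A"
    and "\<And>a b x. \<lbrakk>a \<in> carrier K; b \<in> carrier K; x \<in> carrier A\<rbrakk> \<Longrightarrow>
      (a \<oplus>\<^bsub>K\<^esub> b) \<odot>\<^bsub>A\<^esub> x = a \<odot>\<^bsub>A\<^esub> x \<oplus>\<^bsub>A\<^esub> b \<odot>\<^bsub>A\<^esub> x"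
    and "\<And>a x y. \<lbrakk>a \<in> carrier K; x \<in> carrier A; y \<in> carrier A\<rbrakk> \<Longrightarrow>
      a \<odot>\<^bsub>A\<^esub> (x \<oplus>\<^bsub>A\<^esub> y) = a \<odot>\<^bsub>A\<^esub> x \<oplus>\<^bsub>A\<^esub> a \<odot>\<^bsub>A\<^esub> y"
    and "\<And>a b x. \<lbrakk>a \<in> carrier K; b \<in> carrier K; x \<in> carrier A\<rbrakk> \<Longrightarrow>
      (a \<otimes>\<^bsub>K\<^esub> b) \<odot>\<^bsub>A\<^esub> x = a \<odot>\<^bsub>A\<^esub> (b \<odot>\<^bsub>A\<^esub> x)"
    and "\<And>x. x \<in> carrier A \<Longrightarrow> \<one>\<^bsub>K\<^esub> \<odot>\<^bsub>A\<^esub> x = x"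
    and "\<And>a x y. \<lbrakk>a \<in> carrier K; x \<in> carrier A; y \<in> carrier A\<rbrakk> \<Longrightarrow>
      (a \<odot>\<^bsub>A\<^esub> x) \<otimes>\<^bsub>A\<^esub> y = a \<odot>\<^bsub>A\<^esub> (x \<otimes>\<^bsub>A\<^esub> y)"
    and "\<And>a x y. \<lbrakk>a \<in> carrier K; x \<in> carrier A; y \<in> carrier A\<rbrakk> \<Longrightarrow>
      x \<otimes>\<^bsub>A\<^esub> (a \<odot>\<^bsub>A\<^esub> y) = a \<odot>\<^bsub>A\<^esub> (x \<otimes>\<^bsub>A\<^esub> y)"
  shows "assoc_algebra K A"
proof -
  have "abelian_group A"
    by (rule abelian_groupI) (use assms in auto)
  moreover have "monoid A"
    by (rule monoidI) (use assms in auto)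
  ultimately have "ring A" "module K A"
    using assms by (auto intro!: ringI moduleI)
  then show ?thesis
    using assms by (simp add: assoc_algebra_def assoc_algebra_axioms_def)
qed

text \<open>Every axiom for \<open>B\<close> is pulled back along preimages to the same axiom for
  \<open>A\<close>. Preservation of zero is a separate hypothesis because it follows from additivity
  only once \<open>B\<close> is known to be a group.\<close>

lemma assoc_algebra_image:
  assumes A: "assoc_algebra K A" and h: "h \<in> alg_hom K A B" and surj: "h ` carrier A = carrier B"
    and zero: "h \<zero>\<^bsub>A\<^esub> = \<zero>\<^bsub>B\<^esub>"
  shows "assoc_algebra K B"
proof -
  interpret A: assoc_algebra K A by fact
  interpret A: ring A by unfold_locales
  note hD = alg_homD[OF h]
  note hs = hD(2,3,5)[symmetric] hD(4)[symmetric] zero[symmetric]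
  have ex: "\<exists>x\<in>carrier A. y = h x" if "y \<in> carrier B" for y
    using that surj by auto
  show ?thesis
  proof (rule assoc_algebraI)
    show "cring K" by unfold_locales
    show "\<exists>y\<in>carrier B. y \<oplus>\<^bsub>B\<^esub> x = \<zero>\<^bsub>B\<^esub>" if x: "x \<in> carrier B" for x
    proof -
      obtain a where a: "a \<in> carrier A" "x = h a" using ex[OF x] by blast
      then have "h (\<ominus>\<^bsub>A\<^esub> a) \<oplus>\<^bsub>B\<^esub> x = \<zero>\<^bsub>B\<^esub>"
        by (simp add: hs A.M.l_neg)
      then show ?thesis using a hD(1) by blast
    qed
  qed (auto dest!: ex simp: hs hD(1) A.smult_l_distr A.smult_r_distr A.smult_assoc1
      A.smult_mult_left A.smult_mult_right A.M.a_assoc A.l_distr A.r_distr A.m_assoc intro: arg_cong[OF A.M.a_comm])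
qed

text \<open>Multiplying by the scalar \<open>a\<close> is the same as multiplying by the element
  \<open>a\<close> times \<open>1\<close>, so ring ideals are automatically subspaces and their
  quotients are algebras.\<close>

lemma (in assoc_algebra) ideal_smult_closed:
  assumes "ideal I A" "a \<in> carrier K" "x \<in> I"
  shows "a \<odot>\<^bsub>A\<^esub> x \<in> I"
proof -
  interpret I: ideal I A by fact
  have "(a \<odot>\<^bsub>A\<^esub> \<one>\<^bsub>A\<^esub>) \<otimes>\<^bsub>A\<^esub> x \<in> I"
    using assms by (intro I.I_l_closed) auto
  then show ?thesis
    using assms by (simp add: smult_mult_left I.Icarr)
qed

lemma quotient_algebra_sel [simp]:
  "carrier (quotient_algebra A I) = carrier (A Quot I)"
  "mult (quotient_algebra A I) = mult (A Quot I)"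
  "one (quotient_algebra A I) = one (A Quot I)"
  "zero (quotient_algebra A I) = zero (A Quot I)"
  "add (quotient_algebra A I) = add (A Quot I)"
  by (simp_all add: quotient_algebra_def)

lemma coset_in_alg_hom:
  assumes A: "assoc_algebra K A" and I: "ideal I A"
  shows "(+>\<^bsub>A\<^esub>) I \<in> alg_hom K A (quotient_algebra A I)"
proof -
  interpret A: assoc_algebra K A by fact
  interpret I: ideal I A by fact
  note rD = I.rcos_ring_hom[unfolded ring_hom_def, simplified]
  show ?thesis
  proof (rule alg_homI)
    fix a x assume a: "a \<in> carrier K" and x: "x \<in> carrier A"
    \<comment> \<open>Changing the representative by \<open>i\<close> in \<open>I\<close> changes
      the multiple by \<open>a\<close> times \<open>i\<close>, again in \<open>I\<close>. Hence all
      sets in the union that defines the scalar action coincide.\<close>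
    have coset: "I +>\<^bsub>A\<^esub> (a \<odot>\<^bsub>A\<^esub> y) = I +>\<^bsub>A\<^esub> (a \<odot>\<^bsub>A\<^esub> x)" if y: "y \<in> I +>\<^bsub>A\<^esub> x" for y
    proof -
      obtain i where i: "i \<in> I" "y = i \<oplus>\<^bsub>A\<^esub> x"
        using y by (auto simp: a_r_coset_def')
      have ai: "a \<odot>\<^bsub>A\<^esub> i \<in> I"
        using A.ideal_smult_closed[OF I a i(1)] .
      have "a \<odot>\<^bsub>A\<^esub> y = a \<odot>\<^bsub>A\<^esub> i \<oplus>\<^bsub>A\<^esub> a \<odot>\<^bsub>A\<^esub> x"
        using i a x by (simp add: A.smult_r_distr I.Icarr)
      then have "a \<odot>\<^bsub>A\<^esub> y \<in> I +>\<^bsub>A\<^esub> (a \<odot>\<^bsub>A\<^esub> x)"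
        using ai by (auto simp: a_r_coset_def')
      then show ?thesis
        using I.a_repr_independence' a x by auto
    qed
    have "x \<in> I +>\<^bsub>A\<^esub> x"
      using x I.a_rcos_self by auto
    then have "(\<Union>y\<in>I +>\<^bsub>A\<^esub> x. I +>\<^bsub>A\<^esub> (a \<odot>\<^bsub>A\<^esub> y)) = I +>\<^bsub>A\<^esub> (a \<odot>\<^bsub>A\<^esub> x)"
      using coset by blast
    then show "I +>\<^bsub>A\<^esub> (a \<odot>\<^bsub>A\<^esub> x) = a \<odot>\<^bsub>quotient_algebra A I\<^esub> (I +>\<^bsub>A\<^esub> x)"
      by (simp add: quotient_algebra_def)
  qed (use rD in auto)
qed

lemma coset_surj: "carrier (quotient_algebra A I) = (+>\<^bsub>A\<^esub>) I ` carrier A"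
  by (auto simp: FactRing_def A_RCOSETS_def' a_r_coset_def')

lemma (in ideal) coset_eq_zero_iff:
  assumes "x \<in> carrier R"
  shows "I +> x = \<zero>\<^bsub>R Quot I\<^esub> \<longleftrightarrow> x \<in> I"
proof
  assume "I +> x = \<zero>\<^bsub>R Quot I\<^esub>"
  then have "I +> x = I"
    by (simp add: FactRing_def)
  then show "x \<in> I"
    using assms by (rule rcos_const_imp_mem[rotated])
next
  assume "x \<in> I"
  then have "I +> x = I"
    by (rule a_rcos_zero[OF is_ideal])
  then show "I +> x = \<zero>\<^bsub>R Quot I\<^esub>"
    by (simp add: FactRing_def)
qed

lemma assoc_algebra_quotient:
  assumes A: "assoc_algebra K A" and I: "ideal I A"
  shows "assoc_algebra K (quotient_algebra A I)"
proof (rule assoc_algebra_image[OF A coset_in_alg_hom[OF A I] coset_surj[symmetric]])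
  interpret I: ideal I A by fact
  show "I +>\<^bsub>A\<^esub> \<zero>\<^bsub>A\<^esub> = \<zero>\<^bsub>quotient_algebra A I\<^esub>"
    by (simp add: I.coset_eq_zero_iff)
qed

lemma assoc_algebra_subalgebra:
  assumes A: "assoc_algebra K A" and "subring H A" "submodule H K A"
  shows "assoc_algebra K (A\<lparr>carrier := H\<rparr>)"
proof -
  interpret A: assoc_algebra K A by fact
  have "ring (A\<lparr>carrier := H\<rparr>)"
    using A.subring_is_ring assms by auto
  moreover have "module K (A\<lparr>carrier := H\<rparr>)"
    using submodule.submodule_is_module[OF assms(3)] A.module_axioms by auto
  moreover have "H \<subseteq> carrier A"
    using assms(2) subringE(1) by auto
  ultimately show ?thesis
    by (auto simp: assoc_algebra_def assoc_algebra_axioms_def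
        intro!: A.smult_mult_left A.smult_mult_right)
qed

lemma alg_hom_image_subring:
  assumes A: "assoc_algebra K A" and B: "assoc_algebra K B" and f: "f \<in> alg_hom K A B"
  shows "subring (f ` carrier A) B" and "submodule (f ` carrier A) K B"
proof -
  interpret A: assoc_algebra K A by fact
  interpret B: assoc_algebra K B by fact
  interpret f: ring_hom_ring A B f
    using alg_hom_ring_hom_ring[OF A B f] .
  show "subring (f ` carrier A) B"
    using f.img_is_subring A.carrier_is_subring by auto
  then show "submodule (f ` carrier A) K B"
    by (intro B.submoduleI) (auto dest: subringE simp flip: alg_homD(5)[OF f] f.hom_zero f.hom_add f.hom_a_inv)
qed

text \<open>Replacing the intersection by an image gives each element of the generated subalgebra a
  preimage in \<open>A\<close>, which in the application is the free algebra.\<close>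

lemma generated_subalgebra_eq_image:
  assumes A: "assoc_algebra K A" and B: "assoc_algebra K B" and f: "f \<in> alg_hom K A B"
    and S: "S \<subseteq> f ` carrier A"
    and min: "\<And>H. \<lbrakk>subring H B; submodule H K B; S \<subseteq> H\<rbrakk> \<Longrightarrow> f ` carrier A \<subseteq> H"
  shows "generated_subalgebra K B S = f ` carrier A"
  unfolding generated_subalgebra_def
  using alg_hom_image_subring[OF A B f] S min by blast

lemma alg_hom_factor:
  assumes A: "assoc_algebra K A" and B: "assoc_algebra K B" and C: "assoc_algebra K C"
    and f: "f \<in> alg_hom K A B" and g: "g \<in> alg_hom K A C"
    and fs: "f ` carrier A = carrier B"
    and ker: "\<And>x. \<lbrakk>x \<in> carrier A; f x = \<zero>\<^bsub>B\<^esub>\<rbrakk> \<Longrightarrow> g x = \<zero>\<^bsub>C\<^esub>"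
  obtains \<phi> where "\<phi> \<in> alg_hom K B C" "\<And>x. x \<in> carrier A \<Longrightarrow> \<phi> (f x) = g x"
proof
  interpret A: assoc_algebra K A by fact
  interpret B: assoc_algebra K B by fact
  interpret C: assoc_algebra K C by fact
  interpret f: ring_hom_ring A B f
    using alg_hom_ring_hom_ring[OF A B f] .
  interpret g: ring_hom_ring A C g
    using alg_hom_ring_hom_ring[OF A C g] .
  have eq: "g x = g y" if "f x = f y" "x \<in> carrier A" "y \<in> carrier A" for x y
  proof -
    have "f (x \<ominus>\<^bsub>A\<^esub> y) = \<zero>\<^bsub>B\<^esub>"
      using that by (simp add: A.minus_eq B.r_neg)
    then have "g (x \<ominus>\<^bsub>A\<^esub> y) = \<zero>\<^bsub>C\<^esub>"
      using that by (intro ker) auto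
    then show ?thesis
      using that by (simp add: A.minus_eq C.r_right_minus_eq flip: C.minus_eq)
  qed
  \<comment> \<open>An arbitrary preimage under \<open>f\<close> is chosen; by \<open>eq\<close> the
    value of \<open>g\<close> does not depend on the choice.\<close>
  define \<phi> where "\<phi> y = g (inv_into (carrier A) f y)" for y
  show \<phi>: "\<phi> (f x) = g x" if "x \<in> carrier A" for x
    unfolding \<phi>_def by (intro eq) (use that in \<open>auto simp: f_inv_into_f inv_into_into\<close>)
  have ex: "\<exists>x\<in>carrier A. y = f x" if "y \<in> carrier B" for y
    using that fs by auto
  show "\<phi> \<in> alg_hom K B C"
  proof (rule alg_homI)
    show "\<phi> \<one>\<^bsub>B\<^esub> = \<one>\<^bsub>C\<^esub>"
      using \<phi>[of "\<one>\<^bsub>A\<^esub>"] by simp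
  next
    fix y assume "y \<in> carrier B"
    then show "\<phi> y \<in> carrier C"
      by (auto dest!: ex simp: \<phi>)
  next
    fix y z assume y: "y \<in> carrier B" and z: "z \<in> carrier B"
    obtain u v where "u \<in> carrier A" "v \<in> carrier A" "y = f u" "z = f v"
      using ex[OF y] ex[OF z] by auto
    then show "\<phi> (y \<otimes>\<^bsub>B\<^esub> z) = \<phi> y \<otimes>\<^bsub>C\<^esub> \<phi> z" "\<phi> (y \<oplus>\<^bsub>B\<^esub> z) = \<phi> y \<oplus>\<^bsub>C\<^esub> \<phi> z"
      using \<phi>[of "u \<otimes>\<^bsub>A\<^esub> v"] \<phi>[of "u \<oplus>\<^bsub>A\<^esub> v"] by (simp_all add: \<phi>)
  next
    fix a y assume a: "a \<in> carrier K" and y: "y \<in> carrier B"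
    obtain u where "u \<in> carrier A" "y = f u"
      using ex[OF y] by auto
    then show "\<phi> (a \<odot>\<^bsub>B\<^esub> y) = a \<odot>\<^bsub>C\<^esub> \<phi> y"
      using \<phi>[of "a \<odot>\<^bsub>A\<^esub> u"] a by (simp add: \<phi> alg_homD(5)[OF f] alg_homD(5)[OF g])
  qed
qed

text \<open>Factoring \<open>g\<close> through \<open>f\<close> and \<open>f\<close> through
  \<open>g\<close> yields maps in both directions. They undo each other on values of
  \<open>f\<close> and \<open>g\<close>, and these exhaust \<open>B\<close> and
  \<open>C\<close>.\<close>

lemma alg_iso_if_same_kernel:
  assumes A: "assoc_algebra K A" and B: "assoc_algebra K B" and C: "assoc_algebra K C"
    and f: "f \<in> alg_hom K A B" and g: "g \<in> alg_hom K A C"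
    and fs: "f ` carrier A = carrier B" and gs: "g ` carrier A = carrier C"
    and ker: "\<And>x. x \<in> carrier A \<Longrightarrow> f x = \<zero>\<^bsub>B\<^esub> \<longleftrightarrow> g x = \<zero>\<^bsub>C\<^esub>"
  shows "\<exists>\<phi>. \<phi> \<in> alg_iso K B C"
proof -
  obtain \<phi> where \<phi>: "\<phi> \<in> alg_hom K B C" "\<And>x. x \<in> carrier A \<Longrightarrow> \<phi> (f x) = g x"
    using alg_hom_factor[OF A B C f g fs] ker by metis
  obtain \<psi> where \<psi>: "\<psi> \<in> alg_hom K C B" "\<And>x. x \<in> carrier A \<Longrightarrow> \<psi> (g x) = f x"
    using alg_hom_factor[OF A C B g f gs] ker by metis
  have "bij_betw \<phi> (carrier B) (carrier C)"
    using fs gs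
    by (intro bij_betw_byWitness[where f' = \<psi>]) (force simp: \<phi>(2) \<psi>(2))+
  then have "\<phi> \<in> alg_iso K B C"
    using \<phi>(1) by (simp add: alg_iso_def alg_hom_def ring_iso_def)
  then show ?thesis by blast
qed

section \<open>The free algebra\<close>

context cring
begin

definition convolution :: "('g list \<Rightarrow> 'a) \<Rightarrow> ('g list \<Rightarrow> 'a) \<Rightarrow> 'g list \<Rightarrow> 'a"
  where "convolution p q w = (\<Oplus>i\<in>{..length w}. p (take i w) \<otimes> q (drop i w))"

lemma convolution_Nil [simp]:
  assumes "\<And>w. p w \<in> carrier R" "\<And>w. q w \<in> carrier R"
  shows "convolution p q [] = p [] \<otimes> q []"
  using assms by (simp add: convolution_def)

text \<open>This recursion turns all properties of the product into inductions on the word; the letter is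
  shifted off the left factor only.\<close>

lemma convolution_Cons [simp]:
  assumes "\<And>w. p w \<in> carrier R" "\<And>w. q w \<in> carrier R"
  shows "convolution p q (x # w) = p [] \<otimes> q (x # w) \<oplus> convolution (\<lambda>u. p (x # u)) q w"
  using assms unfolding convolution_def
  by (simp add: finsum_Suc2 Pi_def a_comm del: finsum_Suc)

lemma convolution_closed [simp]:
  assumes "\<And>w. p w \<in> carrier R" "\<And>w. q w \<in> carrier R"
  shows "convolution p q w \<in> carrier R"
  using assms by (auto simp: convolution_def intro!: finsum_closed)

lemma convolution_add_left:
  assumes "\<And>w. p w \<in> carrier R" "\<And>w. q w \<in> carrier R" "\<And>w. r w \<in> carrier R"
  shows "convolution (\<lambda>u. p u \<oplus> q u) r w = convolution p r w \<oplus> convolution q r w"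
  using assms by (induction w arbitrary: p q) (simp_all add: l_distr a_ac)

lemma convolution_add_right:
  assumes "\<And>w. p w \<in> carrier R" "\<And>w. q w \<in> carrier R" "\<And>w. r w \<in> carrier R"
  shows "convolution r (\<lambda>u. p u \<oplus> q u) w = convolution r p w \<oplus> convolution r q w"
  using assms by (induction w arbitrary: r) (simp_all add: r_distr a_ac)

lemma convolution_smult_left:
  assumes "\<And>w. p w \<in> carrier R" "\<And>w. q w \<in> carrier R" "a \<in> carrier R"
  shows "convolution (\<lambda>u. a \<otimes> p u) q w = a \<otimes> convolution p q w"
  using assms by (induction w arbitrary: p) (simp_all add: r_distr m_assoc)

lemma convolution_smult_right:
  assumes "\<And>w. p w \<in> carrier R" "\<And>w. q w \<in> carrier R" "a \<in> carrier R"
  shows "convolution p (\<lambda>u. a \<otimes> q u) w = a \<otimes> convolution p q w"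
  using assms by (induction w arbitrary: p) (simp_all add: r_distr m_lcomm)

lemma convolution_assoc:
  assumes "\<And>w. p w \<in> carrier R" "\<And>w. q w \<in> carrier R" "\<And>w. r w \<in> carrier R"
  shows "convolution (convolution p q) r w = convolution p (convolution q r) w"
  using assms
proof (induction w arbitrary: p)
  case Nil
  then show ?case
    by (simp add: m_assoc)
next
  case (Cons x w)
  \<comment> \<open>Stripping the first letter obeys a product rule: the shift of
    \<open>convolution p q\<close> is a scalar multiple of the shifted \<open>q\<close> plus the
    convolution of the shifted \<open>p\<close> with \<open>q\<close>. The induction hypothesis,
    general in \<open>p\<close>, handles the second summand.\<close>
  have "convolution (\<lambda>u. convolution p q (x # u)) r w
      = convolution (\<lambda>u. p [] \<otimes> q (x # u) \<oplus> convolution (\<lambda>u. p (x # u)) q u) r w"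
    using Cons.prems by simp
  also have "\<dots> = convolution (\<lambda>u. p [] \<otimes> q (x # u)) r w
      \<oplus> convolution (convolution (\<lambda>u. p (x # u)) q) r w"
    using Cons.prems by (intro convolution_add_left) auto
  also have "convolution (\<lambda>u. p [] \<otimes> q (x # u)) r w = p [] \<otimes> convolution (\<lambda>u. q (x # u)) r w"
    using Cons.prems by (intro convolution_smult_left) auto
  also have "convolution (convolution (\<lambda>u. p (x # u)) q) r w
      = convolution (\<lambda>u. p (x # u)) (convolution q r) w"
    using Cons.prems by (intro Cons.IH)
  finally show ?case
    using Cons.prems by (simp add: r_distr m_assoc a_assoc)
qed

lemma convolution_zero_left:
  assumes "\<And>w. q w \<in> carrier R"
  shows "convolution (\<lambda>_. \<zero>) q w = \<zero>"
  using assms by (induction w) auto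

definition word_monom :: "'g list \<Rightarrow> 'a \<Rightarrow> 'g list \<Rightarrow> 'a"
  where "word_monom w a = (\<lambda>v. if v = w then a else \<zero>)"

lemma word_monom_closed [simp]: "a \<in> carrier R \<Longrightarrow> word_monom w a v \<in> carrier R"
  by (auto simp: word_monom_def)

lemma convolution_monom_Nil_left:
  assumes "\<And>w. q w \<in> carrier R" "a \<in> carrier R"
  shows "convolution (word_monom [] a) q w = a \<otimes> q w"
proof (cases w)
  case Nil
  then show ?thesis
    using assms by (simp add: word_monom_def)
next
  case (Cons x v)
  have "(\<lambda>u. word_monom [] a (x # u)) = (\<lambda>_. \<zero>)"
    by (simp add: word_monom_def)
  then show ?thesis
    using assms Cons by (simp add: convolution_zero_left) (simp add: word_monom_def)
qed

lemma convolution_one_right: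
  assumes "\<And>w. p w \<in> carrier R"
  shows "convolution p (word_monom [] \<one>) w = p w"
  using assms
proof (induction w arbitrary: p)
  case (Cons x w)
  have "convolution (\<lambda>u. p (x # u)) (word_monom [] \<one>) w = p (x # w)"
    using Cons.prems by (intro Cons.IH) auto
  then show ?case
    using Cons.prems by simp (simp add: word_monom_def)
qed (simp, simp add: word_monom_def)

lemma convolution_monom_monom:
  assumes "a \<in> carrier R" "b \<in> carrier R"
  shows "convolution (word_monom u a) (word_monom v b) w = word_monom (u @ v) (a \<otimes> b) w"
  using assms
proof (induction w arbitrary: u)
  case Nil
  then show ?case
    by simp (simp add: word_monom_def)
next
  case (Cons x w)
  show ?case
  proof (cases u)
    case Nil
    then show ?thesis
      using Cons.prems by (simp add: convolution_monom_Nil_left del: convolution_Cons)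
        (simp add: word_monom_def)
  next
    case u: (Cons y u')
    have "(\<lambda>t. word_monom u a (x # t)) = (if x = y then word_monom u' a else (\<lambda>_. \<zero>))"
      by (auto simp: word_monom_def u)
    then show ?thesis
      using Cons by (simp add: convolution_zero_left) (simp add: word_monom_def u)
  qed
qed

text \<open>A nonzero sum has a nonzero term, and its index tells where to split the word. This is
  what makes products finitely supported.\<close>

lemma supp_convolution:
  assumes "\<And>w. p w \<in> carrier R" "\<And>w. q w \<in> carrier R"
  shows "{w. convolution p q w \<noteq> \<zero>} \<subseteq> (\<lambda>(u, v). u @ v) ` ({w. p w \<noteq> \<zero>} \<times> {w. q w \<noteq> \<zero>})"
proof
  fix w assume w: "w \<in> {w. convolution p q w \<noteq> \<zero>}"
  have "\<exists>i. p (take i w) \<noteq> \<zero> \<and> q (drop i w) \<noteq> \<zero>"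
  proof (rule ccontr)
    assume "\<not> ?thesis"
    then have "p (take i w) \<otimes> q (drop i w) = \<zero>" for i
      using assms by (cases "p (take i w) = \<zero>") auto
    then show False
      using w by (simp add: convolution_def)
  qed
  then obtain i where "p (take i w) \<noteq> \<zero>" "q (drop i w) \<noteq> \<zero>"
    by blast
  then show "w \<in> (\<lambda>(u, v). u @ v) ` ({w. p w \<noteq> \<zero>} \<times> {w. q w \<noteq> \<zero>})"
    by (intro image_eqI[of _ _ "(take i w, drop i w)"]) auto
qed

lemma free_algebra_sel:
  "mult (free_algebra R X) = convolution"
  "one (free_algebra R X) = word_monom [] \<one>"
  "zero (free_algebra R X) = (\<lambda>_. \<zero>)"
  "add (free_algebra R X) = (\<lambda>p q w. p w \<oplus> q w)"
  "smult (free_algebra R X) = (\<lambda>a p w. a \<otimes> p w)"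
  by (auto simp: free_algebra_def convolution_def word_monom_def fun_eq_iff)

lemma free_algebra_carrier_iff:
  "p \<in> carrier (free_algebra R X) \<longleftrightarrow>
    (\<forall>w. p w \<in> carrier R) \<and> finite {w. p w \<noteq> \<zero>} \<and> {w. p w \<noteq> \<zero>} \<subseteq> lists X"
  by (auto simp: free_algebra_def)

lemma free_algebra_memI:
  assumes "\<And>w. p w \<in> carrier R" "{w. p w \<noteq> \<zero>} \<subseteq> W" "finite W" "W \<subseteq> lists X"
  shows "p \<in> carrier (free_algebra R X)"
  using assms by (auto simp: free_algebra_carrier_iff intro: finite_subset)

lemma word_monom_in_free_algebra:
  assumes "a \<in> carrier R" "w \<in> lists X"
  shows "word_monom w a \<in> carrier (free_algebra R X)"
  by (rule free_algebra_memI[of _ "{w}"]) (use assms in \<open>auto simp: word_monom_def\<close>)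

lemma free_gen_eq_word_monom: "free_gen R x = word_monom [x] \<one>"
  by (simp add: free_gen_def word_monom_def)

lemma free_gen_in_free_algebra:
  "x \<in> X \<Longrightarrow> free_gen R x \<in> carrier (free_algebra R X)"
  by (simp add: free_gen_eq_word_monom word_monom_in_free_algebra)

lemma assoc_algebra_free_algebra: "assoc_algebra R (free_algebra R X)"
proof (rule assoc_algebraI)
  let ?F = "free_algebra R X"
  note [simp] = free_algebra_sel
  show "cring R" ..
  show "\<zero>\<^bsub>?F\<^esub> \<in> carrier ?F"
    by (simp add: free_algebra_carrier_iff)
  show "\<one>\<^bsub>?F\<^esub> \<in> carrier ?F"
    by (simp add: word_monom_in_free_algebra)
  fix p assume p: "p \<in> carrier ?F"
  then have p': "\<And>w. p w \<in> carrier R"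
    by (auto simp: free_algebra_carrier_iff)
  show "\<zero>\<^bsub>?F\<^esub> \<oplus>\<^bsub>?F\<^esub> p = p"
    using p' by simp
  show "\<exists>q\<in>carrier ?F. q \<oplus>\<^bsub>?F\<^esub> p = \<zero>\<^bsub>?F\<^esub>"
    using p p' by (intro bexI[of _ "\<lambda>w. \<ominus> p w"])
      (auto simp: l_neg free_algebra_carrier_iff)
  show "\<one>\<^bsub>?F\<^esub> \<otimes>\<^bsub>?F\<^esub> p = p" "p \<otimes>\<^bsub>?F\<^esub> \<one>\<^bsub>?F\<^esub> = p"
    using p' by (auto simp: convolution_monom_Nil_left convolution_one_right fun_eq_iff)
  show "\<one> \<odot>\<^bsub>?F\<^esub> p = p"
    using p' by simp
  show "a \<odot>\<^bsub>?F\<^esub> p \<in> carrier ?F" if "a \<in> carrier R" for a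
    by (rule free_algebra_memI[of _ "{w. p w \<noteq> \<zero>}"])
      (use p p' that in \<open>auto simp: free_algebra_carrier_iff\<close>)
  show "(a \<otimes> b) \<odot>\<^bsub>?F\<^esub> p = a \<odot>\<^bsub>?F\<^esub> (b \<odot>\<^bsub>?F\<^esub> p)"
    "(a \<oplus> b) \<odot>\<^bsub>?F\<^esub> p = a \<odot>\<^bsub>?F\<^esub> p \<oplus>\<^bsub>?F\<^esub> b \<odot>\<^bsub>?F\<^esub> p"
    if "a \<in> carrier R" "b \<in> carrier R" for a b
    using p' that by (simp_all add: m_assoc l_distr)
  fix q assume q: "q \<in> carrier ?F"
  then have q': "\<And>w. q w \<in> carrier R"
    by (auto simp: free_algebra_carrier_iff)
  show "p \<oplus>\<^bsub>?F\<^esub> q \<in> carrier ?F"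
    by (rule free_algebra_memI[of _ "{w. p w \<noteq> \<zero>} \<union> {w. q w \<noteq> \<zero>}"])
      (use p q p' q' in \<open>auto simp: free_algebra_carrier_iff\<close>)
  show "p \<otimes>\<^bsub>?F\<^esub> q \<in> carrier ?F"
    by (rule free_algebra_memI[OF _ order.trans[OF _ supp_convolution[OF p' q']]])
      (use p q p' q' in \<open>force simp: free_algebra_carrier_iff simp del: in_lists_conv_set\<close>)+
  show "p \<oplus>\<^bsub>?F\<^esub> q = q \<oplus>\<^bsub>?F\<^esub> p"
    using p' q' by (simp add: a_comm)
  show "a \<odot>\<^bsub>?F\<^esub> (p \<oplus>\<^bsub>?F\<^esub> q) = a \<odot>\<^bsub>?F\<^esub> p \<oplus>\<^bsub>?F\<^esub> a \<odot>\<^bsub>?F\<^esub> q"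
    "(a \<odot>\<^bsub>?F\<^esub> p) \<otimes>\<^bsub>?F\<^esub> q = a \<odot>\<^bsub>?F\<^esub> (p \<otimes>\<^bsub>?F\<^esub> q)"
    "p \<otimes>\<^bsub>?F\<^esub> (a \<odot>\<^bsub>?F\<^esub> q) = a \<odot>\<^bsub>?F\<^esub> (p \<otimes>\<^bsub>?F\<^esub> q)"
    if "a \<in> carrier R" for a
    using p' q' that by (simp_all add: r_distr convolution_smult_left convolution_smult_right fun_eq_iff)
  fix r assume r: "r \<in> carrier ?F"
  then have r': "\<And>w. r w \<in> carrier R"
    by (auto simp: free_algebra_carrier_iff)
  show "(p \<oplus>\<^bsub>?F\<^esub> q) \<oplus>\<^bsub>?F\<^esub> r = p \<oplus>\<^bsub>?F\<^esub> (q \<oplus>\<^bsub>?F\<^esub> r)"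
    "(p \<otimes>\<^bsub>?F\<^esub> q) \<otimes>\<^bsub>?F\<^esub> r = p \<otimes>\<^bsub>?F\<^esub> (q \<otimes>\<^bsub>?F\<^esub> r)"
    "(p \<oplus>\<^bsub>?F\<^esub> q) \<otimes>\<^bsub>?F\<^esub> r = p \<otimes>\<^bsub>?F\<^esub> r \<oplus>\<^bsub>?F\<^esub> q \<otimes>\<^bsub>?F\<^esub> r"
    "r \<otimes>\<^bsub>?F\<^esub> (p \<oplus>\<^bsub>?F\<^esub> q) = r \<otimes>\<^bsub>?F\<^esub> p \<oplus>\<^bsub>?F\<^esub> r \<otimes>\<^bsub>?F\<^esub> q"
    using p' q' r'
    by (simp_all add: a_assoc convolution_assoc convolution_add_left convolution_add_right fun_eq_iff)
qed

text \<open>The induction removes one word from the support at a time, so that statements about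
  additive maps reduce to a single word with a coefficient.\<close>

lemma free_algebra_induct [consumes 1, case_names zero add]:
  assumes p: "p \<in> carrier (free_algebra R X)"
    and zero: "P \<zero>\<^bsub>free_algebra R X\<^esub>"
    and add: "\<And>w a p. \<lbrakk>w \<in> lists X; a \<in> carrier R; p \<in> carrier (free_algebra R X); P p\<rbrakk>
      \<Longrightarrow> P (word_monom w a \<oplus>\<^bsub>free_algebra R X\<^esub> p)"
  shows "P p"
proof -
  let ?F = "free_algebra R X"
  have "finite W \<Longrightarrow> p \<in> carrier ?F \<Longrightarrow> {w. p w \<noteq> \<zero>} = W \<Longrightarrow> P p" for W p
  proof (induction W arbitrary: p rule: finite_induct)
    case empty
    then have "p = \<zero>\<^bsub>?F\<^esub>"
      by (auto simp: free_algebra_sel)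
    then show ?case
      using zero by simp
  next
    case (insert w W)
    then have p: "w \<in> lists X" "\<And>v. p v \<in> carrier R"
      by (auto simp: free_algebra_carrier_iff)
    have supp: "{v. (p(w := \<zero>)) v \<noteq> \<zero>} = W"
      using insert by auto
    have q: "p(w := \<zero>) \<in> carrier ?F"
      by (rule free_algebra_memI[of _ W]) (use supp insert p in \<open>auto simp: free_algebra_carrier_iff\<close>)
    have "p = word_monom w (p w) \<oplus>\<^bsub>?F\<^esub> p(w := \<zero>)"
      using p by (auto simp: free_algebra_sel word_monom_def fun_eq_iff)
    then show ?case
      using add[OF p(1) p(2)[of w] q insert.IH[OF q supp]] by argo
  qed
  then show ?thesis
    using p by (auto simp: free_algebra_carrier_iff)
qed

end

section \<open>The universal property of the free algebra\<close>

definition word_prod :: "('a, 'm) monoid_scheme \<Rightarrow> ('g \<Rightarrow> 'a) \<Rightarrow> 'g list \<Rightarrow> 'a"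
  where "word_prod A \<gamma> w = foldr (\<lambda>g x. \<gamma> g \<otimes>\<^bsub>A\<^esub> x) w \<one>\<^bsub>A\<^esub>"

lemma word_prod_simps [simp]:
  "word_prod A \<gamma> [] = \<one>\<^bsub>A\<^esub>"
  "word_prod A \<gamma> (g # w) = \<gamma> g \<otimes>\<^bsub>A\<^esub> word_prod A \<gamma> w"
  by (simp_all add: word_prod_def)

lemma (in monoid) word_prod_closed:
  assumes "\<gamma> \<in> X \<rightarrow> carrier G" "w \<in> lists X"
  shows "word_prod G \<gamma> w \<in> carrier G"
  using assms(2,1) by induction auto

lemma (in monoid) word_prod_append:
  assumes "\<gamma> \<in> X \<rightarrow> carrier G" "u \<in> lists X" "v \<in> lists X"
  shows "word_prod G \<gamma> (u @ v) = word_prod G \<gamma> u \<otimes> word_prod G \<gamma> v"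
  using assms(2,1,3)
  by induction (simp_all add: word_prod_closed[OF assms(1)] funcset_mem[OF assms(1)] m_assoc)

text \<open>The evaluation homomorphism of the universal property: the linear extension of \<gamma>
  from letters to words to coefficient functions.\<close>

definition free_ext ::
    "('k, 'm) ring_scheme \<Rightarrow> ('k, 'a, 'n) module_scheme \<Rightarrow> ('g \<Rightarrow> 'a) \<Rightarrow> ('g list \<Rightarrow> 'k) \<Rightarrow> 'a"
  where "free_ext K A \<gamma> p = (\<Oplus>\<^bsub>A\<^esub>w\<in>{w. p w \<noteq> \<zero>\<^bsub>K\<^esub>}. p w \<odot>\<^bsub>A\<^esub> word_prod A \<gamma> w)"

context
  fixes K :: "('k, 'm) ring_scheme" and A :: "('k, 'a, 'n) module_scheme"
    and X :: "'g set" and \<gamma> :: "'g \<Rightarrow> 'a"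
  assumes A: "assoc_algebra K A" and \<gamma>: "\<gamma> \<in> X \<rightarrow> carrier A"
begin

interpretation A: assoc_algebra K A by (rule A)
interpretation F: assoc_algebra K "free_algebra K X" by (rule A.R.assoc_algebra_free_algebra)

private lemma wp: "w \<in> lists X \<Longrightarrow> word_prod A \<gamma> w \<in> carrier A"
  using A.word_prod_closed[OF \<gamma>] .

text \<open>The index set in \<open>free_ext\<close> depends on \<open>p\<close>; adding two
  elements requires both sums over one common set of words.\<close>

lemma free_ext_superset:
  assumes "\<And>w. p w \<in> carrier K" "{w. p w \<noteq> \<zero>\<^bsub>K\<^esub>} \<subseteq> W" "finite W" "W \<subseteq> lists X"
  shows "free_ext K A \<gamma> p = (\<Oplus>\<^bsub>A\<^esub>w\<in>W. p w \<odot>\<^bsub>A\<^esub> word_prod A \<gamma> w)"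
  unfolding free_ext_def
  by (rule A.M.add.finprod_mono_neutral_cong_left)
    (use assms in \<open>auto simp:  wp subset_iff  in_lists_conv_set\<close>)

lemma free_ext_closed:
  assumes "p \<in> carrier (free_algebra K X)"
  shows "free_ext K A \<gamma> p \<in> carrier A"
  unfolding free_ext_def
  by (rule A.M.finsum_closed)
    (use assms in \<open>auto simp: A.R.free_algebra_carrier_iff wp  subset_iff\<close>)

lemma free_ext_monom:
  assumes "a \<in> carrier K" "w \<in> lists X"
  shows "free_ext K A \<gamma> (A.R.word_monom w a) = a \<odot>\<^bsub>A\<^esub> word_prod A \<gamma> w"
proof -
  have "free_ext K A \<gamma> (A.R.word_monom w a)
      = (\<Oplus>\<^bsub>A\<^esub>v\<in>{w}. A.R.word_monom w a v \<odot>\<^bsub>A\<^esub> word_prod A \<gamma> v)"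
    by (rule free_ext_superset) (use assms in \<open>auto simp: A.R.word_monom_def\<close>)
  then show ?thesis
    using assms by (simp add: wp A.R.word_monom_def)
qed

lemma free_ext_gen:
  "x \<in> X \<Longrightarrow> free_ext K A \<gamma> (free_gen K x) = \<gamma> x"
  using free_ext_monom[of "\<one>\<^bsub>K\<^esub>" "[x]"] funcset_mem[OF \<gamma>, of x]
  by (simp add: A.R.free_gen_eq_word_monom)

lemma free_ext_add:
  assumes p: "p \<in> carrier (free_algebra K X)" and q: "q \<in> carrier (free_algebra K X)"
  shows "free_ext K A \<gamma> (p \<oplus>\<^bsub>free_algebra K X\<^esub> q) = free_ext K A \<gamma> p \<oplus>\<^bsub>A\<^esub> free_ext K A \<gamma> q"
proof -
  define W where "W = {w. p w \<noteq> \<zero>\<^bsub>K\<^esub>} \<union> {w. q w \<noteq> \<zero>\<^bsub>K\<^esub>}"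
  have W: "finite W" "W \<subseteq> lists X"
    using p q by (auto simp: W_def A.R.free_algebra_carrier_iff)
  have range: "\<And>w. p w \<in> carrier K" "\<And>w. q w \<in> carrier K"
    using p q by (auto simp: A.R.free_algebra_carrier_iff)
  have wpW: "word_prod A \<gamma> w \<in> carrier A" if "w \<in> W" for w
    using that W wp by blast
  have "free_ext K A \<gamma> (p \<oplus>\<^bsub>free_algebra K X\<^esub> q)
      = (\<Oplus>\<^bsub>A\<^esub>w\<in>W. (p w \<oplus>\<^bsub>K\<^esub> q w) \<odot>\<^bsub>A\<^esub> word_prod A \<gamma> w)"
    unfolding A.R.free_algebra_sel
    by (rule free_ext_superset) (use W range in \<open>auto simp: W_def\<close>)
  also have "\<dots> = (\<Oplus>\<^bsub>A\<^esub>w\<in>W. p w \<odot>\<^bsub>A\<^esub> word_prod A \<gamma> w \<oplus>\<^bsub>A\<^esub> q w \<odot>\<^bsub>A\<^esub> word_prod A \<gamma> w)"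
    using W range by (intro A.M.finsum_cong) (auto simp: A.smult_l_distr wpW simp_implies_def)
  also have "\<dots> = (\<Oplus>\<^bsub>A\<^esub>w\<in>W. p w \<odot>\<^bsub>A\<^esub> word_prod A \<gamma> w) \<oplus>\<^bsub>A\<^esub> (\<Oplus>\<^bsub>A\<^esub>w\<in>W. q w \<odot>\<^bsub>A\<^esub> word_prod A \<gamma> w)"
    using W range by (intro A.M.finsum_addf) (auto simp: wpW)
  also have "\<dots> = free_ext K A \<gamma> p \<oplus>\<^bsub>A\<^esub> free_ext K A \<gamma> q"
    using W range by (intro arg_cong2[of _ _ _ _ "add A"] free_ext_superset[symmetric]) (auto simp: W_def)
  finally show ?thesis .
qed

lemma free_ext_zero: "free_ext K A \<gamma> \<zero>\<^bsub>free_algebra K X\<^esub> = \<zero>\<^bsub>A\<^esub>"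
  by (simp add: free_ext_def A.R.free_algebra_sel)

lemma free_ext_smult:
  assumes "p \<in> carrier (free_algebra K X)" "a \<in> carrier K"
  shows "free_ext K A \<gamma> (a \<odot>\<^bsub>free_algebra K X\<^esub> p) = a \<odot>\<^bsub>A\<^esub> free_ext K A \<gamma> p"
  using assms(1)
proof (induction rule: A.R.free_algebra_induct)
  case zero
  then show ?case
    using assms(2) by (simp add: free_ext_zero)
next
  case (add w b p)
  have "a \<odot>\<^bsub>free_algebra K X\<^esub> A.R.word_monom w b = A.R.word_monom w (a \<otimes>\<^bsub>K\<^esub> b)"
    using assms(2) by (auto simp: A.R.free_algebra_sel A.R.word_monom_def fun_eq_iff)
  then show ?case
    using add assms(2) by (simp add: F.smult_r_distr free_ext_add free_ext_monom wp
        A.smult_r_distr A.smult_assoc1 A.R.word_monom_in_free_algebra free_ext_closed)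
qed

lemma free_ext_mult:
  assumes p: "p \<in> carrier (free_algebra K X)" and q: "q \<in> carrier (free_algebra K X)"
  shows "free_ext K A \<gamma> (p \<otimes>\<^bsub>free_algebra K X\<^esub> q) = free_ext K A \<gamma> p \<otimes>\<^bsub>A\<^esub> free_ext K A \<gamma> q"
proof -
  \<comment> \<open>Bilinearity is used in two stages: here the left factor is one word and the
    induction runs over \<open>q\<close>; the outer induction then runs over
    \<open>p\<close>.\<close>
  have monom: "free_ext K A \<gamma> (A.R.word_monom u a \<otimes>\<^bsub>free_algebra K X\<^esub> q)
      = (a \<odot>\<^bsub>A\<^esub> word_prod A \<gamma> u) \<otimes>\<^bsub>A\<^esub> free_ext K A \<gamma> q"
    if "u \<in> lists X" "a \<in> carrier K" for u a
    using q
  proof (induction rule: A.R.free_algebra_induct)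
    case zero
    then show ?case
      using that by (simp add: free_ext_zero A.R.word_monom_in_free_algebra wp)
  next
    case (add v b q)
    have "A.R.word_monom u a \<otimes>\<^bsub>free_algebra K X\<^esub> A.R.word_monom v b
        = A.R.word_monom (u @ v) (a \<otimes>\<^bsub>K\<^esub> b)"
      using that add by (simp add: A.R.free_algebra_sel A.R.convolution_monom_monom fun_eq_iff)
    moreover have "(a \<otimes>\<^bsub>K\<^esub> b) \<odot>\<^bsub>A\<^esub> z = b \<odot>\<^bsub>A\<^esub> (a \<odot>\<^bsub>A\<^esub> z)" if "z \<in> carrier A" for z
      using that \<open>a \<in> carrier K\<close> add by (simp add: A.R.m_comm[of a b] A.smult_assoc1)
    ultimately show ?case
      using that add by (simp add: F.r_distr A.r_distr free_ext_add free_ext_monom wp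
          A.R.word_monom_in_free_algebra free_ext_closed A.word_prod_append[OF \<gamma>]
          A.smult_mult_left A.smult_mult_right)
  qed
  show ?thesis
    using p
  proof (induction rule: A.R.free_algebra_induct)
    case zero
    then show ?case
      using q by (simp add: free_ext_zero free_ext_closed)
  next
    case (add u a p)
    then show ?case
      using q by (simp add: F.l_distr A.l_distr free_ext_add free_ext_monom monom wp
          A.R.word_monom_in_free_algebra free_ext_closed)
  qed
qed

lemma free_ext_alg_hom: "free_ext K A \<gamma> \<in> alg_hom K (free_algebra K X) A"
proof (rule alg_homI)
  show "free_ext K A \<gamma> \<one>\<^bsub>free_algebra K X\<^esub> = \<one>\<^bsub>A\<^esub>"
    using free_ext_monom[of "\<one>\<^bsub>K\<^esub>" "[]"] by (simp add: A.R.free_algebra_sel)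
qed (simp_all add: free_ext_closed free_ext_mult free_ext_add free_ext_smult)

lemma free_ext_image_subset:
  assumes H: "subring H A" "submodule H K A" "\<gamma> ` X \<subseteq> H"
  shows "free_ext K A \<gamma> ` carrier (free_algebra K X) \<subseteq> H"
proof -
  have wpH: "word_prod A \<gamma> w \<in> H" if "w \<in> lists X" for w
    using that H subringE[OF H(1)] by induction auto
  have "free_ext K A \<gamma> p \<in> H" if "p \<in> carrier (free_algebra K X)" for p
    using that
  proof (induction rule: A.R.free_algebra_induct)
    case zero
    then show ?case
      using subringE(2)[OF H(1)] by (simp add: free_ext_zero)
  next
    case (add w a p)
    then have "a \<odot>\<^bsub>A\<^esub> word_prod A \<gamma> w \<in> H"
      using A.submoduleE(4)[OF H(2)] wpH by auto
    then show ?case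
      using add subringE(7)[OF H(1)]
      by (simp add: free_ext_add free_ext_monom A.R.word_monom_in_free_algebra)
  qed
  then show ?thesis by auto
qed

end
lemma free_ext_cong:
  assumes "assoc_algebra K A" "p \<in> carrier (free_algebra K X)"
    and "\<gamma> \<in> X \<rightarrow> carrier A" "\<And>x. x \<in> X \<Longrightarrow> \<gamma>' x = \<gamma> x"
  shows "free_ext K A \<gamma>' p = free_ext K A \<gamma> p"
proof -
  interpret A: assoc_algebra K A by fact
  have wp: "word_prod A \<gamma>' w = word_prod A \<gamma> w" if "w \<in> lists X" for w
    using that by induction (simp_all add: assms(4))
  show ?thesis
    unfolding free_ext_def
  proof (rule A.M.finsum_cong')
    show "(\<lambda>w. p w \<odot>\<^bsub>A\<^esub> word_prod A \<gamma> w) \<in> {w. p w \<noteq> \<zero>\<^bsub>K\<^esub>} \<rightarrow> carrier A"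
      using assms(2) A.word_prod_closed[OF assms(3)] by (auto simp: A.R.free_algebra_carrier_iff subset_iff)
  qed (use assms(2) wp in \<open>auto simp: A.R.free_algebra_carrier_iff subset_iff\<close>)
qed

text \<open>Naturality of evaluation. It carries computations between the free algebra, its
  quotient, the subalgebra of idempotents, the quotient of that subalgebra and the operators on
  functions.\<close>

lemma alg_hom_free_ext:
  assumes A: "assoc_algebra K A" and B: "assoc_algebra K B" and f: "f \<in> alg_hom K A B"
    and \<gamma>: "\<gamma> \<in> X \<rightarrow> carrier A" and p: "p \<in> carrier (free_algebra K X)"
  shows "f (free_ext K A \<gamma> p) = free_ext K B (\<lambda>x. f (\<gamma> x)) p"
proof -
  interpret A: assoc_algebra K A by fact
  interpret f: ring_hom_ring A B f
    by (rule alg_hom_ring_hom_ring[OF A B f])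
  have \<gamma>': "(\<lambda>x. f (\<gamma> x)) \<in> X \<rightarrow> carrier B"
    using \<gamma> alg_homD(1)[OF f] by (simp add: Pi_def)
  show ?thesis
    using p
  proof (induction rule: A.R.free_algebra_induct)
    case zero
    show ?case
      by (simp add: free_ext_zero[OF A \<gamma>] free_ext_zero[OF B \<gamma>'])
  next
    case (add w a p)
    have wp: "f (word_prod A \<gamma> w) = word_prod B (\<lambda>x. f (\<gamma> x)) w"
      using add(1)
      by induction (simp_all add: A.word_prod_closed[OF \<gamma>] funcset_mem[OF \<gamma>])
    show ?case
      using add A.R.word_monom_in_free_algebra[OF add(2,1)] A.word_prod_closed[OF \<gamma> add(1)]
      by (simp add: free_ext_add[OF A \<gamma>] free_ext_add[OF B \<gamma>'] free_ext_monom[OF A \<gamma>]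
          free_ext_monom[OF B \<gamma>'] free_ext_closed[OF A \<gamma>] alg_homD(5)[OF f] wp)
  qed
qed

section \<open>Endomorphisms of function spaces\<close>

text \<open>Functions on \<open>S\<close> extended by zero. No finiteness of the support is imposed,
  since a twisted shift reads only one value of its argument at each point.\<close>

definition fun_space :: "('k, 'm) ring_scheme \<Rightarrow> 'g set \<Rightarrow> ('g \<Rightarrow> 'k) set"
  where "fun_space K S = {f. (\<forall>x. f x \<in> carrier K) \<and> (\<forall>x. x \<notin> S \<longrightarrow> f x = \<zero>\<^bsub>K\<^esub>)}"

text \<open>Endomorphisms are normalised to the junk value \<open>\<lambda>_. \<zero>\<close> outside the function space, so that
  plain composition is the product.\<close>

definition fun_endo :: "('k, 'm) ring_scheme \<Rightarrow> 'g set \<Rightarrow> ('k, ('g \<Rightarrow> 'k) \<Rightarrow> ('g \<Rightarrow> 'k)) module"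
  where "fun_endo K S =
    \<lparr>carrier = {T. (\<forall>f\<in>fun_space K S. T f \<in> fun_space K S) \<and>
         (\<forall>f. f \<notin> fun_space K S \<longrightarrow> T f = (\<lambda>_. \<zero>\<^bsub>K\<^esub>)) \<and>
         (\<forall>f\<in>fun_space K S. \<forall>h\<in>fun_space K S.
            T (\<lambda>x. f x \<oplus>\<^bsub>K\<^esub> h x) = (\<lambda>x. T f x \<oplus>\<^bsub>K\<^esub> T h x)) \<and>
         (\<forall>a\<in>carrier K. \<forall>f\<in>fun_space K S. T (\<lambda>x. a \<otimes>\<^bsub>K\<^esub> f x) = (\<lambda>x. a \<otimes>\<^bsub>K\<^esub> T f x))},
     mult = (\<lambda>S T f. S (T f)),
     one = (\<lambda>f. if f \<in> fun_space K S then f else (\<lambda>_. \<zero>\<^bsub>K\<^esub>)),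
     zero = (\<lambda>f x. \<zero>\<^bsub>K\<^esub>),
     add = (\<lambda>S T f x. S f x \<oplus>\<^bsub>K\<^esub> T f x),
     smult = (\<lambda>a T f x. a \<otimes>\<^bsub>K\<^esub> T f x)\<rparr>"

context cring
begin

lemma fun_space_closed:
  "f \<in> fun_space R S \<Longrightarrow> f x \<in> carrier R"
  "(\<lambda>_. \<zero>) \<in> fun_space R S"
  "\<lbrakk>f \<in> fun_space R S; h \<in> fun_space R S\<rbrakk> \<Longrightarrow> (\<lambda>x. f x \<oplus> h x) \<in> fun_space R S"
  "\<lbrakk>a \<in> carrier R; f \<in> fun_space R S\<rbrakk> \<Longrightarrow> (\<lambda>x. a \<otimes> f x) \<in> fun_space R S"
  "f \<in> fun_space R S \<Longrightarrow> (\<lambda>x. \<ominus> f x) \<in> fun_space R S"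
  by (auto simp: fun_space_def)

lemma fun_endo_sel [simp]:
  "mult (fun_endo R X) = (\<lambda>S T f. S (T f))"
  "one (fun_endo R X) = (\<lambda>f. if f \<in> fun_space R X then f else (\<lambda>_. \<zero>))"
  "zero (fun_endo R X) = (\<lambda>f x. \<zero>)"
  "add (fun_endo R X) = (\<lambda>S T f x. S f x \<oplus> T f x)"
  "smult (fun_endo R X) = (\<lambda>a T f x. a \<otimes> T f x)"
  by (simp_all add: fun_endo_def)

lemma fun_endoI:
  assumes "\<And>f. f \<in> fun_space R X \<Longrightarrow> T f \<in> fun_space R X"
    and "\<And>f. f \<notin> fun_space R X \<Longrightarrow> T f = (\<lambda>_. \<zero>)"
    and "\<And>f h x. \<lbrakk>f \<in> fun_space R X; h \<in> fun_space R X\<rbrakk> \<Longrightarrow>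
      T (\<lambda>x. f x \<oplus> h x) x = T f x \<oplus> T h x"
    and "\<And>a f x. \<lbrakk>a \<in> carrier R; f \<in> fun_space R X\<rbrakk> \<Longrightarrow> T (\<lambda>x. a \<otimes> f x) x = a \<otimes> T f x"
  shows "T \<in> carrier (fun_endo R X)"
  using assms by (simp add: fun_endo_def fun_eq_iff)

lemma fun_endoD:
  assumes "T \<in> carrier (fun_endo R X)"
  shows "\<And>f. T f \<in> fun_space R X"
    and "\<And>f x. T f x \<in> carrier R"
    and "\<And>f. f \<notin> fun_space R X \<Longrightarrow> T f = (\<lambda>_. \<zero>)"
    and "\<And>f h. \<lbrakk>f \<in> fun_space R X; h \<in> fun_space R X\<rbrakk> \<Longrightarrow>
      T (\<lambda>x. f x \<oplus> h x) = (\<lambda>x. T f x \<oplus> T h x)"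
    and "\<And>a f. \<lbrakk>a \<in> carrier R; f \<in> fun_space R X\<rbrakk> \<Longrightarrow> T (\<lambda>x. a \<otimes> f x) = (\<lambda>x. a \<otimes> T f x)"
    and "T (\<lambda>_. \<zero>) = (\<lambda>_. \<zero>)"
proof -
  show closed: "T f \<in> fun_space R X" for f
    using assms fun_space_closed(2) by (cases "f \<in> fun_space R X") (auto simp: fun_endo_def)
  show "T f x \<in> carrier R" for f x
    using fun_space_closed(1)[OF closed] .
  show smult: "T (\<lambda>x. a \<otimes> f x) = (\<lambda>x. a \<otimes> T f x)" if "a \<in> carrier R" "f \<in> fun_space R X" for a f
    using assms that by (auto simp: fun_endo_def)
  show "T (\<lambda>_. \<zero>) = (\<lambda>_. \<zero>)"
    using smult[of \<zero> "\<lambda>_. \<zero>"] fun_space_closed(1)[OF closed] by (simp add: fun_space_closed)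
qed (use assms in \<open>auto simp: fun_endo_def\<close>)

lemma assoc_algebra_fun_endo:
  fixes X :: "'g set"
  shows "assoc_algebra R (fun_endo R X)"
proof (rule assoc_algebraI)
  let ?E = "fun_endo R X"
  show "cring R" ..
  show "\<zero>\<^bsub>?E\<^esub> \<in> carrier ?E" "\<one>\<^bsub>?E\<^esub> \<in> carrier ?E"
    by (rule fun_endoI; simp add: fun_space_closed)+
  fix S assume S: "S \<in> carrier ?E"
  note S' = fun_endoD[OF S] fun_space_closed
  show "\<zero>\<^bsub>?E\<^esub> \<oplus>\<^bsub>?E\<^esub> S = S" "\<one> \<odot>\<^bsub>?E\<^esub> S = S" "\<one>\<^bsub>?E\<^esub> \<otimes>\<^bsub>?E\<^esub> S = S"
    by (simp_all add: S' fun_eq_iff)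
  show "S \<otimes>\<^bsub>?E\<^esub> \<one>\<^bsub>?E\<^esub> = S"
    by (auto simp: S' fun_eq_iff)
  show "\<exists>T\<in>carrier ?E. T \<oplus>\<^bsub>?E\<^esub> S = \<zero>\<^bsub>?E\<^esub>"
  proof
    show "(\<lambda>f x. \<ominus> S f x) \<oplus>\<^bsub>?E\<^esub> S = \<zero>\<^bsub>?E\<^esub>"
      by (simp add: S' l_neg)
    show "(\<lambda>f x. \<ominus> S f x) \<in> carrier ?E"
      by (rule fun_endoI) (auto simp: S' minus_add r_minus)
  qed
  show "a \<odot>\<^bsub>?E\<^esub> S \<in> carrier ?E" if "a \<in> carrier R" for a
    by (rule fun_endoI) (auto simp: S' that r_distr m_lcomm)
  show "(a \<otimes> b) \<odot>\<^bsub>?E\<^esub> S = a \<odot>\<^bsub>?E\<^esub> (b \<odot>\<^bsub>?E\<^esub> S)"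
    "(a \<oplus> b) \<odot>\<^bsub>?E\<^esub> S = a \<odot>\<^bsub>?E\<^esub> S \<oplus>\<^bsub>?E\<^esub> b \<odot>\<^bsub>?E\<^esub> S"
    if "a \<in> carrier R" "b \<in> carrier R" for a b
    using that by (simp_all add: S' m_assoc l_distr)
  fix T assume T: "T \<in> carrier ?E"
  note T' = fun_endoD[OF T]
  show "S \<oplus>\<^bsub>?E\<^esub> T \<in> carrier ?E"
    by (rule fun_endoI) (auto simp: S' T' a_ac r_distr)
  show "S \<otimes>\<^bsub>?E\<^esub> T \<in> carrier ?E"
    by (rule fun_endoI) (auto simp: S' T')
  show "S \<oplus>\<^bsub>?E\<^esub> T = T \<oplus>\<^bsub>?E\<^esub> S"
    by (simp add: S' T' a_comm)
  show "a \<odot>\<^bsub>?E\<^esub> (S \<oplus>\<^bsub>?E\<^esub> T) = a \<odot>\<^bsub>?E\<^esub> S \<oplus>\<^bsub>?E\<^esub> a \<odot>\<^bsub>?E\<^esub> T"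
    "(a \<odot>\<^bsub>?E\<^esub> S) \<otimes>\<^bsub>?E\<^esub> T = a \<odot>\<^bsub>?E\<^esub> (S \<otimes>\<^bsub>?E\<^esub> T)"
    "S \<otimes>\<^bsub>?E\<^esub> (a \<odot>\<^bsub>?E\<^esub> T) = a \<odot>\<^bsub>?E\<^esub> (S \<otimes>\<^bsub>?E\<^esub> T)"
    if "a \<in> carrier R" for a
    using that by (simp_all add: S' T' r_distr)
  fix U assume U: "U \<in> carrier ?E"
  note U' = fun_endoD[OF U]
  show "(S \<oplus>\<^bsub>?E\<^esub> T) \<oplus>\<^bsub>?E\<^esub> U = S \<oplus>\<^bsub>?E\<^esub> (T \<oplus>\<^bsub>?E\<^esub> U)"
    "(S \<otimes>\<^bsub>?E\<^esub> T) \<otimes>\<^bsub>?E\<^esub> U = S \<otimes>\<^bsub>?E\<^esub> (T \<otimes>\<^bsub>?E\<^esub> U)"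
    "(S \<oplus>\<^bsub>?E\<^esub> T) \<otimes>\<^bsub>?E\<^esub> U = S \<otimes>\<^bsub>?E\<^esub> U \<oplus>\<^bsub>?E\<^esub> T \<otimes>\<^bsub>?E\<^esub> U"
    "U \<otimes>\<^bsub>?E\<^esub> (S \<oplus>\<^bsub>?E\<^esub> T) = U \<otimes>\<^bsub>?E\<^esub> S \<oplus>\<^bsub>?E\<^esub> U \<otimes>\<^bsub>?E\<^esub> T"
    by (simp_all add: S' T' U' a_assoc)
qed

lemma fun_endo_finsum:
  fixes X :: "'g set"
  assumes "finite I" "\<And>i. i \<in> I \<Longrightarrow> T i \<in> carrier (fun_endo R X)"
  shows "(\<Oplus>\<^bsub>fun_endo R X\<^esub>i\<in>I. T i) f x = (\<Oplus>i\<in>I. T i f x)"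
proof -
  interpret E: assoc_algebra R "fun_endo R X"
    by (rule assoc_algebra_fun_endo)
  show ?thesis
    using assms
  proof (induction I)
    case empty
    then show ?case
      by (simp add: E.M.finsum_empty)
  next
    case (insert i I)
    then show ?case
      by (simp add: E.M.finsum_insert finsum_insert Pi_def fun_endoD(2)[of _ X])
  qed
qed

end

section \<open>The regular representation twisted by a factor set\<close>

text \<open>The possible sets \<open>S\<close> of indices \<open>g\<close> with \<open>e g \<mapsto> 1\<close> under a character of the algebra
  generated by the \<open>e g\<close>.\<close>

definition factor_spectrum ::
    "('k, 'm) ring_scheme \<Rightarrow> ('g, 'n) monoid_scheme \<Rightarrow> ('g \<Rightarrow> 'g \<Rightarrow> 'k) \<Rightarrow> 'g set set"
  where "factor_spectrum K G \<sigma> = {S. S \<subseteq> carrier G \<and> \<one>\<^bsub>G\<^esub> \<in> S \<and>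
    (\<forall>s\<in>carrier G. \<forall>g\<in>carrier G. \<forall>h\<in>carrier G.
       {s, s \<otimes>\<^bsub>G\<^esub> g, s \<otimes>\<^bsub>G\<^esub> g \<otimes>\<^bsub>G\<^esub> h} \<subseteq> S \<longrightarrow> \<sigma> g h \<noteq> \<zero>\<^bsub>K\<^esub>) \<and>
    (\<forall>s\<in>carrier G. \<forall>g\<in>carrier G. \<forall>h\<in>carrier G. \<forall>t\<in>carrier G.
       {s, s \<otimes>\<^bsub>G\<^esub> g, s \<otimes>\<^bsub>G\<^esub> g \<otimes>\<^bsub>G\<^esub> h, s \<otimes>\<^bsub>G\<^esub> g \<otimes>\<^bsub>G\<^esub> h \<otimes>\<^bsub>G\<^esub> t} \<subseteq> S \<longrightarrow>
       \<sigma> g h \<otimes>\<^bsub>K\<^esub> \<sigma> (g \<otimes>\<^bsub>G\<^esub> h) t = \<sigma> g (h \<otimes>\<^bsub>G\<^esub> t) \<otimes>\<^bsub>K\<^esub> \<sigma> h t)}"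

text \<open>Both the given factor set and the constant factor \<open>1\<close> satisfy these
  assumptions, so the theory below is instantiated twice, once for each of the two algebras to be
  compared.\<close>

locale normalized_factor =
  fixes K :: "('k, 'm) ring_scheme" (structure) and G :: "('g, 'n) monoid_scheme" (structure)
    and \<sigma> :: "'g \<Rightarrow> 'g \<Rightarrow> 'k"
  assumes field_K: "field K" and group_G: "group G"
    and factor_closed: "\<lbrakk>g \<in> carrier G; h \<in> carrier G\<rbrakk> \<Longrightarrow> \<sigma> g h \<in> carrier K"
    and factor_one: "\<sigma> \<one>\<^bsub>G\<^esub> \<one>\<^bsub>G\<^esub> = \<one>\<^bsub>K\<^esub>"
begin

sublocale K: field K by (rule field_K)
sublocale G: group G by (rule group_G)

text \<open>This is the action \<open>[g] v_x = \<sigma>(g,x) v_(gx)\<close> in coordinates, the basis vector \<open>v_x\<close> being indexed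
  by \<open>s = x\<inverse>\<close> in \<open>S\<close>.\<close>

definition twisted_shift :: "'g set \<Rightarrow> 'g \<Rightarrow> ('g \<Rightarrow> 'k) \<Rightarrow> 'g \<Rightarrow> 'k"
  where "twisted_shift S g f s =
    (if f \<in> fun_space K S \<and> s \<in> S \<and> s \<otimes>\<^bsub>G\<^esub> g \<in> S
     then \<sigma> g (inv\<^bsub>G\<^esub> (s \<otimes>\<^bsub>G\<^esub> g)) \<otimes>\<^bsub>K\<^esub> f (s \<otimes>\<^bsub>G\<^esub> g) else \<zero>\<^bsub>K\<^esub>)"

lemma factor_spectrumD:
  assumes "S \<in> factor_spectrum K G \<sigma>"
  shows "S \<subseteq> carrier G" "\<one>\<^bsub>G\<^esub> \<in> S"
    and "\<And>s g h. \<lbrakk>g \<in> carrier G; h \<in> carrier G; s \<in> S; s \<otimes>\<^bsub>G\<^esub> g \<in> S; s \<otimes>\<^bsub>G\<^esub> (g \<otimes>\<^bsub>G\<^esub> h) \<in> S\<rbrakk> \<Longrightarrow>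
      \<sigma> g h \<noteq> \<zero>\<^bsub>K\<^esub>"
    and "\<And>s g h t. \<lbrakk>g \<in> carrier G; h \<in> carrier G; t \<in> carrier G; s \<in> S; s \<otimes>\<^bsub>G\<^esub> g \<in> S;
      s \<otimes>\<^bsub>G\<^esub> (g \<otimes>\<^bsub>G\<^esub> h) \<in> S; s \<otimes>\<^bsub>G\<^esub> (g \<otimes>\<^bsub>G\<^esub> (h \<otimes>\<^bsub>G\<^esub> t)) \<in> S\<rbrakk> \<Longrightarrow>
      \<sigma> g h \<otimes>\<^bsub>K\<^esub> \<sigma> (g \<otimes>\<^bsub>G\<^esub> h) t = \<sigma> g (h \<otimes>\<^bsub>G\<^esub> t) \<otimes>\<^bsub>K\<^esub> \<sigma> h t"
proof -
  show sub: "S \<subseteq> carrier G" and "\<one>\<^bsub>G\<^esub> \<in> S"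
    using assms by (auto simp: factor_spectrum_def)
  fix s g h assume 1: "g \<in> carrier G" "h \<in> carrier G" "s \<in> S" "s \<otimes>\<^bsub>G\<^esub> g \<in> S"
    "s \<otimes>\<^bsub>G\<^esub> (g \<otimes>\<^bsub>G\<^esub> h) \<in> S"
  then have s: "s \<in> carrier G"
    using sub by auto
  then show "\<sigma> g h \<noteq> \<zero>\<^bsub>K\<^esub>"
    using 1 assms by (auto simp: factor_spectrum_def G.m_assoc)
  fix t assume "t \<in> carrier G" "s \<otimes>\<^bsub>G\<^esub> (g \<otimes>\<^bsub>G\<^esub> (h \<otimes>\<^bsub>G\<^esub> t)) \<in> S"
  then show "\<sigma> g h \<otimes>\<^bsub>K\<^esub> \<sigma> (g \<otimes>\<^bsub>G\<^esub> h) t = \<sigma> g (h \<otimes>\<^bsub>G\<^esub> t) \<otimes>\<^bsub>K\<^esub> \<sigma> h t"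
    using 1 s assms by (auto simp: factor_spectrum_def G.m_assoc)
qed

text \<open>The cocycle identity at (g,1,1) reads \<sigma>(g,1) \<sigma>(g,1) = \<sigma>(g,1), and
  the one at (1,1,g) reads \<sigma>(1,g) = \<sigma>(1,g) \<sigma>(1,g). Both values are nonzero
  because the points involved lie in \<open>S\<close>, so they cancel.\<close>

lemma factor_spectrum_one:
  assumes S: "S \<in> factor_spectrum K G \<sigma>" and "g \<in> carrier G" "s \<in> S" "s \<otimes>\<^bsub>G\<^esub> g \<in> S"
  shows "\<sigma> g \<one>\<^bsub>G\<^esub> = \<one>\<^bsub>K\<^esub>" and "\<sigma> \<one>\<^bsub>G\<^esub> g = \<one>\<^bsub>K\<^esub>"
proof -
  have s: "s \<in> carrier G"
    using factor_spectrumD(1)[OF S] assms by auto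
  have "\<sigma> g \<one>\<^bsub>G\<^esub> \<noteq> \<zero>\<^bsub>K\<^esub>"
    using factor_spectrumD(3)[OF S, of g "\<one>\<^bsub>G\<^esub>" s] assms by simp
  moreover have "\<sigma> g \<one>\<^bsub>G\<^esub> \<otimes>\<^bsub>K\<^esub> \<sigma> g \<one>\<^bsub>G\<^esub> = \<sigma> g \<one>\<^bsub>G\<^esub> \<otimes>\<^bsub>K\<^esub> \<one>\<^bsub>K\<^esub>"
    using factor_spectrumD(4)[OF S, of g "\<one>\<^bsub>G\<^esub>" "\<one>\<^bsub>G\<^esub>" s] assms by (simp add: factor_one)
  ultimately show "\<sigma> g \<one>\<^bsub>G\<^esub> = \<one>\<^bsub>K\<^esub>"
    using assms by (subst (asm) K.m_lcancel) (auto simp: factor_closed)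
  have "\<sigma> \<one>\<^bsub>G\<^esub> g \<noteq> \<zero>\<^bsub>K\<^esub>"
    using factor_spectrumD(3)[OF S, of "\<one>\<^bsub>G\<^esub>" g s] assms s by simp
  moreover have "\<one>\<^bsub>K\<^esub> \<otimes>\<^bsub>K\<^esub> \<sigma> \<one>\<^bsub>G\<^esub> g = \<sigma> \<one>\<^bsub>G\<^esub> g \<otimes>\<^bsub>K\<^esub> \<sigma> \<one>\<^bsub>G\<^esub> g"
    using factor_spectrumD(4)[OF S, of "\<one>\<^bsub>G\<^esub>" "\<one>\<^bsub>G\<^esub>" g s] assms s by (simp add: factor_one)
  ultimately show "\<sigma> \<one>\<^bsub>G\<^esub> g = \<one>\<^bsub>K\<^esub>"
    using assms by (subst (asm) K.m_rcancel) (auto simp: factor_closed)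
qed

lemma twisted_shift_endo:
  assumes "S \<subseteq> carrier G" "g \<in> carrier G"
  shows "twisted_shift S g \<in> carrier (fun_endo K S)"
proof -
  have factor: "\<sigma> g (inv\<^bsub>G\<^esub> (s \<otimes>\<^bsub>G\<^esub> g)) \<in> carrier K" if "s \<otimes>\<^bsub>G\<^esub> g \<in> S" for s
    using that assms by (intro factor_closed) auto
  show ?thesis
  proof (rule K.fun_endoI)
    fix f assume "f \<in> fun_space K S"
    then show "twisted_shift S g f \<in> fun_space K S"
      using factor unfolding fun_space_def by (simp add: twisted_shift_def)
  next
    fix f assume "f \<notin> fun_space K S"
    then show "twisted_shift S g f = (\<lambda>_. \<zero>\<^bsub>K\<^esub>)"
      by (simp add: twisted_shift_def fun_eq_iff)
  next
    fix f h x assume "f \<in> fun_space K S" "h \<in> fun_space K S"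
    then show "twisted_shift S g (\<lambda>x. f x \<oplus>\<^bsub>K\<^esub> h x) x = twisted_shift S g f x \<oplus>\<^bsub>K\<^esub> twisted_shift S g h x"
      using factor by (simp add: twisted_shift_def K.fun_space_closed K.r_distr)
  next
    fix a f x assume "a \<in> carrier K" "f \<in> fun_space K S"
    then show "twisted_shift S g (\<lambda>x. a \<otimes>\<^bsub>K\<^esub> f x) x = a \<otimes>\<^bsub>K\<^esub> twisted_shift S g f x"
      using factor by (simp add: twisted_shift_def K.fun_space_closed K.m_lcomm)
  qed
qed

lemma twisted_shift_twice:
  assumes "S \<subseteq> carrier G" "g \<in> carrier G" "h \<in> carrier G"
  shows "twisted_shift S g (twisted_shift S h f) s =
    (if f \<in> fun_space K S \<and> s \<in> S \<and> s \<otimes>\<^bsub>G\<^esub> g \<in> S \<and> s \<otimes>\<^bsub>G\<^esub> (g \<otimes>\<^bsub>G\<^esub> h) \<in> S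
     then \<sigma> g (inv\<^bsub>G\<^esub> (s \<otimes>\<^bsub>G\<^esub> g)) \<otimes>\<^bsub>K\<^esub> (\<sigma> h (inv\<^bsub>G\<^esub> (s \<otimes>\<^bsub>G\<^esub> (g \<otimes>\<^bsub>G\<^esub> h))) \<otimes>\<^bsub>K\<^esub> f (s \<otimes>\<^bsub>G\<^esub> (g \<otimes>\<^bsub>G\<^esub> h)))
     else \<zero>\<^bsub>K\<^esub>)"
proof (cases "s \<in> S \<and> s \<otimes>\<^bsub>G\<^esub> g \<in> S")
  case True
  then have "s \<in> carrier G" "\<sigma> g (inv\<^bsub>G\<^esub> (s \<otimes>\<^bsub>G\<^esub> g)) \<in> carrier K"
    using assms by (auto intro: factor_closed)
  then show ?thesis
    using True assms K.fun_endoD(1)[OF twisted_shift_endo[OF assms(1,3)], of f]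
    unfolding twisted_shift_def[of S g] by (simp add: G.m_assoc) (simp add: twisted_shift_def G.m_assoc)
qed (auto simp: twisted_shift_def[of S g])

lemma twisted_shift_thrice:
  assumes "S \<subseteq> carrier G" "g \<in> carrier G" "h \<in> carrier G" "k \<in> carrier G"
  shows "twisted_shift S g (twisted_shift S h (twisted_shift S k f)) s =
    (if f \<in> fun_space K S \<and> s \<in> S \<and> s \<otimes>\<^bsub>G\<^esub> g \<in> S \<and> s \<otimes>\<^bsub>G\<^esub> (g \<otimes>\<^bsub>G\<^esub> h) \<in> S \<and> s \<otimes>\<^bsub>G\<^esub> (g \<otimes>\<^bsub>G\<^esub> (h \<otimes>\<^bsub>G\<^esub> k)) \<in> S
     then \<sigma> g (inv\<^bsub>G\<^esub> (s \<otimes>\<^bsub>G\<^esub> g)) \<otimes>\<^bsub>K\<^esub> (\<sigma> h (inv\<^bsub>G\<^esub> (s \<otimes>\<^bsub>G\<^esub> (g \<otimes>\<^bsub>G\<^esub> h))) \<otimes>\<^bsub>K\<^esub>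
        (\<sigma> k (inv\<^bsub>G\<^esub> (s \<otimes>\<^bsub>G\<^esub> (g \<otimes>\<^bsub>G\<^esub> (h \<otimes>\<^bsub>G\<^esub> k)))) \<otimes>\<^bsub>K\<^esub> f (s \<otimes>\<^bsub>G\<^esub> (g \<otimes>\<^bsub>G\<^esub> (h \<otimes>\<^bsub>G\<^esub> k)))))
     else \<zero>\<^bsub>K\<^esub>)"
proof (cases "s \<in> S \<and> s \<otimes>\<^bsub>G\<^esub> g \<in> S")
  case True
  then have "s \<in> carrier G" "\<sigma> g (inv\<^bsub>G\<^esub> (s \<otimes>\<^bsub>G\<^esub> g)) \<in> carrier K"
    using assms by (auto intro: factor_closed)
  then show ?thesis
    using True assms K.fun_endoD(1)[OF twisted_shift_endo[OF assms(1,3)], of "twisted_shift S k f"]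
    unfolding twisted_shift_def[of S g] by (simp add: G.m_assoc twisted_shift_twice)
qed (auto simp: twisted_shift_def[of S g])

text \<open>The relators of the twisted partial group algebra read as conditions on a map. By
  \<open>free_ext_twisted_ideal\<close> such a map annihilates the ideal that they generate.\<close>

definition twisted_rep :: "('k, 'a, 'o) module_scheme \<Rightarrow> ('g \<Rightarrow> 'a) \<Rightarrow> bool"
  where "twisted_rep A \<Gamma> \<longleftrightarrow>
    \<Gamma> \<in> carrier G \<rightarrow> carrier A \<and> \<Gamma> \<one>\<^bsub>G\<^esub> = \<one>\<^bsub>A\<^esub> \<and>
    (\<forall>g\<in>carrier G. \<forall>h\<in>carrier G.
      (\<sigma> g h = \<zero>\<^bsub>K\<^esub> \<longrightarrow>
        \<Gamma> (inv\<^bsub>G\<^esub> g) \<otimes>\<^bsub>A\<^esub> \<Gamma> (g \<otimes>\<^bsub>G\<^esub> h) = \<zero>\<^bsub>A\<^esub> \<and> \<Gamma> (g \<otimes>\<^bsub>G\<^esub> h) \<otimes>\<^bsub>A\<^esub> \<Gamma> (inv\<^bsub>G\<^esub> h) = \<zero>\<^bsub>A\<^esub>) \<and>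
      \<Gamma> (inv\<^bsub>G\<^esub> g) \<otimes>\<^bsub>A\<^esub> \<Gamma> g \<otimes>\<^bsub>A\<^esub> \<Gamma> h = \<sigma> g h \<odot>\<^bsub>A\<^esub> (\<Gamma> (inv\<^bsub>G\<^esub> g) \<otimes>\<^bsub>A\<^esub> \<Gamma> (g \<otimes>\<^bsub>G\<^esub> h)) \<and>
      \<Gamma> g \<otimes>\<^bsub>A\<^esub> \<Gamma> h \<otimes>\<^bsub>A\<^esub> \<Gamma> (inv\<^bsub>G\<^esub> h) = \<sigma> g h \<odot>\<^bsub>A\<^esub> (\<Gamma> (g \<otimes>\<^bsub>G\<^esub> h) \<otimes>\<^bsub>A\<^esub> \<Gamma> (inv\<^bsub>G\<^esub> h)))"

text \<open>The product of the operators is evaluated at a point \<open>s\<close> of \<open>S\<close>; for this the cocycle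
  identity is needed at \<open>(s, g, h, (sgh)\<inverse>)\<close> only.\<close>

lemma twisted_rep_shift:
  assumes S: "S \<in> factor_spectrum K G \<sigma>"
  shows "twisted_rep (fun_endo K S) (twisted_shift S)"
proof -
  note SD = factor_spectrumD[OF S]
  have SG: "s \<in> carrier G" if "s \<in> S" for s
    using that SD(1) by auto
  have endo: "twisted_shift S g \<in> carrier (fun_endo K S)" if "g \<in> carrier G" for g
    using twisted_shift_endo SD(1) that .
  have cocycle: "\<sigma> g h \<otimes>\<^bsub>K\<^esub> \<sigma> (g \<otimes>\<^bsub>G\<^esub> h) (inv\<^bsub>G\<^esub> (s \<otimes>\<^bsub>G\<^esub> (g \<otimes>\<^bsub>G\<^esub> h)))
      = \<sigma> g (inv\<^bsub>G\<^esub> (s \<otimes>\<^bsub>G\<^esub> g)) \<otimes>\<^bsub>K\<^esub> \<sigma> h (inv\<^bsub>G\<^esub> (s \<otimes>\<^bsub>G\<^esub> (g \<otimes>\<^bsub>G\<^esub> h)))"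
    if "g \<in> carrier G" "h \<in> carrier G" "s \<in> S" "s \<otimes>\<^bsub>G\<^esub> g \<in> S" "s \<otimes>\<^bsub>G\<^esub> (g \<otimes>\<^bsub>G\<^esub> h) \<in> S" for g h s
  proof -
    have "h \<otimes>\<^bsub>G\<^esub> inv\<^bsub>G\<^esub> (s \<otimes>\<^bsub>G\<^esub> (g \<otimes>\<^bsub>G\<^esub> h)) = inv\<^bsub>G\<^esub> (s \<otimes>\<^bsub>G\<^esub> g)"
      using that SG[of s] by (simp add: G.inv_mult_group G.m_assoc) (simp add: G.m_assoc[symmetric])
    \<comment> \<open>With the inverse of \<open>sgh\<close> as last argument, the fourth point of
      the configuration is \<open>1\<close>, which belongs to \<open>S\<close>. So the identity
      holds as soon as \<open>s\<close>, \<open>sg\<close> and \<open>sgh\<close> lie in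
      \<open>S\<close>.\<close>
    moreover have "s \<otimes>\<^bsub>G\<^esub> (g \<otimes>\<^bsub>G\<^esub> (h \<otimes>\<^bsub>G\<^esub> inv\<^bsub>G\<^esub> (s \<otimes>\<^bsub>G\<^esub> (g \<otimes>\<^bsub>G\<^esub> h)))) = \<one>\<^bsub>G\<^esub>"
      unfolding calculation using that SG[of s] by (simp add: G.m_assoc[symmetric])
    ultimately show ?thesis
      using SD(4)[of g h "inv\<^bsub>G\<^esub> (s \<otimes>\<^bsub>G\<^esub> (g \<otimes>\<^bsub>G\<^esub> h))" s] that SG[of s] SD(2) by auto
  qed
  have cancel: "inv\<^bsub>G\<^esub> g \<otimes>\<^bsub>G\<^esub> (g \<otimes>\<^bsub>G\<^esub> h) = h" "g \<otimes>\<^bsub>G\<^esub> (h \<otimes>\<^bsub>G\<^esub> inv\<^bsub>G\<^esub> h) = g"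
      "g \<otimes>\<^bsub>G\<^esub> h \<otimes>\<^bsub>G\<^esub> inv\<^bsub>G\<^esub> h = g" "s \<otimes>\<^bsub>G\<^esub> inv\<^bsub>G\<^esub> g \<otimes>\<^bsub>G\<^esub> g = s"
      "s \<otimes>\<^bsub>G\<^esub> inv\<^bsub>G\<^esub> g \<otimes>\<^bsub>G\<^esub> (g \<otimes>\<^bsub>G\<^esub> h) = s \<otimes>\<^bsub>G\<^esub> h"
    if "s \<in> carrier G" "g \<in> carrier G" "h \<in> carrier G" for s g h
  proof -
    show *: "inv\<^bsub>G\<^esub> g \<otimes>\<^bsub>G\<^esub> (g \<otimes>\<^bsub>G\<^esub> h) = h"
      using that by (simp flip: G.m_assoc)
    show "s \<otimes>\<^bsub>G\<^esub> inv\<^bsub>G\<^esub> g \<otimes>\<^bsub>G\<^esub> (g \<otimes>\<^bsub>G\<^esub> h) = s \<otimes>\<^bsub>G\<^esub> h"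
      using that by (simp add: G.m_assoc *)
  qed (use that in \<open>simp_all add: G.m_assoc\<close>)
  have factor: "\<sigma> g (inv\<^bsub>G\<^esub> s) \<in> carrier K" if "s \<in> S" "g \<in> carrier G" for g s
    using that SG[of s] by (intro factor_closed) auto
  note eval = twisted_shift_twice[OF SD(1)]
  show ?thesis
    unfolding twisted_rep_def
  proof (intro conjI ballI impI)
    show "twisted_shift S \<in> carrier G \<rightarrow> carrier (fun_endo K S)"
      using endo by auto
    show "twisted_shift S \<one>\<^bsub>G\<^esub> = \<one>\<^bsub>fun_endo K S\<^esub>"
    proof (rule ext, rule ext)
      fix f s
      show "twisted_shift S \<one>\<^bsub>G\<^esub> f s = \<one>\<^bsub>fun_endo K S\<^esub> f s"
      proof (cases "s \<in> S")
        case True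
        \<comment> \<open>The two points \<open>s\<close> and \<open>1\<close> of \<open>S\<close>
          differ by the inverse of \<open>s\<close>, which permits normalisation at that
          element.\<close>
        then have "\<sigma> \<one>\<^bsub>G\<^esub> (inv\<^bsub>G\<^esub> s) = \<one>\<^bsub>K\<^esub>"
          using factor_spectrum_one(2)[OF S, of "inv\<^bsub>G\<^esub> s" s] SG SD(2) by simp
        then show ?thesis
          using True SG[of s] by (simp add: twisted_shift_def K.fun_space_closed)
      next
        case False
        then show ?thesis
          unfolding twisted_shift_def by (simp add: fun_space_def)
      qed
    qed
    fix g h assume g: "g \<in> carrier G" and h: "h \<in> carrier G"
    show "twisted_shift S (inv\<^bsub>G\<^esub> g) \<otimes>\<^bsub>fun_endo K S\<^esub> twisted_shift S g \<otimes>\<^bsub>fun_endo K S\<^esub> twisted_shift S h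
      = \<sigma> g h \<odot>\<^bsub>fun_endo K S\<^esub> (twisted_shift S (inv\<^bsub>G\<^esub> g) \<otimes>\<^bsub>fun_endo K S\<^esub> twisted_shift S (g \<otimes>\<^bsub>G\<^esub> h))"
    proof (unfold K.fun_endo_sel, rule ext, rule ext)
      fix f s
      let ?t = "s \<otimes>\<^bsub>G\<^esub> inv\<^bsub>G\<^esub> g"
      show "twisted_shift S (inv\<^bsub>G\<^esub> g) (twisted_shift S g (twisted_shift S h f)) s
        = \<sigma> g h \<otimes>\<^bsub>K\<^esub> twisted_shift S (inv\<^bsub>G\<^esub> g) (twisted_shift S (g \<otimes>\<^bsub>G\<^esub> h) f) s"
      \<comment> \<open>With \<open>?t\<close> the inverse translate of \<open>s\<close>, the triple
        product visits \<open>s\<close>, \<open>?t\<close>, \<open>s\<close>, \<open>sh\<close> and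
        the double product visits \<open>s\<close>, \<open>?t\<close>, \<open>sh\<close>. The
        support conditions therefore agree, and the scalars are compared by the cocycle identity
        based at \<open>?t\<close>.\<close>
      proof (cases "f \<in> fun_space K S \<and> s \<in> S \<and> ?t \<in> S \<and> s \<otimes>\<^bsub>G\<^esub> h \<in> S")
        case True
        then have f: "f \<in> fun_space K S" and S: "s \<in> S" "?t \<in> S" "s \<otimes>\<^bsub>G\<^esub> h \<in> S"
          by auto
        have carriers: "\<sigma> (inv\<^bsub>G\<^esub> g) (inv\<^bsub>G\<^esub> ?t) \<in> carrier K" "\<sigma> (g \<otimes>\<^bsub>G\<^esub> h) (inv\<^bsub>G\<^esub> (s \<otimes>\<^bsub>G\<^esub> h)) \<in> carrier K"
          "\<sigma> g h \<in> carrier K" "\<sigma> g (inv\<^bsub>G\<^esub> s) \<in> carrier K" "\<sigma> h (inv\<^bsub>G\<^esub> (s \<otimes>\<^bsub>G\<^esub> h)) \<in> carrier K"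
          "f (s \<otimes>\<^bsub>G\<^esub> h) \<in> carrier K"
          using g h S f SG by (auto intro: factor factor_closed K.fun_space_closed)
        have "\<sigma> g h \<otimes>\<^bsub>K\<^esub> \<sigma> (g \<otimes>\<^bsub>G\<^esub> h) (inv\<^bsub>G\<^esub> (s \<otimes>\<^bsub>G\<^esub> h)) = \<sigma> g (inv\<^bsub>G\<^esub> s) \<otimes>\<^bsub>K\<^esub> \<sigma> h (inv\<^bsub>G\<^esub> (s \<otimes>\<^bsub>G\<^esub> h))"
          using cocycle[of g h ?t] S g h SG[of s] by (simp add: cancel)
        moreover have "\<sigma> g h \<otimes>\<^bsub>K\<^esub> (\<sigma> (inv\<^bsub>G\<^esub> g) (inv\<^bsub>G\<^esub> ?t) \<otimes>\<^bsub>K\<^esub>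
              (\<sigma> (g \<otimes>\<^bsub>G\<^esub> h) (inv\<^bsub>G\<^esub> (s \<otimes>\<^bsub>G\<^esub> h)) \<otimes>\<^bsub>K\<^esub> f (s \<otimes>\<^bsub>G\<^esub> h)))
            = \<sigma> (inv\<^bsub>G\<^esub> g) (inv\<^bsub>G\<^esub> ?t) \<otimes>\<^bsub>K\<^esub>
              (\<sigma> g h \<otimes>\<^bsub>K\<^esub> \<sigma> (g \<otimes>\<^bsub>G\<^esub> h) (inv\<^bsub>G\<^esub> (s \<otimes>\<^bsub>G\<^esub> h)) \<otimes>\<^bsub>K\<^esub> f (s \<otimes>\<^bsub>G\<^esub> h))"
          using carriers by (simp add: K.m_ac)
        ultimately show ?thesis
          using f S g h SG[of s] carriers
          by (subst twisted_shift_thrice[OF SD(1)]) (simp_all add: eval cancel K.m_assoc)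
      next
        case False
        then show ?thesis
          using g h SG[of s]
          by (subst twisted_shift_thrice[OF SD(1)]) (auto simp: eval cancel factor_closed)
      qed
    qed
    show "twisted_shift S g \<otimes>\<^bsub>fun_endo K S\<^esub> twisted_shift S h \<otimes>\<^bsub>fun_endo K S\<^esub> twisted_shift S (inv\<^bsub>G\<^esub> h)
      = \<sigma> g h \<odot>\<^bsub>fun_endo K S\<^esub> (twisted_shift S (g \<otimes>\<^bsub>G\<^esub> h) \<otimes>\<^bsub>fun_endo K S\<^esub> twisted_shift S (inv\<^bsub>G\<^esub> h))"
    proof (unfold K.fun_endo_sel, rule ext, rule ext)
      fix f s
      let ?t = "s \<otimes>\<^bsub>G\<^esub> (g \<otimes>\<^bsub>G\<^esub> h)"
      show "twisted_shift S g (twisted_shift S h (twisted_shift S (inv\<^bsub>G\<^esub> h) f)) s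
        = \<sigma> g h \<otimes>\<^bsub>K\<^esub> twisted_shift S (g \<otimes>\<^bsub>G\<^esub> h) (twisted_shift S (inv\<^bsub>G\<^esub> h) f) s"
      \<comment> \<open>Here the triple product visits \<open>s\<close>, \<open>sg\<close>,
        \<open>sgh\<close>, \<open>sg\<close> and the double product \<open>s\<close>,
        \<open>sgh\<close>, \<open>sg\<close>; the cocycle identity is based at
        \<open>s\<close>.\<close>
      proof (cases "f \<in> fun_space K S \<and> s \<in> S \<and> ?t \<in> S \<and> s \<otimes>\<^bsub>G\<^esub> g \<in> S")
        case True
        then have f: "f \<in> fun_space K S" and S: "s \<in> S" "?t \<in> S" "s \<otimes>\<^bsub>G\<^esub> g \<in> S"
          by auto
        have carriers: "\<sigma> (inv\<^bsub>G\<^esub> h) (inv\<^bsub>G\<^esub> (s \<otimes>\<^bsub>G\<^esub> g)) \<in> carrier K" "\<sigma> (g \<otimes>\<^bsub>G\<^esub> h) (inv\<^bsub>G\<^esub> ?t) \<in> carrier K"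
          "\<sigma> g h \<in> carrier K" "\<sigma> g (inv\<^bsub>G\<^esub> (s \<otimes>\<^bsub>G\<^esub> g)) \<in> carrier K" "\<sigma> h (inv\<^bsub>G\<^esub> ?t) \<in> carrier K"
          "f (s \<otimes>\<^bsub>G\<^esub> g) \<in> carrier K"
          using g h S f SG by (auto intro: factor factor_closed K.fun_space_closed)
        then show ?thesis
          using f S g h SG[of s] cocycle[of g h s]
          by (subst twisted_shift_thrice[OF SD(1)]) (simp_all add: eval cancel flip: K.m_assoc)
      next
        case False
        then show ?thesis
          using g h SG[of s]
          by (subst twisted_shift_thrice[OF SD(1)]) (auto simp: eval cancel factor_closed)
      qed
    qed
    assume zero: "\<sigma> g h = \<zero>\<^bsub>K\<^esub>"
    show "twisted_shift S (inv\<^bsub>G\<^esub> g) \<otimes>\<^bsub>fun_endo K S\<^esub> twisted_shift S (g \<otimes>\<^bsub>G\<^esub> h) = \<zero>\<^bsub>fun_endo K S\<^esub>"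
    proof (unfold K.fun_endo_sel, rule ext, rule ext)
      fix f s
      show "twisted_shift S (inv\<^bsub>G\<^esub> g) (twisted_shift S (g \<otimes>\<^bsub>G\<^esub> h) f) s = \<zero>\<^bsub>K\<^esub>"
        \<comment> \<open>A nonzero value would put the inverse translate of \<open>s\<close> by
          \<open>g\<close>, then \<open>s\<close>, then \<open>sh\<close> into \<open>S\<close>.
          This is a configuration for (g,h), on which \<sigma> cannot vanish.\<close>
        using SD(3)[of g h "s \<otimes>\<^bsub>G\<^esub> inv\<^bsub>G\<^esub> g"] g h zero SG[of s] by (auto simp: eval cancel)
    qed
    show "twisted_shift S (g \<otimes>\<^bsub>G\<^esub> h) \<otimes>\<^bsub>fun_endo K S\<^esub> twisted_shift S (inv\<^bsub>G\<^esub> h) = \<zero>\<^bsub>fun_endo K S\<^esub>"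
    proof (unfold K.fun_endo_sel, rule ext, rule ext)
      fix f s
      show "twisted_shift S (g \<otimes>\<^bsub>G\<^esub> h) (twisted_shift S (inv\<^bsub>G\<^esub> h) f) s = \<zero>\<^bsub>K\<^esub>"
        using SD(3)[of g h s] g h zero SG[of s] by (auto simp: eval cancel)
    qed
  qed
qed

section \<open>The twisted partial group algebra\<close>

abbreviation "F \<equiv> free_algebra K (carrier G)"
abbreviation "A \<equiv> twisted_par_algebra K G \<sigma>"

lemma F_assoc: "assoc_algebra K F"
  by (rule K.assoc_algebra_free_algebra)

sublocale F: assoc_algebra K F
  by (rule F_assoc)

lemma free_gen_closed: "g \<in> carrier G \<Longrightarrow> free_gen K g \<in> carrier F"
  by (rule K.free_gen_in_free_algebra)

lemma twisted_relators_subset: "twisted_relators K G \<sigma> \<subseteq> carrier F"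
  unfolding twisted_relators_def Let_def
  by (auto simp: free_gen_closed factor_closed)

lemma twisted_ideal_ideal: "ideal (twisted_ideal K G \<sigma>) F"
  unfolding twisted_ideal_def by (rule F.genideal_ideal[OF twisted_relators_subset])

sublocale A: assoc_algebra K A
  unfolding twisted_par_algebra_def
  by (rule assoc_algebra_quotient[OF F_assoc twisted_ideal_ideal])

lemma twisted_repD:
  assumes "twisted_rep B \<Gamma>"
  shows "\<And>g. g \<in> carrier G \<Longrightarrow> \<Gamma> g \<in> carrier B"
    and "\<Gamma> \<one>\<^bsub>G\<^esub> = \<one>\<^bsub>B\<^esub>"
    and "\<And>g h. \<lbrakk>g \<in> carrier G; h \<in> carrier G; \<sigma> g h = \<zero>\<^bsub>K\<^esub>\<rbrakk> \<Longrightarrow>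
      \<Gamma> (inv\<^bsub>G\<^esub> g) \<otimes>\<^bsub>B\<^esub> \<Gamma> (g \<otimes>\<^bsub>G\<^esub> h) = \<zero>\<^bsub>B\<^esub>"
    and "\<And>g h. \<lbrakk>g \<in> carrier G; h \<in> carrier G; \<sigma> g h = \<zero>\<^bsub>K\<^esub>\<rbrakk> \<Longrightarrow>
      \<Gamma> (g \<otimes>\<^bsub>G\<^esub> h) \<otimes>\<^bsub>B\<^esub> \<Gamma> (inv\<^bsub>G\<^esub> h) = \<zero>\<^bsub>B\<^esub>"
    and "\<And>g h. \<lbrakk>g \<in> carrier G; h \<in> carrier G\<rbrakk> \<Longrightarrow>
      \<Gamma> (inv\<^bsub>G\<^esub> g) \<otimes>\<^bsub>B\<^esub> \<Gamma> g \<otimes>\<^bsub>B\<^esub> \<Gamma> h = \<sigma> g h \<odot>\<^bsub>B\<^esub> (\<Gamma> (inv\<^bsub>G\<^esub> g) \<otimes>\<^bsub>B\<^esub> \<Gamma> (g \<otimes>\<^bsub>G\<^esub> h))"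
    and "\<And>g h. \<lbrakk>g \<in> carrier G; h \<in> carrier G\<rbrakk> \<Longrightarrow>
      \<Gamma> g \<otimes>\<^bsub>B\<^esub> \<Gamma> h \<otimes>\<^bsub>B\<^esub> \<Gamma> (inv\<^bsub>G\<^esub> h) = \<sigma> g h \<odot>\<^bsub>B\<^esub> (\<Gamma> (g \<otimes>\<^bsub>G\<^esub> h) \<otimes>\<^bsub>B\<^esub> \<Gamma> (inv\<^bsub>G\<^esub> h))"
  using assms unfolding twisted_rep_def by blast+

text \<open>The universal property of the twisted algebra: the kernel of an evaluation is an ideal,
  so it suffices that it contains the relators.\<close>

lemma free_ext_twisted_ideal:
  assumes B: "assoc_algebra K B" and \<Gamma>: "twisted_rep B \<Gamma>" and p: "p \<in> twisted_ideal K G \<sigma>"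
  shows "free_ext K B \<Gamma> p = \<zero>\<^bsub>B\<^esub>"
proof -
  interpret B: assoc_algebra K B by fact
  have \<Gamma>_carrier: "\<Gamma> \<in> carrier G \<rightarrow> carrier B"
    using \<Gamma> by (simp add: twisted_rep_def)
  have hom: "free_ext K B \<Gamma> \<in> alg_hom K F B"
    by (rule free_ext_alg_hom[OF B \<Gamma>_carrier])
  interpret h: ring_hom_ring F B "free_ext K B \<Gamma>"
    by (rule alg_hom_ring_hom_ring[OF F_assoc B hom])
  have gen: "free_ext K B \<Gamma> (free_gen K g) = \<Gamma> g" if "g \<in> carrier G" for g
    by (rule free_ext_gen[OF B \<Gamma>_carrier that])
  have diff: "free_ext K B \<Gamma> (p \<ominus>\<^bsub>F\<^esub> q) = \<zero>\<^bsub>B\<^esub>"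
    if "free_ext K B \<Gamma> p = free_ext K B \<Gamma> q" "p \<in> carrier F" "q \<in> carrier F" for p q
    using that by (simp add: F.minus_eq B.r_neg)
  have smult: "free_ext K B \<Gamma> (a \<odot>\<^bsub>F\<^esub> p) = a \<odot>\<^bsub>B\<^esub> free_ext K B \<Gamma> p"
    if "a \<in> carrier K" "p \<in> carrier F" for a p
    by (rule alg_homD(5)[OF hom that])
  note \<Gamma>D = twisted_repD[OF \<Gamma>]
  have "free_ext K B \<Gamma> r = \<zero>\<^bsub>B\<^esub>" if "r \<in> twisted_relators K G \<sigma>" for r
    using that unfolding twisted_relators_def Let_def
  proof (elim UnE CollectE exE conjE singletonE)
    fix g h assume "r = free_gen K (inv\<^bsub>G\<^esub> g) \<otimes>\<^bsub>F\<^esub> free_gen K (g \<otimes>\<^bsub>G\<^esub> h)"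
      "g \<in> carrier G" "h \<in> carrier G" "\<sigma> g h = \<zero>\<^bsub>K\<^esub>"
    then show ?thesis
      using \<Gamma>D(3) by (simp add: free_gen_closed gen)
  next
    fix g h assume "r = free_gen K (g \<otimes>\<^bsub>G\<^esub> h) \<otimes>\<^bsub>F\<^esub> free_gen K (inv\<^bsub>G\<^esub> h)"
      "g \<in> carrier G" "h \<in> carrier G" "\<sigma> g h = \<zero>\<^bsub>K\<^esub>"
    then show ?thesis
      using \<Gamma>D(4) by (simp add: free_gen_closed gen)
  next
    fix g h assume r: "r = free_gen K (inv\<^bsub>G\<^esub> g) \<otimes>\<^bsub>F\<^esub> free_gen K g \<otimes>\<^bsub>F\<^esub> free_gen K h \<ominus>\<^bsub>F\<^esub>
        \<sigma> g h \<odot>\<^bsub>F\<^esub> (free_gen K (inv\<^bsub>G\<^esub> g) \<otimes>\<^bsub>F\<^esub> free_gen K (g \<otimes>\<^bsub>G\<^esub> h))"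
      and gh: "g \<in> carrier G" "h \<in> carrier G"
    show ?thesis
      unfolding r using gh \<Gamma>D(5)[OF gh]
      by (intro diff) (simp_all add: free_gen_closed gen smult factor_closed)
  next
    fix g h assume r: "r = free_gen K g \<otimes>\<^bsub>F\<^esub> free_gen K h \<otimes>\<^bsub>F\<^esub> free_gen K (inv\<^bsub>G\<^esub> h) \<ominus>\<^bsub>F\<^esub>
        \<sigma> g h \<odot>\<^bsub>F\<^esub> (free_gen K (g \<otimes>\<^bsub>G\<^esub> h) \<otimes>\<^bsub>F\<^esub> free_gen K (inv\<^bsub>G\<^esub> h))"
      and gh: "g \<in> carrier G" "h \<in> carrier G"
    show ?thesis
      unfolding r using gh \<Gamma>D(6)[OF gh]
      by (intro diff) (simp_all add: free_gen_closed gen smult factor_closed)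
  qed (auto intro!: diff simp: \<Gamma>D free_gen_closed gen)
  then have "twisted_relators K G \<sigma> \<subseteq> a_kernel F B (free_ext K B \<Gamma>)"
    using twisted_relators_subset unfolding a_kernel_def' by blast
  then have "twisted_ideal K G \<sigma> \<subseteq> a_kernel F B (free_ext K B \<Gamma>)"
    unfolding twisted_ideal_def by (rule F.genideal_minimal[OF h.kernel_is_ideal])
  then show ?thesis
    using p unfolding a_kernel_def' by blast
qed

abbreviation "coset \<equiv> (+>\<^bsub>F\<^esub>) (twisted_ideal K G \<sigma>)"

lemma coset_hom: "coset \<in> alg_hom K F A"
  unfolding twisted_par_algebra_def by (rule coset_in_alg_hom[OF F_assoc twisted_ideal_ideal])

lemma coset_eq_zero: "p \<in> carrier F \<Longrightarrow> coset p = \<zero>\<^bsub>A\<^esub> \<longleftrightarrow> p \<in> twisted_ideal K G \<sigma>"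
  unfolding twisted_par_algebra_def quotient_algebra_sel
  by (rule ideal.coset_eq_zero_iff[OF twisted_ideal_ideal])

sublocale coset: ring_hom_ring F A coset
  by (rule alg_hom_ring_hom_ring[OF F_assoc A.assoc_algebra_axioms coset_hom])

abbreviation "x \<equiv> twisted_gen K G \<sigma>"

lemma twisted_relatorsI:
  assumes "g \<in> carrier G" "h \<in> carrier G"
  shows "\<sigma> g h = \<zero>\<^bsub>K\<^esub> \<Longrightarrow>
      free_gen K (inv\<^bsub>G\<^esub> g) \<otimes>\<^bsub>F\<^esub> free_gen K (g \<otimes>\<^bsub>G\<^esub> h) \<in> twisted_relators K G \<sigma>"
    and "\<sigma> g h = \<zero>\<^bsub>K\<^esub> \<Longrightarrow>
      free_gen K (g \<otimes>\<^bsub>G\<^esub> h) \<otimes>\<^bsub>F\<^esub> free_gen K (inv\<^bsub>G\<^esub> h) \<in> twisted_relators K G \<sigma>"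
    and "free_gen K (inv\<^bsub>G\<^esub> g) \<otimes>\<^bsub>F\<^esub> free_gen K g \<otimes>\<^bsub>F\<^esub> free_gen K h \<ominus>\<^bsub>F\<^esub>
        \<sigma> g h \<odot>\<^bsub>F\<^esub> (free_gen K (inv\<^bsub>G\<^esub> g) \<otimes>\<^bsub>F\<^esub> free_gen K (g \<otimes>\<^bsub>G\<^esub> h)) \<in> twisted_relators K G \<sigma>"
    and "free_gen K g \<otimes>\<^bsub>F\<^esub> free_gen K h \<otimes>\<^bsub>F\<^esub> free_gen K (inv\<^bsub>G\<^esub> h) \<ominus>\<^bsub>F\<^esub>
        \<sigma> g h \<odot>\<^bsub>F\<^esub> (free_gen K (g \<otimes>\<^bsub>G\<^esub> h) \<otimes>\<^bsub>F\<^esub> free_gen K (inv\<^bsub>G\<^esub> h)) \<in> twisted_relators K G \<sigma>"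
    and "free_gen K \<one>\<^bsub>G\<^esub> \<ominus>\<^bsub>F\<^esub> \<one>\<^bsub>F\<^esub> \<in> twisted_relators K G \<sigma>"
  using assms unfolding twisted_relators_def Let_def by blast+

lemma twisted_rep_gen: "twisted_rep A x"
proof -
  have zero: "coset p = \<zero>\<^bsub>A\<^esub>" if "p \<in> twisted_relators K G \<sigma>" for p
    using that twisted_relators_subset F.genideal_self[OF twisted_relators_subset]
    by (intro coset_eq_zero[THEN iffD2]) (auto simp: twisted_ideal_def)
  have eq: "coset p = coset q"
    if "p \<ominus>\<^bsub>F\<^esub> q \<in> twisted_relators K G \<sigma>" "p \<in> carrier F" "q \<in> carrier F" for p q
    using zero[OF that(1)] that(2,3) by (simp add: F.minus_eq flip: A.minus_eq)
  show ?thesis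
    unfolding twisted_rep_def twisted_gen_def
  proof (intro conjI ballI impI)
    show "(\<lambda>g. coset (free_gen K g)) \<in> carrier G \<rightarrow> carrier A"
      by (auto simp: free_gen_closed)
    show "coset (free_gen K \<one>\<^bsub>G\<^esub>) = \<one>\<^bsub>A\<^esub>"
      unfolding coset.hom_one[symmetric]
      by (rule eq[OF twisted_relatorsI(5)]) (auto simp: free_gen_closed)
    fix g h assume g: "g \<in> carrier G" and h: "h \<in> carrier G"
    note c = free_gen_closed[OF g] free_gen_closed[OF h] free_gen_closed[OF G.inv_closed[OF g]]
      free_gen_closed[OF G.inv_closed[OF h]] free_gen_closed[OF G.m_closed[OF g h]]
      factor_closed[OF g h]
    show "coset (free_gen K (inv\<^bsub>G\<^esub> g)) \<otimes>\<^bsub>A\<^esub> coset (free_gen K g) \<otimes>\<^bsub>A\<^esub> coset (free_gen K h)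
      = \<sigma> g h \<odot>\<^bsub>A\<^esub> (coset (free_gen K (inv\<^bsub>G\<^esub> g)) \<otimes>\<^bsub>A\<^esub> coset (free_gen K (g \<otimes>\<^bsub>G\<^esub> h)))"
      using eq[OF twisted_relatorsI(3)[OF g h]] c by (simp add: alg_homD(5)[OF coset_hom])
    show "coset (free_gen K g) \<otimes>\<^bsub>A\<^esub> coset (free_gen K h) \<otimes>\<^bsub>A\<^esub> coset (free_gen K (inv\<^bsub>G\<^esub> h))
      = \<sigma> g h \<odot>\<^bsub>A\<^esub> (coset (free_gen K (g \<otimes>\<^bsub>G\<^esub> h)) \<otimes>\<^bsub>A\<^esub> coset (free_gen K (inv\<^bsub>G\<^esub> h)))"
      using eq[OF twisted_relatorsI(4)[OF g h]] c by (simp add: alg_homD(5)[OF coset_hom])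
    assume "\<sigma> g h = \<zero>\<^bsub>K\<^esub>"
    note rel = zero[OF twisted_relatorsI(1)[OF g h this]] zero[OF twisted_relatorsI(2)[OF g h this]]
    show "coset (free_gen K (inv\<^bsub>G\<^esub> g)) \<otimes>\<^bsub>A\<^esub> coset (free_gen K (g \<otimes>\<^bsub>G\<^esub> h)) = \<zero>\<^bsub>A\<^esub>"
      using rel(1) c by simp
    show "coset (free_gen K (g \<otimes>\<^bsub>G\<^esub> h)) \<otimes>\<^bsub>A\<^esub> coset (free_gen K (inv\<^bsub>G\<^esub> h)) = \<zero>\<^bsub>A\<^esub>"
      using rel(2) c by simp
  qed
qed

lemmas x_closed [simp] = twisted_repD(1)[OF twisted_rep_gen]
  and x_one [simp] = twisted_repD(2)[OF twisted_rep_gen]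
  and x_zero = twisted_repD(3,4)[OF twisted_rep_gen]
  and x_left = twisted_repD(5)[OF twisted_rep_gen]
  and x_right = twisted_repD(6)[OF twisted_rep_gen]

section \<open>Relations between the symbols and the idempotents\<close>

abbreviation "e \<equiv> twisted_idem K G \<sigma>"

text \<open>If \<sigma> vanishes at \<open>g\<close> and its inverse, the relators for this pair
  have the neutral element as one factor, so they annihilate both symbols themselves. Calculations
  can thus assume an invertible normalising scalar \<open>c\<close>.\<close>

lemma idem_cases:
  assumes "g \<in> carrier G"
  obtains (zero) "\<sigma> g (inv\<^bsub>G\<^esub> g) = \<zero>\<^bsub>K\<^esub>" "e g = \<zero>\<^bsub>A\<^esub>" "x g = \<zero>\<^bsub>A\<^esub>" "x (inv\<^bsub>G\<^esub> g) = \<zero>\<^bsub>A\<^esub>"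
  | (nonzero) c where "c \<in> carrier K" "c \<otimes>\<^bsub>K\<^esub> \<sigma> g (inv\<^bsub>G\<^esub> g) = \<one>\<^bsub>K\<^esub>"
      "e g = c \<odot>\<^bsub>A\<^esub> (x g \<otimes>\<^bsub>A\<^esub> x (inv\<^bsub>G\<^esub> g))"
proof (cases "\<sigma> g (inv\<^bsub>G\<^esub> g) = \<zero>\<^bsub>K\<^esub>")
  case True
  moreover have "x g = \<zero>\<^bsub>A\<^esub>" "x (inv\<^bsub>G\<^esub> g) = \<zero>\<^bsub>A\<^esub>"
    using x_zero[OF assms G.inv_closed[OF assms] True] assms by simp_all
  ultimately show thesis
    using zero by (simp add: twisted_idem_def Let_def)
next
  case False
  then have "\<sigma> g (inv\<^bsub>G\<^esub> g) \<in> Units K"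
    using assms by (simp add: K.field_Units factor_closed)
  then show thesis
    using False by (intro nonzero[of "inv\<^bsub>K\<^esub> (\<sigma> g (inv\<^bsub>G\<^esub> g))"]) (auto simp: twisted_idem_def Let_def)
qed

lemma e_closed [simp]: "g \<in> carrier G \<Longrightarrow> e g \<in> carrier A"
  by (rule idem_cases[of g]) auto

lemma e_one [simp]: "e \<one>\<^bsub>G\<^esub> = \<one>\<^bsub>A\<^esub>"
  by (simp add: twisted_idem_def Let_def factor_one)

text \<open>The right-hand relation for \<open>g\<close> and its inverse says that [g] times
  [inverse of g] times [g] is a multiple of [g]; the scalar is exactly the one by which
  \<open>e g\<close> is normalised.\<close>

lemma e_x [simp]:
  assumes "g \<in> carrier G"
  shows "e g \<otimes>\<^bsub>A\<^esub> x g = x g"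
  using assms
proof (cases rule: idem_cases)
  case (nonzero c)
  then show ?thesis
    using assms x_right[of g "inv\<^bsub>G\<^esub> g"]
    by (simp add: A.smult_mult_left factor_closed flip: A.smult_assoc1)
qed simp

lemma x_inv_e [simp]:
  assumes "g \<in> carrier G"
  shows "x (inv\<^bsub>G\<^esub> g) \<otimes>\<^bsub>A\<^esub> e g = x (inv\<^bsub>G\<^esub> g)"
  using assms
proof (cases rule: idem_cases)
  case (nonzero c)
  then show ?thesis
    using assms x_left[of g "inv\<^bsub>G\<^esub> g"]
    by (simp add: A.smult_mult_right factor_closed A.m_assoc flip: A.smult_assoc1)
qed (use assms in simp)

lemma e_idem:
  assumes "g \<in> carrier G"
  shows "e g \<otimes>\<^bsub>A\<^esub> e g = e g"
  using assms
proof (cases rule: idem_cases)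
  case (nonzero c)
  have "e g \<otimes>\<^bsub>A\<^esub> (c \<odot>\<^bsub>A\<^esub> (x g \<otimes>\<^bsub>A\<^esub> x (inv\<^bsub>G\<^esub> g))) = c \<odot>\<^bsub>A\<^esub> (x g \<otimes>\<^bsub>A\<^esub> x (inv\<^bsub>G\<^esub> g))"
    using assms nonzero(1) by (simp add: A.smult_mult_right flip: A.m_assoc)
  then show ?thesis
    using nonzero(3) by metis
qed simp

text \<open>The left-hand relation rewrites [g][h] only behind the symbol of the inverse of
  \<open>g\<close>. Inserting \<open>e g\<close> in front of [g] provides that symbol, and
  \<open>e g\<close> is what remains afterwards.\<close>

lemma x_mult:
  assumes g: "g \<in> carrier G" and h: "h \<in> carrier G"
  shows "x g \<otimes>\<^bsub>A\<^esub> x h = \<sigma> g h \<odot>\<^bsub>A\<^esub> (e g \<otimes>\<^bsub>A\<^esub> x (g \<otimes>\<^bsub>G\<^esub> h))"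
  using g
proof (cases rule: idem_cases)
  case zero
  then show ?thesis
    using assms by (simp add: factor_closed)
next
  case (nonzero c)
  have closed: "x g \<in> carrier A" "x h \<in> carrier A" "x (inv\<^bsub>G\<^esub> g) \<in> carrier A" "x (g \<otimes>\<^bsub>G\<^esub> h) \<in> carrier A"
      "\<sigma> g h \<in> carrier K"
    using assms by (auto intro: factor_closed)
  have "x g \<otimes>\<^bsub>A\<^esub> x h = (e g \<otimes>\<^bsub>A\<^esub> x g) \<otimes>\<^bsub>A\<^esub> x h"
    using assms by simp
  also have "\<dots> = c \<odot>\<^bsub>A\<^esub> (x g \<otimes>\<^bsub>A\<^esub> (x (inv\<^bsub>G\<^esub> g) \<otimes>\<^bsub>A\<^esub> x g \<otimes>\<^bsub>A\<^esub> x h))"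
    using closed nonzero(1) unfolding nonzero(3) by (simp add: A.smult_mult_left A.m_assoc)
  also have "\<dots> = c \<odot>\<^bsub>A\<^esub> (\<sigma> g h \<odot>\<^bsub>A\<^esub> (x g \<otimes>\<^bsub>A\<^esub> x (inv\<^bsub>G\<^esub> g) \<otimes>\<^bsub>A\<^esub> x (g \<otimes>\<^bsub>G\<^esub> h)))"
    using closed unfolding x_left[OF g h] by (simp add: A.smult_mult_right A.m_assoc)
  also have "\<dots> = (\<sigma> g h \<otimes>\<^bsub>K\<^esub> c) \<odot>\<^bsub>A\<^esub> (x g \<otimes>\<^bsub>A\<^esub> x (inv\<^bsub>G\<^esub> g) \<otimes>\<^bsub>A\<^esub> x (g \<otimes>\<^bsub>G\<^esub> h))"
    using closed nonzero(1) by (simp add: K.m_comm[of "\<sigma> g h"] A.smult_assoc1)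
  also have "\<dots> = \<sigma> g h \<odot>\<^bsub>A\<^esub> (e g \<otimes>\<^bsub>A\<^esub> x (g \<otimes>\<^bsub>G\<^esub> h))"
    using closed nonzero(1) unfolding nonzero(3) by (simp add: A.smult_assoc1 A.smult_mult_left)
  finally show ?thesis .
qed

text \<open>Both sides are multiples of \<open>z = [gh][h\<inverse>]\<close>, which is fixed by \<open>e (gh)\<close> from the left and by
  \<open>e h\<close> from the right; this makes the comparison of the scalars unnecessary.\<close>

lemma x_e:
  assumes g: "g \<in> carrier G" and h: "h \<in> carrier G"
  shows "x g \<otimes>\<^bsub>A\<^esub> e h = e (g \<otimes>\<^bsub>G\<^esub> h) \<otimes>\<^bsub>A\<^esub> x g"
proof -
  define z where "z = x (g \<otimes>\<^bsub>G\<^esub> h) \<otimes>\<^bsub>A\<^esub> x (inv\<^bsub>G\<^esub> h)"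
  have z: "z \<in> carrier A"
    using assms by (simp add: z_def)
  have "\<exists>a\<in>carrier K. x g \<otimes>\<^bsub>A\<^esub> e h = a \<odot>\<^bsub>A\<^esub> z"
    using h
  proof (cases rule: idem_cases)
    case zero
    then show ?thesis
      using assms z by (intro bexI[of _ "\<zero>\<^bsub>K\<^esub>"]) auto
  next
    case (nonzero c)
    have "x g \<otimes>\<^bsub>A\<^esub> e h = c \<odot>\<^bsub>A\<^esub> (x g \<otimes>\<^bsub>A\<^esub> x h \<otimes>\<^bsub>A\<^esub> x (inv\<^bsub>G\<^esub> h))"
      unfolding nonzero(3) using assms nonzero(1) by (simp add: A.smult_mult_right A.m_assoc)
    also have "\<dots> = (c \<otimes>\<^bsub>K\<^esub> \<sigma> g h) \<odot>\<^bsub>A\<^esub> z"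
      unfolding x_right[OF g h] using assms nonzero(1) z by (simp add: A.smult_assoc1 factor_closed z_def)
    finally show ?thesis
      using assms nonzero(1) by (intro bexI[of _ "c \<otimes>\<^bsub>K\<^esub> \<sigma> g h"]) (auto intro: factor_closed)
  qed
  then obtain a where a: "a \<in> carrier K" "x g \<otimes>\<^bsub>A\<^esub> e h = a \<odot>\<^bsub>A\<^esub> z"
    by blast
  have gh: "g \<otimes>\<^bsub>G\<^esub> h \<in> carrier G"
    using assms by simp
  have "\<exists>b\<in>carrier K. e (g \<otimes>\<^bsub>G\<^esub> h) \<otimes>\<^bsub>A\<^esub> x g = b \<odot>\<^bsub>A\<^esub> z"
    using gh
  proof (cases rule: idem_cases)
    case zero
    then show ?thesis
      using assms z by (intro bexI[of _ "\<zero>\<^bsub>K\<^esub>"]) auto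
  next
    case (nonzero c)
    let ?s = "\<sigma> (inv\<^bsub>G\<^esub> (g \<otimes>\<^bsub>G\<^esub> h)) g"
    have s: "?s \<in> carrier K"
      using assms by (auto intro: factor_closed)
    have inv: "inv\<^bsub>G\<^esub> (g \<otimes>\<^bsub>G\<^esub> h) \<otimes>\<^bsub>G\<^esub> g = inv\<^bsub>G\<^esub> h"
      using assms by (simp add: G.inv_mult_group G.m_assoc)
    have "e (g \<otimes>\<^bsub>G\<^esub> h) \<otimes>\<^bsub>A\<^esub> x g = c \<odot>\<^bsub>A\<^esub> (x (g \<otimes>\<^bsub>G\<^esub> h) \<otimes>\<^bsub>A\<^esub> x (inv\<^bsub>G\<^esub> (g \<otimes>\<^bsub>G\<^esub> h)) \<otimes>\<^bsub>A\<^esub> x g)"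
      unfolding nonzero(3) using assms nonzero(1) by (simp add: A.smult_mult_left)
    also have "x (g \<otimes>\<^bsub>G\<^esub> h) \<otimes>\<^bsub>A\<^esub> x (inv\<^bsub>G\<^esub> (g \<otimes>\<^bsub>G\<^esub> h)) \<otimes>\<^bsub>A\<^esub> x g = ?s \<odot>\<^bsub>A\<^esub> z"
      using x_left[of "inv\<^bsub>G\<^esub> (g \<otimes>\<^bsub>G\<^esub> h)" g] assms by (simp add: inv z_def)
    also have "c \<odot>\<^bsub>A\<^esub> (?s \<odot>\<^bsub>A\<^esub> z) = (c \<otimes>\<^bsub>K\<^esub> ?s) \<odot>\<^bsub>A\<^esub> z"
      using s nonzero(1) z by (simp add: A.smult_assoc1)
    finally show ?thesis
      using s nonzero(1) by (intro bexI[of _ "c \<otimes>\<^bsub>K\<^esub> ?s"]) auto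
  qed
  then obtain b where b: "b \<in> carrier K" "e (g \<otimes>\<^bsub>G\<^esub> h) \<otimes>\<^bsub>A\<^esub> x g = b \<odot>\<^bsub>A\<^esub> z"
    by blast
  have ez: "e (g \<otimes>\<^bsub>G\<^esub> h) \<otimes>\<^bsub>A\<^esub> z = z"
    unfolding z_def using assms by (simp flip: A.m_assoc)
  have ze: "z \<otimes>\<^bsub>A\<^esub> e h = z"
    unfolding z_def using assms by (simp add: A.m_assoc)
  have "a \<odot>\<^bsub>A\<^esub> z = e (g \<otimes>\<^bsub>G\<^esub> h) \<otimes>\<^bsub>A\<^esub> (x g \<otimes>\<^bsub>A\<^esub> e h)"
    unfolding a(2) using a(1) z gh by (simp add: A.smult_mult_right ez)
  also have "\<dots> = (e (g \<otimes>\<^bsub>G\<^esub> h) \<otimes>\<^bsub>A\<^esub> x g) \<otimes>\<^bsub>A\<^esub> e h"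
    using assms gh by (simp add: A.m_assoc)
  also have "\<dots> = b \<odot>\<^bsub>A\<^esub> z"
    unfolding b(2) using b(1) z h by (simp add: A.smult_mult_left ze)
  finally show ?thesis
    by (simp add: a(2) b(2))
qed

text \<open>Used to push the symbol of the inverse of \<open>s\<close> to the right through products
  of idempotents; this translates all indices and reduces vanishing statements to base point
  \<open>1\<close>.\<close>

lemma x_inv_e_translate:
  assumes "s \<in> carrier G" "g \<in> carrier G"
  shows "x (inv\<^bsub>G\<^esub> s) \<otimes>\<^bsub>A\<^esub> e (s \<otimes>\<^bsub>G\<^esub> g) = e g \<otimes>\<^bsub>A\<^esub> x (inv\<^bsub>G\<^esub> s)"
  using x_e[of "inv\<^bsub>G\<^esub> s" "s \<otimes>\<^bsub>G\<^esub> g"] assms by (simp flip: G.m_assoc)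

lemma x_inv_e_translate_mult:
  assumes "s \<in> carrier G" "g \<in> carrier G" "y \<in> carrier A"
  shows "x (inv\<^bsub>G\<^esub> s) \<otimes>\<^bsub>A\<^esub> (e (s \<otimes>\<^bsub>G\<^esub> g) \<otimes>\<^bsub>A\<^esub> y) = e g \<otimes>\<^bsub>A\<^esub> (x (inv\<^bsub>G\<^esub> s) \<otimes>\<^bsub>A\<^esub> y)"
  using assms by (simp add: x_inv_e_translate flip: A.m_assoc)

text \<open>By \<open>x_e\<close>, moving \<open>e h\<close> through the two symbols that make up
  \<open>e g\<close> translates its index by the inverse of \<open>g\<close> and then by
  \<open>g\<close>, so it reappears unchanged.\<close>

lemma e_comm:
  assumes g: "g \<in> carrier G" and h: "h \<in> carrier G"
  shows "e g \<otimes>\<^bsub>A\<^esub> e h = e h \<otimes>\<^bsub>A\<^esub> e g"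
  using g
proof (cases rule: idem_cases)
  case zero
  then show ?thesis
    using h by simp
next
  case (nonzero c)
  have inv: "g \<otimes>\<^bsub>G\<^esub> (inv\<^bsub>G\<^esub> g \<otimes>\<^bsub>G\<^esub> h) = h"
    using assms by (simp flip: G.m_assoc)
  have "x g \<otimes>\<^bsub>A\<^esub> x (inv\<^bsub>G\<^esub> g) \<otimes>\<^bsub>A\<^esub> e h = x g \<otimes>\<^bsub>A\<^esub> (x (inv\<^bsub>G\<^esub> g) \<otimes>\<^bsub>A\<^esub> e h)"
    using assms by (simp add: A.m_assoc)
  also have "\<dots> = (x g \<otimes>\<^bsub>A\<^esub> e (inv\<^bsub>G\<^esub> g \<otimes>\<^bsub>G\<^esub> h)) \<otimes>\<^bsub>A\<^esub> x (inv\<^bsub>G\<^esub> g)"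
    using assms by (simp add: x_e[of "inv\<^bsub>G\<^esub> g" h] A.m_assoc)
  also have "\<dots> = e h \<otimes>\<^bsub>A\<^esub> (x g \<otimes>\<^bsub>A\<^esub> x (inv\<^bsub>G\<^esub> g))"
    using assms x_e[of g "inv\<^bsub>G\<^esub> g \<otimes>\<^bsub>G\<^esub> h"] by (simp add: inv A.m_assoc)
  finally show ?thesis
    unfolding nonzero(3) using assms nonzero(1) by (simp add: A.smult_mult_left A.smult_mult_right)
qed

text \<open>Up to a scalar, \<open>e s\<close> ends with the symbol of the inverse of
  \<open>s\<close>, so vanishing can be tested after multiplication by that symbol alone.
  \<open>mult_e_zeroI\<close> is the mirror image.\<close>

lemma e_mult_zeroI:
  assumes s: "s \<in> carrier G" and y: "y \<in> carrier A" and zero: "x (inv\<^bsub>G\<^esub> s) \<otimes>\<^bsub>A\<^esub> y = \<zero>\<^bsub>A\<^esub>"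
  shows "e s \<otimes>\<^bsub>A\<^esub> y = \<zero>\<^bsub>A\<^esub>"
  using s
proof (cases rule: idem_cases)
  case (nonzero c)
  have "(x s \<otimes>\<^bsub>A\<^esub> x (inv\<^bsub>G\<^esub> s)) \<otimes>\<^bsub>A\<^esub> y = \<zero>\<^bsub>A\<^esub>"
    using assms by (simp add: A.m_assoc)
  then show ?thesis
    unfolding nonzero(3) using assms nonzero(1) by (simp add: A.smult_mult_left)
qed (use y in simp)

lemma mult_e_zeroI:
  assumes g: "g \<in> carrier G" and y: "y \<in> carrier A" and zero: "y \<otimes>\<^bsub>A\<^esub> x g = \<zero>\<^bsub>A\<^esub>"
  shows "y \<otimes>\<^bsub>A\<^esub> e g = \<zero>\<^bsub>A\<^esub>"
  using g
proof (cases rule: idem_cases)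
  case (nonzero c)
  have "y \<otimes>\<^bsub>A\<^esub> (x g \<otimes>\<^bsub>A\<^esub> x (inv\<^bsub>G\<^esub> g)) = \<zero>\<^bsub>A\<^esub>"
    using assms by (simp flip: A.m_assoc)
  then show ?thesis
    unfolding nonzero(3) using assms nonzero(1) by (simp add: A.smult_mult_right)
qed (use y in simp)

text \<open>Translation by \<open>s\<close> reduces the claim to the product of \<open>e g\<close>
  and \<open>e (gh)\<close>. Up to a scalar, this product has the symbol of the inverse of
  \<open>g\<close> next to the symbol of \<open>gh\<close> in its middle, and that pair is a
  relator.\<close>

lemma e_zero_factor:
  assumes s: "s \<in> carrier G" and g: "g \<in> carrier G" and h: "h \<in> carrier G"
    and zero: "\<sigma> g h = \<zero>\<^bsub>K\<^esub>"
  shows "e s \<otimes>\<^bsub>A\<^esub> (e (s \<otimes>\<^bsub>G\<^esub> g) \<otimes>\<^bsub>A\<^esub> e (s \<otimes>\<^bsub>G\<^esub> g \<otimes>\<^bsub>G\<^esub> h)) = \<zero>\<^bsub>A\<^esub>"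
proof (rule e_mult_zeroI)
  have "e g \<otimes>\<^bsub>A\<^esub> e (g \<otimes>\<^bsub>G\<^esub> h) = \<zero>\<^bsub>A\<^esub>"
    using assms x_zero(1)[OF g h zero] by (intro e_mult_zeroI mult_e_zeroI) auto
  moreover have "x (inv\<^bsub>G\<^esub> s) \<otimes>\<^bsub>A\<^esub> (e (s \<otimes>\<^bsub>G\<^esub> g) \<otimes>\<^bsub>A\<^esub> e (s \<otimes>\<^bsub>G\<^esub> (g \<otimes>\<^bsub>G\<^esub> h)))
      = e g \<otimes>\<^bsub>A\<^esub> e (g \<otimes>\<^bsub>G\<^esub> h) \<otimes>\<^bsub>A\<^esub> x (inv\<^bsub>G\<^esub> s)"
    using assms by (simp add: A.m_assoc x_inv_e_translate x_inv_e_translate_mult)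
  ultimately show "x (inv\<^bsub>G\<^esub> s) \<otimes>\<^bsub>A\<^esub> (e (s \<otimes>\<^bsub>G\<^esub> g) \<otimes>\<^bsub>A\<^esub> e (s \<otimes>\<^bsub>G\<^esub> g \<otimes>\<^bsub>G\<^esub> h)) = \<zero>\<^bsub>A\<^esub>"
    using assms by (simp add: G.m_assoc)
qed (use assms in auto)

text \<open>The product [g][h][t] is computed with both bracketings. The first yields
  \<open>?a\<close> times \<open>y\<close> by \<open>x_mult\<close> alone; the second needs
  \<open>x_e\<close> to move \<open>e h\<close> past [g] and yields \<open>?b\<close> times the same
  \<open>y\<close>. As distinct scalars of a field differ by a unit, \<open>y\<close> is
  zero.\<close>

lemma e_zero_cocycle_one:
  assumes g: "g \<in> carrier G" and h: "h \<in> carrier G" and t: "t \<in> carrier G"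
    and neq: "\<sigma> g h \<otimes>\<^bsub>K\<^esub> \<sigma> (g \<otimes>\<^bsub>G\<^esub> h) t \<noteq> \<sigma> g (h \<otimes>\<^bsub>G\<^esub> t) \<otimes>\<^bsub>K\<^esub> \<sigma> h t"
  shows "e g \<otimes>\<^bsub>A\<^esub> e (g \<otimes>\<^bsub>G\<^esub> h) \<otimes>\<^bsub>A\<^esub> e (g \<otimes>\<^bsub>G\<^esub> (h \<otimes>\<^bsub>G\<^esub> t)) = \<zero>\<^bsub>A\<^esub>"
proof (rule mult_e_zeroI)
  let ?k = "g \<otimes>\<^bsub>G\<^esub> (h \<otimes>\<^bsub>G\<^esub> t)"
  define y where "y = e g \<otimes>\<^bsub>A\<^esub> e (g \<otimes>\<^bsub>G\<^esub> h) \<otimes>\<^bsub>A\<^esub> x ?k"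
  let ?a = "\<sigma> g h \<otimes>\<^bsub>K\<^esub> \<sigma> (g \<otimes>\<^bsub>G\<^esub> h) t" and ?b = "\<sigma> g (h \<otimes>\<^bsub>G\<^esub> t) \<otimes>\<^bsub>K\<^esub> \<sigma> h t"
  have factors: "\<sigma> g h \<in> carrier K" "\<sigma> (g \<otimes>\<^bsub>G\<^esub> h) t \<in> carrier K" "\<sigma> g (h \<otimes>\<^bsub>G\<^esub> t) \<in> carrier K" "\<sigma> h t \<in> carrier K"
    using assms by (auto intro: factor_closed)
  have y: "y \<in> carrier A"
    using assms by (simp add: y_def)
  have "x g \<otimes>\<^bsub>A\<^esub> x h \<otimes>\<^bsub>A\<^esub> x t = \<sigma> g h \<odot>\<^bsub>A\<^esub> (e g \<otimes>\<^bsub>A\<^esub> (x (g \<otimes>\<^bsub>G\<^esub> h) \<otimes>\<^bsub>A\<^esub> x t))"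
    using assms factors by (simp add: x_mult[OF g h] A.smult_mult_left A.m_assoc)
  also have "\<dots> = \<sigma> g h \<odot>\<^bsub>A\<^esub> (\<sigma> (g \<otimes>\<^bsub>G\<^esub> h) t \<odot>\<^bsub>A\<^esub> y)"
    using assms factors
    by (simp add: x_mult[of "g \<otimes>\<^bsub>G\<^esub> h" t] A.smult_mult_right A.m_assoc G.m_assoc y_def)
  finally have 1: "x g \<otimes>\<^bsub>A\<^esub> x h \<otimes>\<^bsub>A\<^esub> x t = ?a \<odot>\<^bsub>A\<^esub> y"
    using factors y by (simp add: A.smult_assoc1)
  have "x g \<otimes>\<^bsub>A\<^esub> x h \<otimes>\<^bsub>A\<^esub> x t = x g \<otimes>\<^bsub>A\<^esub> (x h \<otimes>\<^bsub>A\<^esub> x t)"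
    using assms by (simp add: A.m_assoc)
  also have "\<dots> = \<sigma> h t \<odot>\<^bsub>A\<^esub> ((x g \<otimes>\<^bsub>A\<^esub> e h) \<otimes>\<^bsub>A\<^esub> x (h \<otimes>\<^bsub>G\<^esub> t))"
    using assms factors by (simp add: x_mult[OF h t] A.smult_mult_right A.m_assoc)
  also have "\<dots> = \<sigma> h t \<odot>\<^bsub>A\<^esub> (e (g \<otimes>\<^bsub>G\<^esub> h) \<otimes>\<^bsub>A\<^esub> (x g \<otimes>\<^bsub>A\<^esub> x (h \<otimes>\<^bsub>G\<^esub> t)))"
    using assms by (simp add: x_e[OF g h] A.m_assoc)
  also have "\<dots> = \<sigma> h t \<odot>\<^bsub>A\<^esub> (\<sigma> g (h \<otimes>\<^bsub>G\<^esub> t) \<odot>\<^bsub>A\<^esub> (e (g \<otimes>\<^bsub>G\<^esub> h) \<otimes>\<^bsub>A\<^esub> e g \<otimes>\<^bsub>A\<^esub> x ?k))"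
    using assms factors by (simp add: x_mult[of g "h \<otimes>\<^bsub>G\<^esub> t"] A.smult_mult_right A.m_assoc)
  also have "e (g \<otimes>\<^bsub>G\<^esub> h) \<otimes>\<^bsub>A\<^esub> e g \<otimes>\<^bsub>A\<^esub> x ?k = y"
    using assms by (simp add: y_def e_comm[of g])
  finally have 2: "x g \<otimes>\<^bsub>A\<^esub> x h \<otimes>\<^bsub>A\<^esub> x t = ?b \<odot>\<^bsub>A\<^esub> y"
    using factors y by (simp add: A.smult_assoc1 K.m_comm[of "\<sigma> g _"])
  have diff: "?a \<ominus>\<^bsub>K\<^esub> ?b \<in> Units K"
    using neq factors by (simp add: K.field_Units)
  have "(?a \<ominus>\<^bsub>K\<^esub> ?b) \<odot>\<^bsub>A\<^esub> y = \<zero>\<^bsub>A\<^esub>"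
    using 1 2 factors y by (simp add: K.minus_eq A.smult_l_distr A.smult_l_minus A.M.r_neg)
  then have "inv\<^bsub>K\<^esub> (?a \<ominus>\<^bsub>K\<^esub> ?b) \<odot>\<^bsub>A\<^esub> ((?a \<ominus>\<^bsub>K\<^esub> ?b) \<odot>\<^bsub>A\<^esub> y) = \<zero>\<^bsub>A\<^esub>"
    using diff by simp
  then have "y = \<zero>\<^bsub>A\<^esub>"
    using diff y factors by (simp flip: A.smult_assoc1)
  then show "e g \<otimes>\<^bsub>A\<^esub> e (g \<otimes>\<^bsub>G\<^esub> h) \<otimes>\<^bsub>A\<^esub> x ?k = \<zero>\<^bsub>A\<^esub>"
    by (simp add: y_def)
qed (use assms in auto)

lemma e_zero_cocycle:
  assumes s: "s \<in> carrier G" and g: "g \<in> carrier G" and h: "h \<in> carrier G" and t: "t \<in> carrier G"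
    and neq: "\<sigma> g h \<otimes>\<^bsub>K\<^esub> \<sigma> (g \<otimes>\<^bsub>G\<^esub> h) t \<noteq> \<sigma> g (h \<otimes>\<^bsub>G\<^esub> t) \<otimes>\<^bsub>K\<^esub> \<sigma> h t"
  shows "e s \<otimes>\<^bsub>A\<^esub> (e (s \<otimes>\<^bsub>G\<^esub> g) \<otimes>\<^bsub>A\<^esub> (e (s \<otimes>\<^bsub>G\<^esub> g \<otimes>\<^bsub>G\<^esub> h) \<otimes>\<^bsub>A\<^esub> e (s \<otimes>\<^bsub>G\<^esub> g \<otimes>\<^bsub>G\<^esub> h \<otimes>\<^bsub>G\<^esub> t))) = \<zero>\<^bsub>A\<^esub>"
proof (rule e_mult_zeroI)
  have "x (inv\<^bsub>G\<^esub> s) \<otimes>\<^bsub>A\<^esub> (e (s \<otimes>\<^bsub>G\<^esub> g) \<otimes>\<^bsub>A\<^esub> (e (s \<otimes>\<^bsub>G\<^esub> (g \<otimes>\<^bsub>G\<^esub> h)) \<otimes>\<^bsub>A\<^esub> e (s \<otimes>\<^bsub>G\<^esub> (g \<otimes>\<^bsub>G\<^esub> (h \<otimes>\<^bsub>G\<^esub> t)))))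
      = e g \<otimes>\<^bsub>A\<^esub> e (g \<otimes>\<^bsub>G\<^esub> h) \<otimes>\<^bsub>A\<^esub> e (g \<otimes>\<^bsub>G\<^esub> (h \<otimes>\<^bsub>G\<^esub> t)) \<otimes>\<^bsub>A\<^esub> x (inv\<^bsub>G\<^esub> s)"
    using assms by (simp add: A.m_assoc x_inv_e_translate x_inv_e_translate_mult)
  then show "x (inv\<^bsub>G\<^esub> s) \<otimes>\<^bsub>A\<^esub>
      (e (s \<otimes>\<^bsub>G\<^esub> g) \<otimes>\<^bsub>A\<^esub> (e (s \<otimes>\<^bsub>G\<^esub> g \<otimes>\<^bsub>G\<^esub> h) \<otimes>\<^bsub>A\<^esub> e (s \<otimes>\<^bsub>G\<^esub> g \<otimes>\<^bsub>G\<^esub> h \<otimes>\<^bsub>G\<^esub> t))) = \<zero>\<^bsub>A\<^esub>"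
    using assms e_zero_cocycle_one[OF g h t neq] by (simp add: G.m_assoc)
qed (use assms in auto)

end

section \<open>Systems of commuting idempotents\<close>

text \<open>The induction removes one whole fibre of \<open>k\<close> at a time. In both
  applications \<open>k\<close> is the letter set of a word with \<open>1\<close> adjoined.\<close>

lemma (in abelian_monoid) finsum_zero_if_fibers_zero:
  assumes "finite A" "\<And>x. x \<in> A \<Longrightarrow> f x \<in> carrier G"
    and "\<And>x. x \<in> A \<Longrightarrow> (\<Oplus>y\<in>{y \<in> A. k y = k x}. f y) = \<zero>"
  shows "(\<Oplus>x\<in>A. f x) = \<zero>"
  using assms
proof (induction A rule: finite_psubset_induct)
  case (psubset A)
  show ?case
  proof (cases "A = {}")
    case False
    then obtain x where x: "x \<in> A" by blast
    let ?B = "{y \<in> A. k y = k x}" and ?C = "{y \<in> A. k y \<noteq> k x}"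
    have "(\<Oplus>z\<in>{z \<in> ?C. k z = k y}. f z) = \<zero>" if "y \<in> ?C" for y
    proof -
      have "{z \<in> ?C. k z = k y} = {z \<in> A. k z = k y}"
        using that by auto
      then show ?thesis
        using that psubset.prems(2)[of y] by (metis (mono_tags, lifting) mem_Collect_eq)
    qed
    moreover have C_subset: "?C \<subset> A"
      using x by blast
    ultimately have C: "(\<Oplus>y\<in>?C. f y) = \<zero>"
      using psubset.IH[OF C_subset] psubset.prems(1) by simp
    have "(\<Oplus>y\<in>?B \<union> ?C. f y) = (\<Oplus>y\<in>?B. f y) \<oplus> (\<Oplus>y\<in>?C. f y)"
      by (rule finsum_Un_disjoint) (use psubset.hyps psubset.prems(1) in \<open>simp_all add: Pi_def disjoint_iff\<close>)
    moreover have "?B \<union> ?C = A"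
      by auto
    ultimately show ?thesis
      using C psubset.prems(2)[OF x] by simp
  qed simp
qed

lemma (in module) finsum_smult_rdistr:
  assumes "finite I" "\<And>i. i \<in> I \<Longrightarrow> a i \<in> carrier R" "y \<in> carrier M"
  shows "(\<Oplus>\<^bsub>M\<^esub>i\<in>I. a i \<odot>\<^bsub>M\<^esub> y) = (\<Oplus>i\<in>I. a i) \<odot>\<^bsub>M\<^esub> y"
  using assms
proof (induction I)
  case (insert i I)
  then show ?case
    by (simp add: M.finsum_insert R.finsum_insert Pi_def smult_l_distr R.finsum_closed)
qed simp

text \<open>The value at \<open>p\<close> of the character of the free algebra that sends letters in
  \<open>S\<close> to \<open>1\<close> and all others to \<open>0\<close>.\<close>

definition char_sum :: "('k, 'm) ring_scheme \<Rightarrow> 'g set \<Rightarrow> ('g list \<Rightarrow> 'k) \<Rightarrow> 'k"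
  where "char_sum K S p = (\<Oplus>\<^bsub>K\<^esub>w\<in>{w. p w \<noteq> \<zero>\<^bsub>K\<^esub> \<and> set w \<subseteq> S}. p w)"

context normalized_factor
begin

lemma factor_spectrum_subset:
  assumes "S \<in> factor_spectrum K G \<sigma>" "T \<subseteq> S" "\<one>\<^bsub>G\<^esub> \<in> T"
  shows "T \<in> factor_spectrum K G \<sigma>"
  using assms unfolding factor_spectrum_def by (simp add: subset_iff)

text \<open>Moebius inversion in the form of an induction on \<open>S\<close>: the sum for
  \<open>S\<close> is the sum of the fibres over all subsets of \<open>S\<close> containing
  \<open>1\<close>, and all proper ones already vanish.\<close>

lemma fiber_sum_eq_zero:
  assumes p: "p \<in> carrier F"
    and sums: "\<And>S. \<lbrakk>finite S; S \<in> factor_spectrum K G \<sigma>\<rbrakk> \<Longrightarrow> char_sum K S p = \<zero>\<^bsub>K\<^esub>"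
    and S: "finite S" "S \<in> factor_spectrum K G \<sigma>"
  shows "(\<Oplus>\<^bsub>K\<^esub>w\<in>{w. p w \<noteq> \<zero>\<^bsub>K\<^esub> \<and> insert \<one>\<^bsub>G\<^esub> (set w) = S}. p w) = \<zero>\<^bsub>K\<^esub>"
  using S
proof (induction S rule: finite_psubset_induct)
  case (psubset S)
  have one: "\<one>\<^bsub>G\<^esub> \<in> S"
    using factor_spectrumD(2)[OF psubset.prems] .
  have fin: "finite {w. p w \<noteq> \<zero>\<^bsub>K\<^esub> \<and> P w}" for P
    using p by (auto simp: K.free_algebra_carrier_iff)
  have closed: "p w \<in> carrier K" for w
    using p by (auto simp: K.free_algebra_carrier_iff)
  let ?B = "{w. p w \<noteq> \<zero>\<^bsub>K\<^esub> \<and> insert \<one>\<^bsub>G\<^esub> (set w) = S}"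
  let ?C = "{w. p w \<noteq> \<zero>\<^bsub>K\<^esub> \<and> insert \<one>\<^bsub>G\<^esub> (set w) \<subset> S}"
  have "(\<Oplus>\<^bsub>K\<^esub>w\<in>?C. p w) = \<zero>\<^bsub>K\<^esub>"
  proof (rule K.finsum_zero_if_fibers_zero[where k = "\<lambda>w. insert \<one>\<^bsub>G\<^esub> (set w)"])
    fix v assume v: "v \<in> ?C"
    then have "{w \<in> ?C. insert \<one>\<^bsub>G\<^esub> (set w) = insert \<one>\<^bsub>G\<^esub> (set v)}
        = {w. p w \<noteq> \<zero>\<^bsub>K\<^esub> \<and> insert \<one>\<^bsub>G\<^esub> (set w) = insert \<one>\<^bsub>G\<^esub> (set v)}"
      by auto
    moreover have "insert \<one>\<^bsub>G\<^esub> (set v) \<in> factor_spectrum K G \<sigma>"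
      using v by (intro factor_spectrum_subset[OF psubset.prems]) auto
    ultimately show "(\<Oplus>\<^bsub>K\<^esub>w\<in>{w \<in> ?C. insert \<one>\<^bsub>G\<^esub> (set w) = insert \<one>\<^bsub>G\<^esub> (set v)}. p w) = \<zero>\<^bsub>K\<^esub>"
      using psubset.IH[of "insert \<one>\<^bsub>G\<^esub> (set v)"] v by simp
  qed (use fin closed in auto)
  moreover have "(\<Oplus>\<^bsub>K\<^esub>w\<in>?B \<union> ?C. p w) = (\<Oplus>\<^bsub>K\<^esub>w\<in>?B. p w) \<oplus>\<^bsub>K\<^esub> (\<Oplus>\<^bsub>K\<^esub>w\<in>?C. p w)"
    by (rule K.finsum_Un_disjoint) (use fin closed in \<open>simp_all add: Pi_def disjoint_iff\<close>)
  \<comment> \<open>Since \<open>1\<close> lies in \<open>S\<close>, adjoining it to the letters of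
    a word does not affect inclusion in \<open>S\<close>.\<close>
  moreover have "?B \<union> ?C = {w. p w \<noteq> \<zero>\<^bsub>K\<^esub> \<and> set w \<subseteq> S}"
    using one by auto
  ultimately show ?case
    using sums[OF psubset.hyps psubset.prems] closed by (simp add: char_sum_def K.finsum_closed)
qed

end

text \<open>The relations common to the idempotents of the twisted algebra and to the cosets in the
  quotient by \<open>factor_ideal\<close>; the vanishing criterion below is applied to both.
  Products are nested to the right because \<open>word_prod\<close> has this shape.\<close>

locale idempotent_system = normalized_factor K G \<sigma> + Q: assoc_algebra K Q
  for K :: "('k, 'm) ring_scheme" (structure) and G :: "('g, 'n) monoid_scheme" (structure)
    and \<sigma> :: "'g \<Rightarrow> 'g \<Rightarrow> 'k" and Q :: "('k, 'q, 'l) module_scheme" +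
  fixes u :: "'g \<Rightarrow> 'q"
  assumes u_closed [simp]: "g \<in> carrier G \<Longrightarrow> u g \<in> carrier Q"
    and u_one [simp]: "u \<one>\<^bsub>G\<^esub> = \<one>\<^bsub>Q\<^esub>"
    and u_idem: "g \<in> carrier G \<Longrightarrow> u g \<otimes>\<^bsub>Q\<^esub> u g = u g"
    and u_comm: "\<lbrakk>g \<in> carrier G; h \<in> carrier G\<rbrakk> \<Longrightarrow> u g \<otimes>\<^bsub>Q\<^esub> u h = u h \<otimes>\<^bsub>Q\<^esub> u g"
    and u_zero_factor: "\<lbrakk>s \<in> carrier G; g \<in> carrier G; h \<in> carrier G; \<sigma> g h = \<zero>\<^bsub>K\<^esub>\<rbrakk> \<Longrightarrow>
      u s \<otimes>\<^bsub>Q\<^esub> (u (s \<otimes>\<^bsub>G\<^esub> g) \<otimes>\<^bsub>Q\<^esub> u (s \<otimes>\<^bsub>G\<^esub> g \<otimes>\<^bsub>G\<^esub> h)) = \<zero>\<^bsub>Q\<^esub>"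
    and u_zero_cocycle: "\<lbrakk>s \<in> carrier G; g \<in> carrier G; h \<in> carrier G; t \<in> carrier G;
        \<sigma> g h \<otimes>\<^bsub>K\<^esub> \<sigma> (g \<otimes>\<^bsub>G\<^esub> h) t \<noteq> \<sigma> g (h \<otimes>\<^bsub>G\<^esub> t) \<otimes>\<^bsub>K\<^esub> \<sigma> h t\<rbrakk> \<Longrightarrow>
      u s \<otimes>\<^bsub>Q\<^esub> (u (s \<otimes>\<^bsub>G\<^esub> g) \<otimes>\<^bsub>Q\<^esub> (u (s \<otimes>\<^bsub>G\<^esub> g \<otimes>\<^bsub>G\<^esub> h) \<otimes>\<^bsub>Q\<^esub> u (s \<otimes>\<^bsub>G\<^esub> g \<otimes>\<^bsub>G\<^esub> h \<otimes>\<^bsub>G\<^esub> t))) = \<zero>\<^bsub>Q\<^esub>"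
begin

abbreviation "W \<equiv> word_prod Q u"

lemma u_funcset: "u \<in> carrier G \<rightarrow> carrier Q"
  by simp

lemma W_closed [simp]: "set w \<subseteq> carrier G \<Longrightarrow> W w \<in> carrier Q"
  by (rule Q.word_prod_closed[OF u_funcset]) auto

lemma u_absorb:
  assumes "set w \<subseteq> carrier G" "g \<in> set w"
  shows "u g \<otimes>\<^bsub>Q\<^esub> W w = W w"
  using assms
proof (induction w)
  case (Cons h w)
  then have closed: "g \<in> carrier G" "h \<in> carrier G" "W w \<in> carrier Q"
    by auto
  show ?case
  proof (cases "g = h")
    case True
    then show ?thesis
      using closed by (simp add: u_idem flip: Q.m_assoc)
  next
    case False
    then have "u h \<otimes>\<^bsub>Q\<^esub> (u g \<otimes>\<^bsub>Q\<^esub> W w) = u h \<otimes>\<^bsub>Q\<^esub> W w"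
      using Cons by simp
    then show ?thesis
      using closed by (simp add: u_comm[of g h] flip: Q.m_assoc)
  qed
qed simp

lemma u_W_comm:
  assumes "set w \<subseteq> carrier G" "g \<in> carrier G"
  shows "u g \<otimes>\<^bsub>Q\<^esub> W w = W w \<otimes>\<^bsub>Q\<^esub> u g"
  using assms
proof (induction w)
  case (Cons h w)
  have "u g \<otimes>\<^bsub>Q\<^esub> (u h \<otimes>\<^bsub>Q\<^esub> W w) = u h \<otimes>\<^bsub>Q\<^esub> (u g \<otimes>\<^bsub>Q\<^esub> W w)"
    using Cons.prems by (simp add: u_comm[of g h] flip: Q.m_assoc)
  then show ?case
    using Cons by (simp add: Q.m_assoc)
qed simp

lemma W_comm:
  assumes "set v \<subseteq> carrier G" "set w \<subseteq> carrier G"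
  shows "W v \<otimes>\<^bsub>Q\<^esub> W w = W w \<otimes>\<^bsub>Q\<^esub> W v"
  using assms
proof (induction v)
  case (Cons g v)
  have "u g \<otimes>\<^bsub>Q\<^esub> W v \<otimes>\<^bsub>Q\<^esub> W w = u g \<otimes>\<^bsub>Q\<^esub> W w \<otimes>\<^bsub>Q\<^esub> W v"
    using Cons by (simp add: Q.m_assoc)
  then show ?case
    using Cons.prems by (simp add: u_W_comm[of w] Q.m_assoc)
qed simp

lemma W_absorb:
  assumes "set v \<subseteq> set w" "set w \<subseteq> carrier G"
  shows "W v \<otimes>\<^bsub>Q\<^esub> W w = W w"
  using assms
proof (induction v)
  case (Cons g v)
  then have "u g \<otimes>\<^bsub>Q\<^esub> (W v \<otimes>\<^bsub>Q\<^esub> W w) = W w"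
    using u_absorb[of w g] by simp
  moreover have "g \<in> carrier G" "set v \<subseteq> carrier G"
    using Cons.prems by auto
  ultimately show ?case
    using Cons.prems by (simp add: Q.m_assoc)
qed simp

text \<open>Prefixing the letter \<open>1\<close> changes neither product and makes the letter sets
  equal. Each product then absorbs the other, and they commute.\<close>

lemma W_cong:
  assumes "insert \<one>\<^bsub>G\<^esub> (set v) = insert \<one>\<^bsub>G\<^esub> (set w)" "set v \<subseteq> carrier G" "set w \<subseteq> carrier G"
  shows "W v = W w"
proof -
  have "W (\<one>\<^bsub>G\<^esub> # v) \<otimes>\<^bsub>Q\<^esub> W (\<one>\<^bsub>G\<^esub> # w) = W (\<one>\<^bsub>G\<^esub> # w)"
    "W (\<one>\<^bsub>G\<^esub> # w) \<otimes>\<^bsub>Q\<^esub> W (\<one>\<^bsub>G\<^esub> # v) = W (\<one>\<^bsub>G\<^esub> # v)"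
    using assms by (intro W_absorb; auto)+
  then show ?thesis
    using assms W_comm[of v w] by simp
qed

text \<open>By absorption, a nonzero product over \<open>?S\<close> forces every product of letters
  from \<open>?S\<close> to be nonzero. The forbidden triples and quadruples have product zero, so
  none of them lies in \<open>?S\<close>.\<close>

lemma W_eq_zero:
  assumes w: "set w \<subseteq> carrier G" and S: "insert \<one>\<^bsub>G\<^esub> (set w) \<notin> factor_spectrum K G \<sigma>"
  shows "W w = \<zero>\<^bsub>Q\<^esub>"
proof (rule ccontr)
  let ?S = "insert \<one>\<^bsub>G\<^esub> (set w)"
  assume "W w \<noteq> \<zero>\<^bsub>Q\<^esub>"
  then have nonzero: "W v \<noteq> \<zero>\<^bsub>Q\<^esub>" if "set v \<subseteq> ?S" for v
    using that w W_absorb[of v "\<one>\<^bsub>G\<^esub> # w"] by force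
  have "?S \<in> factor_spectrum K G \<sigma>"
    unfolding factor_spectrum_def
  proof (intro CollectI conjI ballI impI)
    fix s g h assume s: "s \<in> carrier G" and g: "g \<in> carrier G" and h: "h \<in> carrier G"
    {
      assume "{s, s \<otimes>\<^bsub>G\<^esub> g, s \<otimes>\<^bsub>G\<^esub> g \<otimes>\<^bsub>G\<^esub> h} \<subseteq> ?S"
      then show "\<sigma> g h \<noteq> \<zero>\<^bsub>K\<^esub>"
        using nonzero[of "[s, s \<otimes>\<^bsub>G\<^esub> g, s \<otimes>\<^bsub>G\<^esub> g \<otimes>\<^bsub>G\<^esub> h]"] u_zero_factor[of s g h] s g h by auto
    }
    fix t assume t: "t \<in> carrier G"
    assume "{s, s \<otimes>\<^bsub>G\<^esub> g, s \<otimes>\<^bsub>G\<^esub> g \<otimes>\<^bsub>G\<^esub> h, s \<otimes>\<^bsub>G\<^esub> g \<otimes>\<^bsub>G\<^esub> h \<otimes>\<^bsub>G\<^esub> t} \<subseteq> ?S"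
    then show "\<sigma> g h \<otimes>\<^bsub>K\<^esub> \<sigma> (g \<otimes>\<^bsub>G\<^esub> h) t = \<sigma> g (h \<otimes>\<^bsub>G\<^esub> t) \<otimes>\<^bsub>K\<^esub> \<sigma> h t"
      using nonzero[of "[s, s \<otimes>\<^bsub>G\<^esub> g, s \<otimes>\<^bsub>G\<^esub> g \<otimes>\<^bsub>G\<^esub> h, s \<otimes>\<^bsub>G\<^esub> g \<otimes>\<^bsub>G\<^esub> h \<otimes>\<^bsub>G\<^esub> t]"]
        u_zero_cocycle[of s g h t] s g h t by auto
  qed (use w in auto)
  then show False
    using S by blast
qed

lemma free_ext_eq_zeroI:
  assumes p: "p \<in> carrier F"
    and sums: "\<And>S. \<lbrakk>finite S; S \<in> factor_spectrum K G \<sigma>\<rbrakk> \<Longrightarrow> char_sum K S p = \<zero>\<^bsub>K\<^esub>"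
  shows "free_ext K Q u p = \<zero>\<^bsub>Q\<^esub>"
  unfolding free_ext_def
proof (rule Q.M.finsum_zero_if_fibers_zero[where k = "\<lambda>w. insert \<one>\<^bsub>G\<^esub> (set w)"])
  have pD: "\<And>w. p w \<in> carrier K" "finite {w. p w \<noteq> \<zero>\<^bsub>K\<^esub>}" "\<And>w. p w \<noteq> \<zero>\<^bsub>K\<^esub> \<Longrightarrow> set w \<subseteq> carrier G"
    using p by (auto simp: K.free_algebra_carrier_iff)
  show "finite {w. p w \<noteq> \<zero>\<^bsub>K\<^esub>}"
    by (rule pD(2))
  fix w assume "w \<in> {w. p w \<noteq> \<zero>\<^bsub>K\<^esub>}"
  then have w: "set w \<subseteq> carrier G"
    using pD(3) by auto
  then show "p w \<odot>\<^bsub>Q\<^esub> W w \<in> carrier Q"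
    using pD(1) by simp
  let ?S = "insert \<one>\<^bsub>G\<^esub> (set w)"
  let ?B = "{v \<in> {w. p w \<noteq> \<zero>\<^bsub>K\<^esub>}. insert \<one>\<^bsub>G\<^esub> (set v) = ?S}"
  have "(\<Oplus>\<^bsub>Q\<^esub>v\<in>?B. p v \<odot>\<^bsub>Q\<^esub> W v) = (\<Oplus>\<^bsub>Q\<^esub>v\<in>?B. p v \<odot>\<^bsub>Q\<^esub> W w)"
  proof (rule Q.M.finsum_cong')
    show "(\<lambda>v. p v \<odot>\<^bsub>Q\<^esub> W w) \<in> ?B \<rightarrow> carrier Q"
      using pD(1) w by simp
    fix v assume "v \<in> ?B"
    then have "W v = W w"
      using pD(3)[of v] w by (intro W_cong) simp_all
    then show "p v \<odot>\<^bsub>Q\<^esub> W v = p v \<odot>\<^bsub>Q\<^esub> W w"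
      by simp
  qed simp
  also have "\<dots> = (\<Oplus>\<^bsub>K\<^esub>v\<in>?B. p v) \<odot>\<^bsub>Q\<^esub> W w"
    using pD w by (intro Q.finsum_smult_rdistr) auto
  also have "\<dots> = \<zero>\<^bsub>Q\<^esub>"
  \<comment> \<open>Inside the spectrum the scalar vanishes, outside it the product
    \<open>W w\<close> does.\<close>
  proof (cases "?S \<in> factor_spectrum K G \<sigma>")
    case True
    then show ?thesis
      using fiber_sum_eq_zero[OF p sums, of ?S] w by simp
  next
    case False
    then show ?thesis
      using W_eq_zero[OF w False] pD by (simp add: K.finsum_closed)
  qed
  finally show "(\<Oplus>\<^bsub>Q\<^esub>v\<in>?B. p v \<odot>\<^bsub>Q\<^esub> W v) = \<zero>\<^bsub>Q\<^esub>" .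
qed

end

section \<open>Evaluating the idempotents on functions\<close>

context normalized_factor
begin

text \<open>A preimage of \<open>e g\<close> in the free algebra. The free algebra plays two roles
  here: in \<open>idem_lift\<close> the letter \<open>g\<close> stands for the symbol [g], whereas
  under \<open>free_ext K A e\<close> it stands for the idempotent.\<close>

definition idem_lift :: "'g \<Rightarrow> 'g list \<Rightarrow> 'k"
  where "idem_lift g =
    (if \<sigma> g (inv\<^bsub>G\<^esub> g) \<noteq> \<zero>\<^bsub>K\<^esub>
     then inv\<^bsub>K\<^esub> (\<sigma> g (inv\<^bsub>G\<^esub> g)) \<odot>\<^bsub>F\<^esub> (free_gen K g \<otimes>\<^bsub>F\<^esub> free_gen K (inv\<^bsub>G\<^esub> g))
     else \<zero>\<^bsub>F\<^esub>)"

lemma inv_factor_closed: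
  assumes "g \<in> carrier G" "h \<in> carrier G" "\<sigma> g h \<noteq> \<zero>\<^bsub>K\<^esub>"
  shows "inv\<^bsub>K\<^esub> (\<sigma> g h) \<in> carrier K" "inv\<^bsub>K\<^esub> (\<sigma> g h) \<otimes>\<^bsub>K\<^esub> \<sigma> g h = \<one>\<^bsub>K\<^esub>"
proof -
  have "\<sigma> g h \<in> Units K"
    using assms by (simp add: K.field_Units factor_closed)
  then show "inv\<^bsub>K\<^esub> (\<sigma> g h) \<in> carrier K" "inv\<^bsub>K\<^esub> (\<sigma> g h) \<otimes>\<^bsub>K\<^esub> \<sigma> g h = \<one>\<^bsub>K\<^esub>"
    by simp_all
qed

lemma idem_lift_closed: "g \<in> carrier G \<Longrightarrow> idem_lift g \<in> carrier F"
  by (simp add: idem_lift_def free_gen_closed inv_factor_closed)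

lemma coset_idem_lift: "g \<in> carrier G \<Longrightarrow> coset (idem_lift g) = e g"
  by (simp add: idem_lift_def twisted_idem_def Let_def twisted_gen_def free_gen_closed
      inv_factor_closed alg_homD(5)[OF coset_hom])

text \<open>The two shifts visit \<open>1\<close>, \<open>g\<close>, \<open>1\<close>. If all these
  points lie in \<open>S\<close>, the scalar \<sigma>(g, inverse of g) appears and is cancelled by
  the normalisation, while the other scalar is \<open>1\<close> by
  \<open>factor_spectrum_one\<close>. If the normalising value is zero, the same triple shows that
  \<open>g\<close> is not in \<open>S\<close>.\<close>

lemma shift_idem_lift:
  assumes S: "S \<in> factor_spectrum K G \<sigma>" and g: "g \<in> carrier G" and f: "f \<in> fun_space K S"
  shows "free_ext K (fun_endo K S) (twisted_shift S) (idem_lift g) f \<one>\<^bsub>G\<^esub>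
    = (if g \<in> S then f \<one>\<^bsub>G\<^esub> else \<zero>\<^bsub>K\<^esub>)"
proof -
  note SD = factor_spectrumD[OF S]
  have E: "assoc_algebra K (fun_endo K S)"
    by (rule K.assoc_algebra_fun_endo)
  have shift: "twisted_shift S \<in> carrier G \<rightarrow> carrier (fun_endo K S)"
    using twisted_repD(1)[OF twisted_rep_shift[OF S]] by blast
  note hom = free_ext_alg_hom[OF E shift]
  show ?thesis
  proof (cases "\<sigma> g (inv\<^bsub>G\<^esub> g) = \<zero>\<^bsub>K\<^esub>")
    case True
    then have "g \<notin> S"
      using SD(3)[of g "inv\<^bsub>G\<^esub> g" "\<one>\<^bsub>G\<^esub>"] SD(2) g by auto
    then show ?thesis
      using True by (simp add: idem_lift_def free_ext_zero[OF E shift])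
  next
    case False
    have "free_ext K (fun_endo K S) (twisted_shift S) (idem_lift g)
        = inv\<^bsub>K\<^esub> (\<sigma> g (inv\<^bsub>G\<^esub> g)) \<odot>\<^bsub>fun_endo K S\<^esub> (twisted_shift S g \<otimes>\<^bsub>fun_endo K S\<^esub> twisted_shift S (inv\<^bsub>G\<^esub> g))"
      using g False
      by (simp add: idem_lift_def alg_homD(2,5)[OF hom] free_gen_closed inv_factor_closed
          free_ext_gen[OF E shift] del: K.fun_endo_sel)
    then have *: "free_ext K (fun_endo K S) (twisted_shift S) (idem_lift g) f \<one>\<^bsub>G\<^esub>
        = inv\<^bsub>K\<^esub> (\<sigma> g (inv\<^bsub>G\<^esub> g)) \<otimes>\<^bsub>K\<^esub> twisted_shift S g (twisted_shift S (inv\<^bsub>G\<^esub> g) f) \<one>\<^bsub>G\<^esub>"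
      by simp
    show ?thesis
    proof (cases "g \<in> S")
      case True
      have one: "\<sigma> (inv\<^bsub>G\<^esub> g) \<one>\<^bsub>G\<^esub> = \<one>\<^bsub>K\<^esub>"
        using factor_spectrum_one(1)[OF S, of "inv\<^bsub>G\<^esub> g" g] g True SD(2) by simp
      have "twisted_shift S g (twisted_shift S (inv\<^bsub>G\<^esub> g) f) \<one>\<^bsub>G\<^esub> = \<sigma> g (inv\<^bsub>G\<^esub> g) \<otimes>\<^bsub>K\<^esub> f \<one>\<^bsub>G\<^esub>"
        using True f g SD(2) K.fun_space_closed(1)[OF f]
        by (subst twisted_shift_twice[OF SD(1)]) (simp_all add: one)
      then show ?thesis
        using * True g False K.fun_space_closed(1)[OF f]
        by (simp add: inv_factor_closed factor_closed flip: K.m_assoc)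
    next
      case nS: False
      then show ?thesis
        using * g False by (simp add: twisted_shift_twice[OF SD(1)] inv_factor_closed)
    qed
  qed
qed

text \<open>Substituting \<open>idem_lift\<close> for the letters moves the relation satisfied by
  the idempotents into \<open>twisted_ideal\<close>, which the shift representation annihilates. One
  matrix entry of the resulting operator identity is the claim.\<close>

lemma char_sum_eq_zero:
  assumes p: "p \<in> carrier F" and zero: "free_ext K A e p = \<zero>\<^bsub>A\<^esub>"
    and S: "S \<in> factor_spectrum K G \<sigma>"
  shows "char_sum K S p = \<zero>\<^bsub>K\<^esub>"
proof -
  let ?E = "fun_endo K S"
  define \<Phi> where "\<Phi> = free_ext K ?E (twisted_shift S)"
  have E: "assoc_algebra K ?E"
    by (rule K.assoc_algebra_fun_endo)
  interpret E: assoc_algebra K ?E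
    by (rule E)
  have shift: "twisted_shift S \<in> carrier G \<rightarrow> carrier ?E"
    using twisted_repD(1)[OF twisted_rep_shift[OF S]] by blast
  have lift: "idem_lift \<in> carrier G \<rightarrow> carrier F"
    by (simp add: idem_lift_closed)
  have \<Phi>: "\<Phi> \<in> alg_hom K F ?E"
    unfolding \<Phi>_def by (rule free_ext_alg_hom[OF E shift])
  have \<Phi>_lift: "(\<lambda>g. \<Phi> (idem_lift g)) \<in> carrier G \<rightarrow> carrier ?E"
    using alg_homD(1)[OF \<Phi>] by (simp add: idem_lift_closed)
  have lift_p: "free_ext K F idem_lift p \<in> carrier F"
    by (rule free_ext_closed[OF F_assoc lift p])
  have "coset (free_ext K F idem_lift p) = free_ext K A (\<lambda>g. coset (idem_lift g)) p"
    by (rule alg_hom_free_ext[OF F_assoc A.assoc_algebra_axioms coset_hom lift p])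
  also have "\<dots> = free_ext K A e p"
    by (rule free_ext_cong[OF A.assoc_algebra_axioms p]) (simp_all add: coset_idem_lift)
  finally have "free_ext K F idem_lift p \<in> twisted_ideal K G \<sigma>"
    using zero coset_eq_zero[OF lift_p] by simp
  then have "\<Phi> (free_ext K F idem_lift p) = \<zero>\<^bsub>?E\<^esub>"
    unfolding \<Phi>_def by (rule free_ext_twisted_ideal[OF E twisted_rep_shift[OF S]])
  then have ext_zero: "free_ext K ?E (\<lambda>g. \<Phi> (idem_lift g)) p = \<zero>\<^bsub>?E\<^esub>"
    using alg_hom_free_ext[OF F_assoc E \<Phi> lift p] by (simp del: K.fun_endo_sel)
  have one_S: "\<one>\<^bsub>G\<^esub> \<in> S"
    by (rule factor_spectrumD(2)[OF S])
  \<comment> \<open>Evaluation at \<open>1\<close> is a common eigenvector of the operators in the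
    dual space, so along a word the eigenvalues \<open>1\<close> and \<open>0\<close>
    multiply.\<close>
  have word: "word_prod ?E (\<lambda>g. \<Phi> (idem_lift g)) w f \<one>\<^bsub>G\<^esub> = (if set w \<subseteq> S then f \<one>\<^bsub>G\<^esub> else \<zero>\<^bsub>K\<^esub>)"
    if "w \<in> lists (carrier G)" "f \<in> fun_space K S" for w f
    using that
  proof (induction w)
    case (Cons g w)
    have "word_prod ?E (\<lambda>g. \<Phi> (idem_lift g)) w f \<in> fun_space K S"
      by (rule K.fun_endoD(1)[OF E.word_prod_closed[OF \<Phi>_lift Cons(2)]])
    then show ?case
      using Cons shift_idem_lift[OF S Cons(1)] by (simp add: \<Phi>_def)
  qed simp
  \<comment> \<open>The indicator of \<open>1\<close>, chosen because its value at \<open>1\<close>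
    is \<open>1\<close>: the coefficients then come out unchanged.\<close>
  define f where "f s = (if s = \<one>\<^bsub>G\<^esub> then \<one>\<^bsub>K\<^esub> else \<zero>\<^bsub>K\<^esub>)" for s
  have f: "f \<in> fun_space K S"
    using one_S by (auto simp: f_def fun_space_def)
  have pD: "\<And>w. p w \<in> carrier K" "finite {w. p w \<noteq> \<zero>\<^bsub>K\<^esub>}" "\<And>w. p w \<noteq> \<zero>\<^bsub>K\<^esub> \<Longrightarrow> w \<in> lists (carrier G)"
    using p unfolding K.free_algebra_carrier_iff by blast+
  have "\<zero>\<^bsub>K\<^esub> = free_ext K ?E (\<lambda>g. \<Phi> (idem_lift g)) p f \<one>\<^bsub>G\<^esub>"
    unfolding ext_zero by simp
  also have "\<dots> = (\<Oplus>\<^bsub>K\<^esub>w\<in>{w. p w \<noteq> \<zero>\<^bsub>K\<^esub>}. (p w \<odot>\<^bsub>?E\<^esub> word_prod ?E (\<lambda>g. \<Phi> (idem_lift g)) w) f \<one>\<^bsub>G\<^esub>)"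
    unfolding free_ext_def
    by (rule K.fun_endo_finsum)
      (use pD E.word_prod_closed[OF \<Phi>_lift] in \<open>auto simp del: K.fun_endo_sel in_lists_conv_set\<close>)
  also have "\<dots> = (\<Oplus>\<^bsub>K\<^esub>w\<in>{w. p w \<noteq> \<zero>\<^bsub>K\<^esub>}. if set w \<subseteq> S then p w else \<zero>\<^bsub>K\<^esub>)"
    using pD f by (intro K.finsum_cong') (auto simp: word f_def simp del: in_lists_conv_set)
  also have "\<dots> = char_sum K S p"
    unfolding char_sum_def using pD by (intro K.add.finprod_mono_neutral_cong_right) auto
  finally show ?thesis ..
qed

section \<open>The idempotent subalgebra as an image of the free algebra\<close>

abbreviation "B \<equiv> twisted_B K G \<sigma>"

lemma e_funcset: "e \<in> carrier G \<rightarrow> carrier A"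
  by simp

lemma generated_subalgebra_idem:
  "generated_subalgebra K A (e ` carrier G) = free_ext K A e ` carrier F"
proof (rule generated_subalgebra_eq_image[OF F_assoc A.assoc_algebra_axioms])
  show "free_ext K A e \<in> alg_hom K F A"
    by (rule free_ext_alg_hom[OF A.assoc_algebra_axioms e_funcset])
  show "e ` carrier G \<subseteq> free_ext K A e ` carrier F"
    using free_ext_gen[OF A.assoc_algebra_axioms e_funcset, symmetric] free_gen_closed by blast
qed (rule free_ext_image_subset[OF A.assoc_algebra_axioms e_funcset])

lemma B_sel [simp]:
  "carrier B = free_ext K A e ` carrier F"
  "mult B = mult A" "one B = one A" "zero B = zero A" "add B = add A" "smult B = smult A"
  by (simp_all add: twisted_B_def generated_subalgebra_idem)

lemma B_assoc: "assoc_algebra K B"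
  unfolding twisted_B_def generated_subalgebra_idem
  using alg_hom_image_subring[OF F_assoc A.assoc_algebra_axioms
      free_ext_alg_hom[OF A.assoc_algebra_axioms e_funcset]]
  by (rule assoc_algebra_subalgebra[OF A.assoc_algebra_axioms])

lemma e_in_B: "g \<in> carrier G \<Longrightarrow> e g \<in> carrier B"
  using free_ext_gen[OF A.assoc_algebra_axioms e_funcset, symmetric] free_gen_closed by (simp add: image_eqI)

lemma e_funcset_B: "e \<in> carrier G \<rightarrow> carrier B"
  using e_in_B by blast

lemma B_hom: "free_ext K B e \<in> alg_hom K F B"
  by (rule free_ext_alg_hom[OF B_assoc e_funcset_B])

lemma free_ext_B_eq:
  assumes "p \<in> carrier F"
  shows "free_ext K B e p = free_ext K A e p"
proof -
  have "(\<lambda>y. y) \<in> alg_hom K B A"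
    using free_ext_closed[OF A.assoc_algebra_axioms e_funcset] by (intro alg_homI) auto
  from alg_hom_free_ext[OF B_assoc A.assoc_algebra_axioms this e_funcset_B assms]
  show ?thesis .
qed

lemma B_surj: "free_ext K B e ` carrier F = carrier B"
  by (simp add: free_ext_B_eq cong: image_cong_simp)

lemma idempotent_system_B: "idempotent_system K G \<sigma> B e"
proof -
  interpret B: assoc_algebra K B
    by (rule B_assoc)
  show ?thesis
    by unfold_locales
      (use e_in_B e_zero_factor e_zero_cocycle in \<open>simp_all add: e_idem e_comm del: B_sel(1)\<close>)
qed

text \<open>For the constant factor \<open>1\<close> the spectrum consists of all subsets containing
  \<open>1\<close>, so the same statement also describes the kernel of the map onto
  \<open>par_B\<close>.\<close>

lemma free_ext_B_eq_zero_iff: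
  assumes "p \<in> carrier F"
  shows "free_ext K B e p = \<zero>\<^bsub>B\<^esub> \<longleftrightarrow>
    (\<forall>S. finite S \<and> S \<in> factor_spectrum K G \<sigma> \<longrightarrow> char_sum K S p = \<zero>\<^bsub>K\<^esub>)"
  using idempotent_system.free_ext_eq_zeroI[OF idempotent_system_B assms]
    char_sum_eq_zero[OF assms] free_ext_B_eq[OF assms] by (simp only: B_sel) blast

end

section \<open>The isomorphism\<close>

text \<open>At g = h = 1 the left-hand relation says that \<sigma>(1,1) fixes the unit of
  \<open>R\<close>. As this unit is nonzero and \<open>K\<close> is a field, the scalar must be
  \<open>1\<close>.\<close>

lemma normalized_factor_if_pm:
  assumes "field K" "group G" "\<sigma> \<in> pm TYPE('r) K G"
  shows "normalized_factor K G \<sigma>"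
proof -
  interpret K: field K by fact
  interpret G: group G by fact
  obtain R :: "('a, 'r) module" and \<Gamma> where rep: "partial_proj_rep K G R \<Gamma> \<sigma>"
    using assms(3) by (auto simp: pm_def)
  have R: "assoc_algebra K R"
    using rep by (simp add: partial_proj_rep_def)
  interpret R: assoc_algebra K R by (rule R)
  have \<sigma>: "\<sigma> g h \<in> carrier K" if "g \<in> carrier G" "h \<in> carrier G" for g h
  proof -
    have "\<sigma> \<in> carrier G \<rightarrow> carrier G \<rightarrow> carrier K"
      using rep by (simp add: partial_proj_rep_def)
    then show ?thesis
      using that by blast
  qed
  have "\<Gamma> (inv\<^bsub>G\<^esub> \<one>\<^bsub>G\<^esub>) \<otimes>\<^bsub>R\<^esub> \<Gamma> \<one>\<^bsub>G\<^esub> \<otimes>\<^bsub>R\<^esub> \<Gamma> \<one>\<^bsub>G\<^esub>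
      = \<sigma> \<one>\<^bsub>G\<^esub> \<one>\<^bsub>G\<^esub> \<odot>\<^bsub>R\<^esub> (\<Gamma> (inv\<^bsub>G\<^esub> \<one>\<^bsub>G\<^esub>) \<otimes>\<^bsub>R\<^esub> \<Gamma> (\<one>\<^bsub>G\<^esub> \<otimes>\<^bsub>G\<^esub> \<one>\<^bsub>G\<^esub>))"
    using rep unfolding partial_proj_rep_def by blast
  moreover have one: "\<Gamma> \<one>\<^bsub>G\<^esub> = \<one>\<^bsub>R\<^esub>" "\<one>\<^bsub>R\<^esub> \<noteq> \<zero>\<^bsub>R\<^esub>"
    using rep by (auto simp: partial_proj_rep_def)
  ultimately have "\<sigma> \<one>\<^bsub>G\<^esub> \<one>\<^bsub>G\<^esub> \<odot>\<^bsub>R\<^esub> \<one>\<^bsub>R\<^esub> = \<one>\<^bsub>R\<^esub>"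
    by simp
  then have zero: "(\<sigma> \<one>\<^bsub>G\<^esub> \<one>\<^bsub>G\<^esub> \<ominus>\<^bsub>K\<^esub> \<one>\<^bsub>K\<^esub>) \<odot>\<^bsub>R\<^esub> \<one>\<^bsub>R\<^esub> = \<zero>\<^bsub>R\<^esub>"
    using \<sigma> by (simp add: K.minus_eq R.smult_l_distr R.smult_l_minus R.M.r_neg)
  have "\<sigma> \<one>\<^bsub>G\<^esub> \<one>\<^bsub>G\<^esub> = \<one>\<^bsub>K\<^esub>"
  proof (rule ccontr)
    let ?d = "\<sigma> \<one>\<^bsub>G\<^esub> \<one>\<^bsub>G\<^esub> \<ominus>\<^bsub>K\<^esub> \<one>\<^bsub>K\<^esub>"
    assume "\<sigma> \<one>\<^bsub>G\<^esub> \<one>\<^bsub>G\<^esub> \<noteq> \<one>\<^bsub>K\<^esub>"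
    then have d: "?d \<in> Units K"
      using \<sigma> by (simp add: K.field_Units)
    then have "\<one>\<^bsub>R\<^esub> = inv\<^bsub>K\<^esub> ?d \<odot>\<^bsub>R\<^esub> (?d \<odot>\<^bsub>R\<^esub> \<one>\<^bsub>R\<^esub>)"
      by (simp add: K.Units_closed flip: R.smult_assoc1)
    then show False
      using d one(2) by (simp add: zero)
  qed
  then show ?thesis
    using assms(1,2) \<sigma> by (simp add: normalized_factor_def)
qed

lemma normalized_factor_trivial:
  assumes "field K" "group G"
  shows "normalized_factor K G (trivial_factor K)"
proof -
  interpret K: field K by fact
  show ?thesis
    using assms by (simp add: normalized_factor_def)
qed

context normalized_factor
begin

lemma factor_ideal_alg_iso:
  "\<exists>f. f \<in> alg_iso K (quotient_algebra (par_B K G) (factor_ideal K G \<sigma>)) (twisted_B K G \<sigma>)"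
proof -
  interpret one: normalized_factor K G "trivial_factor K"
    by (rule normalized_factor_trivial[OF field_K group_G])
  \<comment> \<open>\<open>par_idem\<close> carries no normalising scalar; for the constant factor
    the scalar in \<open>twisted_idem\<close> is the inverse of \<open>1\<close>.\<close>
  have idem: "par_idem K G g = one.e g" if "g \<in> carrier G" for g
    using that one.x_closed by (simp add: twisted_idem_def Let_def par_idem_def par_gen_def par_algebra_def)
  have par_B: "par_B K G = one.B"
    unfolding par_B_def twisted_B_def par_algebra_def using idem by (simp cong: image_cong)
  let ?I = "factor_ideal K G \<sigma>"
  let ?Q = "quotient_algebra one.B ?I"
  let ?\<psi> = "free_ext K one.B one.e"
  interpret oneB: assoc_algebra K one.B
    by (rule one.B_assoc)
  interpret B: assoc_algebra K B
    by (rule B_assoc)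
  define gens where "gens =
      {one.e s \<otimes>\<^bsub>one.B\<^esub> one.e (s \<otimes>\<^bsub>G\<^esub> g) \<otimes>\<^bsub>one.B\<^esub> one.e (s \<otimes>\<^bsub>G\<^esub> g \<otimes>\<^bsub>G\<^esub> h) | s g h.
          s \<in> carrier G \<and> g \<in> carrier G \<and> h \<in> carrier G \<and> \<sigma> g h = \<zero>\<^bsub>K\<^esub>}
       \<union> {one.e s \<otimes>\<^bsub>one.B\<^esub> one.e (s \<otimes>\<^bsub>G\<^esub> g) \<otimes>\<^bsub>one.B\<^esub> one.e (s \<otimes>\<^bsub>G\<^esub> g \<otimes>\<^bsub>G\<^esub> h)
             \<otimes>\<^bsub>one.B\<^esub> one.e (s \<otimes>\<^bsub>G\<^esub> g \<otimes>\<^bsub>G\<^esub> h \<otimes>\<^bsub>G\<^esub> t) | s g h t.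
          s \<in> carrier G \<and> g \<in> carrier G \<and> h \<in> carrier G \<and> t \<in> carrier G \<and>
          \<sigma> g h \<otimes>\<^bsub>K\<^esub> \<sigma> (g \<otimes>\<^bsub>G\<^esub> h) t \<noteq> \<sigma> g (h \<otimes>\<^bsub>G\<^esub> t) \<otimes>\<^bsub>K\<^esub> \<sigma> h t}"
  have gensI1: "one.e s \<otimes>\<^bsub>one.B\<^esub> one.e (s \<otimes>\<^bsub>G\<^esub> g) \<otimes>\<^bsub>one.B\<^esub> one.e (s \<otimes>\<^bsub>G\<^esub> g \<otimes>\<^bsub>G\<^esub> h) \<in> gens"
    if "s \<in> carrier G" "g \<in> carrier G" "h \<in> carrier G" "\<sigma> g h = \<zero>\<^bsub>K\<^esub>" for s g h
    unfolding gens_def by (rule UnI1, rule CollectI, intro exI conjI, rule refl, (rule that)+)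
  have gensI2: "one.e s \<otimes>\<^bsub>one.B\<^esub> one.e (s \<otimes>\<^bsub>G\<^esub> g) \<otimes>\<^bsub>one.B\<^esub> one.e (s \<otimes>\<^bsub>G\<^esub> g \<otimes>\<^bsub>G\<^esub> h)
      \<otimes>\<^bsub>one.B\<^esub> one.e (s \<otimes>\<^bsub>G\<^esub> g \<otimes>\<^bsub>G\<^esub> h \<otimes>\<^bsub>G\<^esub> t) \<in> gens"
    if "s \<in> carrier G" "g \<in> carrier G" "h \<in> carrier G" "t \<in> carrier G"
      "\<sigma> g h \<otimes>\<^bsub>K\<^esub> \<sigma> (g \<otimes>\<^bsub>G\<^esub> h) t \<noteq> \<sigma> g (h \<otimes>\<^bsub>G\<^esub> t) \<otimes>\<^bsub>K\<^esub> \<sigma> h t" for s g h t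
    unfolding gens_def by (rule UnI2, rule CollectI, intro exI conjI, rule refl, (rule that)+)
  \<comment> \<open>The equality \<open>idem\<close> is available only on \<open>carrier G\<close>,
    so the two generating sets have to be matched element by element.\<close>
  have I: "?I = Idl\<^bsub>one.B\<^esub> gens"
    unfolding factor_ideal_def Let_def par_B gens_def
    by (intro arg_cong[where f = "genideal one.B"] arg_cong2[where f = "(\<union>)"])
      (auto simp: idem simp del: one.B_sel, (metis idem G.m_closed)+)
  have e_in: "one.e g \<in> carrier one.B" if "g \<in> carrier G" for g
    by (rule one.e_in_B[OF that])
  have gens: "gens \<subseteq> carrier one.B"
    unfolding gens_def using e_in by (auto simp del: one.B_sel)
  have ideal: "ideal ?I one.B"
    unfolding I by (rule oneB.genideal_ideal[OF gens])
  interpret I: ideal ?I one.B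
    by (rule ideal)
  have gens_I: "gens \<subseteq> ?I"
    unfolding I by (rule oneB.genideal_self[OF gens])
  have Q: "assoc_algebra K ?Q"
    by (rule assoc_algebra_quotient[OF one.B_assoc ideal])
  interpret Q: assoc_algebra K ?Q
    by (rule Q)
  let ?c = "(+>\<^bsub>one.B\<^esub>) ?I"
  have c: "?c \<in> alg_hom K one.B ?Q"
    by (rule coset_in_alg_hom[OF one.B_assoc ideal])
  note cD = alg_homD[OF c]
  have c_zero: "?c y = \<zero>\<^bsub>?Q\<^esub> \<longleftrightarrow> y \<in> ?I" if "y \<in> carrier one.B" for y
    unfolding quotient_algebra_sel by (rule I.coset_eq_zero_iff[OF that])
  have \<psi>_closed: "?\<psi> p \<in> carrier one.B" if "p \<in> carrier F" for p
    by (rule alg_homD(1)[OF one.B_hom that])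
  have surj: "(\<lambda>p. ?c (?\<psi> p)) ` carrier F = carrier ?Q"
    unfolding coset_surj one.B_surj[symmetric] image_image ..
  \<comment> \<open>Commutation and idempotency descend from the untwisted idempotents; the two
    vanishing laws hold because their left-hand sides are cosets of generators of the ideal.\<close>
  have "idempotent_system K G \<sigma> ?Q (\<lambda>g. ?c (one.e g))"
  proof (unfold_locales)
    show "?c (one.e \<one>\<^bsub>G\<^esub>) = \<one>\<^bsub>?Q\<^esub>"
      using cD(4) by simp
  next
    fix g assume g: "g \<in> carrier G"
    show "?c (one.e g) \<in> carrier ?Q"
      by (rule cD(1)[OF e_in[OF g]])
    show "?c (one.e g) \<otimes>\<^bsub>?Q\<^esub> ?c (one.e g) = ?c (one.e g)"
      unfolding cD(2)[OF e_in[OF g] e_in[OF g], symmetric] using g by (simp add: one.e_idem)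
    fix h assume h: "h \<in> carrier G"
    show "?c (one.e g) \<otimes>\<^bsub>?Q\<^esub> ?c (one.e h) = ?c (one.e h) \<otimes>\<^bsub>?Q\<^esub> ?c (one.e g)"
      unfolding cD(2)[OF e_in[OF g] e_in[OF h], symmetric] cD(2)[OF e_in[OF h] e_in[OF g], symmetric]
      using one.e_comm[OF g h] by simp
  next
    fix s g h assume s: "s \<in> carrier G" and g: "g \<in> carrier G" and h: "h \<in> carrier G"
    note ins = e_in[OF s] e_in[OF G.m_closed[OF s g]] e_in[OF G.m_closed[OF G.m_closed[OF s g] h]]
    {
      assume zero: "\<sigma> g h = \<zero>\<^bsub>K\<^esub>"
      have "one.e s \<otimes>\<^bsub>one.B\<^esub> one.e (s \<otimes>\<^bsub>G\<^esub> g) \<otimes>\<^bsub>one.B\<^esub> one.e (s \<otimes>\<^bsub>G\<^esub> g \<otimes>\<^bsub>G\<^esub> h) \<in> ?I"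
        using gens_I gensI1[OF s g h zero] by (rule subsetD)
      then have "one.e s \<otimes>\<^bsub>one.B\<^esub> (one.e (s \<otimes>\<^bsub>G\<^esub> g) \<otimes>\<^bsub>one.B\<^esub> one.e (s \<otimes>\<^bsub>G\<^esub> g \<otimes>\<^bsub>G\<^esub> h)) \<in> ?I"
        using ins by (simp only: oneB.m_assoc)
      then show "?c (one.e s) \<otimes>\<^bsub>?Q\<^esub> (?c (one.e (s \<otimes>\<^bsub>G\<^esub> g)) \<otimes>\<^bsub>?Q\<^esub> ?c (one.e (s \<otimes>\<^bsub>G\<^esub> g \<otimes>\<^bsub>G\<^esub> h))) = \<zero>\<^bsub>?Q\<^esub>"
        using ins by (simp only: cD(2)[symmetric] c_zero oneB.m_closed)
    }
    fix t assume t: "t \<in> carrier G"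
    note ins = ins e_in[OF G.m_closed[OF G.m_closed[OF G.m_closed[OF s g] h] t]]
    assume neq: "\<sigma> g h \<otimes>\<^bsub>K\<^esub> \<sigma> (g \<otimes>\<^bsub>G\<^esub> h) t \<noteq> \<sigma> g (h \<otimes>\<^bsub>G\<^esub> t) \<otimes>\<^bsub>K\<^esub> \<sigma> h t"
    have "one.e s \<otimes>\<^bsub>one.B\<^esub> one.e (s \<otimes>\<^bsub>G\<^esub> g) \<otimes>\<^bsub>one.B\<^esub> one.e (s \<otimes>\<^bsub>G\<^esub> g \<otimes>\<^bsub>G\<^esub> h)
        \<otimes>\<^bsub>one.B\<^esub> one.e (s \<otimes>\<^bsub>G\<^esub> g \<otimes>\<^bsub>G\<^esub> h \<otimes>\<^bsub>G\<^esub> t) \<in> ?I"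
      using gens_I gensI2[OF s g h t neq] by (rule subsetD)
    then have "one.e s \<otimes>\<^bsub>one.B\<^esub> (one.e (s \<otimes>\<^bsub>G\<^esub> g) \<otimes>\<^bsub>one.B\<^esub> (one.e (s \<otimes>\<^bsub>G\<^esub> g \<otimes>\<^bsub>G\<^esub> h)
        \<otimes>\<^bsub>one.B\<^esub> one.e (s \<otimes>\<^bsub>G\<^esub> g \<otimes>\<^bsub>G\<^esub> h \<otimes>\<^bsub>G\<^esub> t))) \<in> ?I"
      using ins by (simp only: oneB.m_assoc oneB.m_closed)
    then show "?c (one.e s) \<otimes>\<^bsub>?Q\<^esub> (?c (one.e (s \<otimes>\<^bsub>G\<^esub> g)) \<otimes>\<^bsub>?Q\<^esub>
        (?c (one.e (s \<otimes>\<^bsub>G\<^esub> g \<otimes>\<^bsub>G\<^esub> h)) \<otimes>\<^bsub>?Q\<^esub> ?c (one.e (s \<otimes>\<^bsub>G\<^esub> g \<otimes>\<^bsub>G\<^esub> h \<otimes>\<^bsub>G\<^esub> t)))) = \<zero>\<^bsub>?Q\<^esub>"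
      using ins by (simp only: cD(2)[symmetric] c_zero oneB.m_closed)
  qed
  note Q_system = this
  \<comment> \<open>More sets are admissible for the constant factor, so vanishing in the untwisted
    algebra is the stronger condition.\<close>
  have spectrum: "S \<in> factor_spectrum K G (trivial_factor K)" if "S \<in> factor_spectrum K G \<sigma>" for S
    using that by (simp add: factor_spectrum_def)
  have kernel_one: "free_ext K B e p = \<zero>\<^bsub>B\<^esub>" if "p \<in> carrier F" "?\<psi> p = \<zero>\<^bsub>one.B\<^esub>" for p
    using that spectrum one.free_ext_B_eq_zero_iff[of p] free_ext_B_eq_zero_iff[of p] by blast
  \<comment> \<open>This inclusion of kernels provides the homomorphism from the untwisted to the
    twisted algebra that matches the idempotents. It serves to bound the ideal from above: its
    kernel contains the generators.\<close>
  obtain \<theta> where \<theta>: "\<theta> \<in> alg_hom K one.B B" "\<And>p. p \<in> carrier F \<Longrightarrow> \<theta> (?\<psi> p) = free_ext K B e p"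
    using alg_hom_factor[OF F_assoc one.B_assoc B_assoc one.B_hom B_hom one.B_surj] kernel_one by metis
  interpret \<theta>: ring_hom_ring one.B B \<theta>
    by (rule alg_hom_ring_hom_ring[OF one.B_assoc B_assoc \<theta>(1)])
  have \<theta>_e: "\<theta> (one.e g) = e g" if "g \<in> carrier G" for g
    using \<theta>(2)[OF free_gen_closed[OF that]] that
    by (simp add: free_ext_gen[OF B_assoc e_funcset_B] free_ext_gen[OF one.B_assoc one.e_funcset_B])
  have "\<theta> y = \<zero>\<^bsub>B\<^esub>" if "y \<in> gens" for y
    using that unfolding gens_def
  proof (elim UnE CollectE exE conjE)
    fix s g h assume y: "y = one.e s \<otimes>\<^bsub>one.B\<^esub> one.e (s \<otimes>\<^bsub>G\<^esub> g) \<otimes>\<^bsub>one.B\<^esub> one.e (s \<otimes>\<^bsub>G\<^esub> g \<otimes>\<^bsub>G\<^esub> h)"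
      and *: "s \<in> carrier G" "g \<in> carrier G" "h \<in> carrier G" "\<sigma> g h = \<zero>\<^bsub>K\<^esub>"
    have "\<theta> y = e s \<otimes>\<^bsub>B\<^esub> e (s \<otimes>\<^bsub>G\<^esub> g) \<otimes>\<^bsub>B\<^esub> e (s \<otimes>\<^bsub>G\<^esub> g \<otimes>\<^bsub>G\<^esub> h)"
      unfolding y using * e_in by (simp add: \<theta>_e del: one.B_sel B_sel)
    also have "\<dots> = \<zero>\<^bsub>B\<^esub>"
      using * e_zero_factor[OF *] by (simp add: A.m_assoc)
    finally show ?thesis .
  next
    fix s g h t assume y: "y = one.e s \<otimes>\<^bsub>one.B\<^esub> one.e (s \<otimes>\<^bsub>G\<^esub> g) \<otimes>\<^bsub>one.B\<^esub> one.e (s \<otimes>\<^bsub>G\<^esub> g \<otimes>\<^bsub>G\<^esub> h)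
        \<otimes>\<^bsub>one.B\<^esub> one.e (s \<otimes>\<^bsub>G\<^esub> g \<otimes>\<^bsub>G\<^esub> h \<otimes>\<^bsub>G\<^esub> t)"
      and *: "s \<in> carrier G" "g \<in> carrier G" "h \<in> carrier G" "t \<in> carrier G"
        "\<sigma> g h \<otimes>\<^bsub>K\<^esub> \<sigma> (g \<otimes>\<^bsub>G\<^esub> h) t \<noteq> \<sigma> g (h \<otimes>\<^bsub>G\<^esub> t) \<otimes>\<^bsub>K\<^esub> \<sigma> h t"
    have "\<theta> y = e s \<otimes>\<^bsub>B\<^esub> e (s \<otimes>\<^bsub>G\<^esub> g) \<otimes>\<^bsub>B\<^esub> e (s \<otimes>\<^bsub>G\<^esub> g \<otimes>\<^bsub>G\<^esub> h) \<otimes>\<^bsub>B\<^esub> e (s \<otimes>\<^bsub>G\<^esub> g \<otimes>\<^bsub>G\<^esub> h \<otimes>\<^bsub>G\<^esub> t)"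
      unfolding y using * e_in by (simp add: \<theta>_e del: one.B_sel B_sel)
    also have "\<dots> = \<zero>\<^bsub>B\<^esub>"
      using * e_zero_cocycle[OF *] by (simp add: A.m_assoc)
    finally show ?thesis .
  qed
  then have "gens \<subseteq> a_kernel one.B B \<theta>"
    using gens unfolding a_kernel_def' by blast
  then have I_kernel: "?I \<subseteq> a_kernel one.B B \<theta>"
    unfolding I by (rule oneB.genideal_minimal[OF \<theta>.kernel_is_ideal])
  \<comment> \<open>From left to right, \<theta> kills the ideal. From right to left, vanishing in
    the twisted algebra makes all sums over the spectrum zero, and the quotient satisfies the
    criterion \<open>free_ext_eq_zeroI\<close>.\<close>
  have "?c (?\<psi> p) = \<zero>\<^bsub>?Q\<^esub> \<longleftrightarrow> free_ext K B e p = \<zero>\<^bsub>B\<^esub>" if p: "p \<in> carrier F" for p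
  proof
    assume "?c (?\<psi> p) = \<zero>\<^bsub>?Q\<^esub>"
    then have "\<theta> (?\<psi> p) = \<zero>\<^bsub>B\<^esub>"
      using I_kernel c_zero[OF \<psi>_closed[OF p]] unfolding a_kernel_def' by blast
    then show "free_ext K B e p = \<zero>\<^bsub>B\<^esub>"
      using \<theta>(2)[OF p] by metis
  next
    assume "free_ext K B e p = \<zero>\<^bsub>B\<^esub>"
    then have "free_ext K ?Q (\<lambda>g. ?c (one.e g)) p = \<zero>\<^bsub>?Q\<^esub>"
      using idempotent_system.free_ext_eq_zeroI[OF Q_system p] free_ext_B_eq_zero_iff[OF p] by blast
    then show "?c (?\<psi> p) = \<zero>\<^bsub>?Q\<^esub>"
      using alg_hom_free_ext[OF one.B_assoc Q c one.e_funcset_B p] by metis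
  qed
  from alg_iso_if_same_kernel[OF F_assoc Q B_assoc alg_hom_compose[OF one.B_hom c] B_hom surj B_surj this]
  show ?thesis
    unfolding par_B by blast
qed

end

theorem proposition4p2:
  fixes K :: "('k, 'm) ring_scheme" and G :: "('g, 'n) monoid_scheme"
    and \<sigma> :: "'g \<Rightarrow> 'g \<Rightarrow> 'k"
  assumes "field K" and "group G" and "\<sigma> \<in> pm TYPE('r) K G"
  shows "\<exists>f. f \<in> alg_iso K (quotient_algebra (par_B K G) (factor_ideal K G \<sigma>)) (twisted_B K G \<sigma>)"
  by (rule normalized_factor.factor_ideal_alg_iso[OF normalized_factor_if_pm[OF assms]])

end
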